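(* Let $f\in\mathcal{H}^1$, $N\ge2$, and let $(w,p)\in C^\ell\big([0,T),\mathcal{O}\times\mathcal{H}^{1,+}_0\big)$, $\ell\ge2$, $T>0$, be the solution of the Hamiltonian equation with Hamiltonian $H_f$ and initial data $(w_0,p_0)\in\mathcal{HF}_N$. Then the $w$-component of the solution belongs to $\mathcal{F}_N$, $w\in C^\ell([0,T),\mathcal{F}_N)$, and the curve $(w,\Pi^+_{\le N}p)\in C^\ell([0,T),\mathcal{PF}_N)$ is a solution of the Hamiltonian equation on $\mathcal{PF}_N$ with Hamiltonian $\widetilde H_f:=H_f|_{\mathcal{PF}_N}$ and initial data $(w_0,\Pi^+_{\le N}p_0)$. The flow of $\widetilde H_f$ on $\mathcal{PF}_N$ has $N$ integrals in involution, namely $\widetilde J^f_k:=J^f_k|_{\mathcal{PF}_N}$, $1\le k\le N$. These statements also hold with $H_f$ replaced by $J^f_k$, $1\le k\le N$ (and $\widetilde H_f$ replaced by $\widetilde J^f_k$).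
   Context: All spaces are complex. $\mathbb{T}=\mathbb{R}/\mathbb{Z}$, $f_k=(f)_k=\int_0^1 f(y)e^{-2\pi i k y}\,dy$, $\langle k\rangle:=|k|$ for $k\neq0$, $\langle0\rangle:=1$, $e_k(y)=e^{2\pi i k y}$. $\mathcal{H}^1$ is the Hilbert space of functions $f:\mathbb{T}\to\mathbb{C}$ with $\|f\|_{\mathcal{H}^1}=(\sum_{k}|f_k|^2\langle k\rangle^2)^{1/2}<\infty$ (a Banach algebra). $\mathcal{H}^{1,+}=\{f_k=0 \text{ for } k<0\}$, $\mathcal{H}^{1,+}_0=\{f_k=0\text{ for }k\le 0\}$, with Fourier-truncation projections $\Pi^+,\Pi^+_0$. The bilinear pairing is $\langle f,g\rangle=\sum_{k\in\mathbb{Z}}f_kg_k$, $\check f(y):=f(-y)$. $\mathcal{O}:=\{w\in\mathcal{H}^{1,+}_0: w(y)\ne0\ \forall y\in\mathbb{T}\}$. Shift: $(Lf)(y)=f(y)e^{-2\pi i y}$. For $w\in\mathcal{H}^{1,+}_0$, $k\ge1$: $A_k(w)g=g\,\Pi^+(L^{k+1}w)-w\,\Pi^+(L^{k+1}g)$, $\Gamma(w)p=\Pi^+_0(w\check p)$, $I_k(w,p)=\langle A_k(w)\Gamma(w)p,p\rangle$. For $(w,p)\in\mathcal{O}\times\mathcal{H}^{1,+}_0$: $H_f(w,p)=\langle w,p^2\rangle+\int_0^1 f(y)/w(y)\,dy$; $J^f_k(w,p)=I_k(w,p)-\big(w\,\Pi^+_0(f/w)\big)_{k+1}$. For a $C^1$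 function $F$ on $\mathcal{O}\times\mathcal{H}^{1,+}_0$, $X_F=(\nabla_pF,-\nabla_wF)$ with $\langle\nabla_wF,\delta w\rangle=(D_1F)(\delta w)$, $\langle\nabla_pF,\delta p\rangle=(D_2F)(\delta p)$ for all $\delta w,\delta p\in\mathcal{H}^{1,+}_0$; the Hamiltonian equation is $(\dot w,\dot p)=X_F(w,p)$. $\mathcal{F}_N:=\{w_1e_1+\dots+w_Ne_N+e_{N+1}: w_k\in\mathbb{C}\}$; $\mathcal{PF}_N:=(\mathcal{O}\cap\mathcal{F}_N)\times\{p_1e_1+\dots+p_Ne_N: p_k\in\mathbb{C}\}$; $\mathcal{HF}_N:=(\mathcal{O}\cap\mathcal{F}_N)\times\mathcal{H}^{1,+}_0$; $\Pi^+_{\le N}p=\sum_{k=1}^Np_ke_k$. $\mathcal{PF}_N$ (complex dimension $2N$, coordinates $w_1,\dots,w_N,p_1,\dots,p_N$) carries the canonical Poisson structure $\{w_k,w_l\}_N=\{p_k,p_l\}_N=0$, $\{p_l,w_k\}_N=\delta_{lk}$; the Hamiltonian equation of $F$ on $\mathcal{PF}_N$ is $\dot w_l=\partial F/\partial p_l$, $\dot p_l=-\partial F/\partial w_l$. *)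

theory Defs
  imports "HOL-Analysis.Analysis"
begin

section \<open>Fourier coefficients of functions on the circle\<close>

definition echar :: "int \<Rightarrow> real \<Rightarrow> complex" where
  "echar k y = exp (2 * of_real pi * \<i> * of_int k * of_real y)"

definition fourier_coeff :: "(real \<Rightarrow> complex) \<Rightarrow> int \<Rightarrow> complex" where
  "fourier_coeff f k = integral {0..1} (\<lambda>y. f y * echar (- k) y)"

definition jap :: "int \<Rightarrow> real" where
  "jap k = (if k = 0 then 1 else \<bar>of_int k\<bar>)"

lemma jap_pos: "jap k > 0"
  by (simp add: jap_def)

lemma continuous_on_echar [continuous_intros]: "continuous_on A (echar k)"
  unfolding echar_def by (intro continuous_intros)

lemma echar_add: "echar (k + l) y = echar k y * echar l y"
  unfolding echar_def by (simp add: exp_add [symmetric] ring_distribs)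

lemma echar_0 [simp]: "echar 0 y = 1"
  by (simp add: echar_def)

lemma echar_periodic: "echar k (y + 1) = echar k y"
proof -
  have "exp (2 * of_real pi * \<i> * of_int k) = 1"
    unfolding exp_eq_1 by (auto simp: algebra_simps)
  then show ?thesis
    by (simp add: echar_def exp_add ring_distribs)
qed

lemma integral_echar: "integral {0..1} (echar k) = (if k = 0 then 1 else 0)"
proof (cases "k = 0")
  case True
  have "echar 0 = (\<lambda>_. 1)" by auto
  then show ?thesis using True by simp
next
  case False
  define c where "c = 2 * of_real pi * \<i> * of_int k"
  have c: "c \<noteq> 0" using False by (simp add: c_def)
  have e: "echar k = (\<lambda>y. exp (c * of_real y))"
    by (auto simp: echar_def c_def)
  have "((\<lambda>y. exp (c * of_real y)) has_integral
      (exp (c * of_real 1) / c - exp (c * of_real 0) / c)) {0..1::real}"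
  proof (rule fundamental_theorem_of_calculus)
    fix x :: real
    have "((\<lambda>z. exp (c * z) / c) has_field_derivative exp (c * of_real x)) (at (of_real x))"
      using c by (auto intro!: derivative_eq_intros)
    then show "((\<lambda>y. exp (c * of_real y) / c) has_vector_derivative exp (c * of_real x))
        (at x within {0..1})"
      using has_vector_derivative_real_field has_vector_derivative_at_within by blast
  qed simp
  moreover have "exp c = 1"
    unfolding exp_eq_1 c_def by (auto simp: algebra_simps)
  ultimately have "integral {0..1} (echar k) = 0"
    by (simp add: e integral_unique)
  then show ?thesis using False by simp
qed

lemma fourier_coeff_mode:
  "fourier_coeff (\<lambda>y. z * echar l y) k = (if k = l then z else 0)"
proof -
  have "(\<lambda>y. z * echar l y * echar (- k) y) = (\<lambda>y. z * echar (l - k) y)"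
    using echar_add [of l "- k"] by auto
  then have "fourier_coeff (\<lambda>y. z * echar l y) k = z * integral {0..1} (echar (l - k))"
    by (simp add: fourier_coeff_def)
  then show ?thesis by (simp add: integral_echar)
qed

lemma fourier_coeff_integrable:
  assumes "continuous_on {0..1} f"
  shows "(\<lambda>y. f y * echar k y) integrable_on {0..1}"
  by (intro integrable_continuous_interval continuous_intros assms)

lemma fourier_coeff_add:
  assumes "continuous_on {0..1} f" "continuous_on {0..1} g"
  shows "fourier_coeff (\<lambda>y. f y + g y) k = fourier_coeff f k + fourier_coeff g k"
  by (simp add: fourier_coeff_def ring_distribs integral_add fourier_coeff_integrable assms)

lemma fourier_coeff_scale: "fourier_coeff (\<lambda>y. c * f y) k = c * fourier_coeff f k"
  by (simp add: fourier_coeff_def mult.assoc)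

lemma fourier_coeff_echar_shift:
  "fourier_coeff (\<lambda>y. echar l y * f y) k = fourier_coeff f (k - l)"
  using echar_add [of l "- k"]
  by (auto simp: fourier_coeff_def algebra_simps intro!: integral_cong)

lemma fourier_coeff_zero_polynomial_mult:
  assumes "real_polynomial_function P"
    and "continuous_on {0..1} f" and "\<And>k. fourier_coeff f k = 0"
  shows "continuous_on {0..1} (\<lambda>y. of_real (P (echar 1 y)) * f y) \<and>
    (\<forall>k. fourier_coeff (\<lambda>y. of_real (P (echar 1 y)) * f y) k = 0)"
  using assms
proof (induction P arbitrary: f rule: real_polynomial_function.induct)
  case (linear P)
  note cont_f = linear.prems(1) and zero_f = linear.prems(2)
  interpret bounded_linear P by fact
  define a where "a = Complex (P 1 / 2) (- P \<i> / 2)"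
  have *: "of_real (P (echar 1 y)) = a * echar 1 y + cnj a * echar (-1) y" for y
  proof -
    have c: "echar (-1) y = cnj (echar 1 y)"
      by (simp add: echar_def exp_cnj)
    have "P z = Re z * P 1 + Im z * P \<i>" for z
    proof -
      have "z = Re z *\<^sub>R 1 + Im z *\<^sub>R \<i>" by (simp add: complex_eq_iff)
      then show ?thesis by (metis add scaleR real_scaleR_def)
    qed
    from this [of "echar 1 y"] show ?thesis
      unfolding c by (simp add: complex_eq_iff a_def algebra_simps)
  qed
  have eq: "(\<lambda>y. of_real (P (echar 1 y)) * f y) =
      (\<lambda>y. echar 1 y * (a * f y) + echar (-1) y * (cnj a * f y))"
    by (auto simp: * algebra_simps)
  have cont: "continuous_on {0..1} (\<lambda>y. echar l y * (c * f y))" for l c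
    by (intro continuous_intros cont_f)
  show ?case
    unfolding eq using cont zero_f cont_f
    by (auto simp: fourier_coeff_add fourier_coeff_echar_shift fourier_coeff_scale
        intro!: continuous_intros)
next
  case (const c)
  then show ?case by (auto simp: fourier_coeff_scale intro!: continuous_intros)
next
  case (add P Q)
  have eq: "(\<lambda>y. of_real (P (echar 1 y) + Q (echar 1 y)) * f y) =
      (\<lambda>y. of_real (P (echar 1 y)) * f y + of_real (Q (echar 1 y)) * f y)"
    by (auto simp: algebra_simps)
  show ?case unfolding eq
    using add.IH(1) [OF add.prems] add.IH(2) [OF add.prems]
    by (auto simp: fourier_coeff_add intro!: continuous_on_add)
next
  case (mult P Q)
  have eq: "(\<lambda>y. of_real (P (echar 1 y) * Q (echar 1 y)) * f y) =
      (\<lambda>y. of_real (P (echar 1 y)) * (of_real (Q (echar 1 y)) * f y))"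
    by (auto simp: algebra_simps)
  show ?case unfolding eq
    by (rule mult.IH(1)) (use mult.IH(2) [OF mult.prems] in auto)
qed

lemma continuous_periodic_factor:
  fixes h :: "real \<Rightarrow> real"
  assumes cont: "continuous_on UNIV h" and per: "\<And>y. h (y + 1) = h y"
  obtains H where "continuous_on (sphere 0 1) H" "\<And>y. y \<in> {0..1} \<Longrightarrow> H (echar 1 y) = h y"
proof -
  define H where "H = (\<lambda>z. h (Arg2pi z / (2 * pi)))"
  have Heq: "H (echar 1 y) = h y" if "y \<in> {0..1}" for y
  proof (cases "y = 1")
    case True
    have "echar 1 1 = 1" using echar_periodic [of 1 0] by (simp add: echar_def)
    then show ?thesis using True per [of 0] Arg2pi_of_real [of 1] by (simp add: H_def)
  next
    case False
    then have "Arg2pi (echar 1 y) = 2 * pi * y"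
      using that by (intro Arg2pi_unique [of 1]) (auto simp: echar_def algebra_simps)
    then show ?thesis by (simp add: H_def)
  qed
  have "quotient_map (top_of_set {0..1}) (top_of_set (sphere 0 1)) (echar 1)"
  proof (rule T1_Spaces.continuous_imp_quotient_map)
    have img: "echar 1 ` {0..1} = sphere 0 1"
    proof (intro subset_antisym subsetI)
      fix z assume "z \<in> echar 1 ` {0..1}"
      then show "z \<in> sphere 0 1" by (auto simp: echar_def norm_exp_eq_Re)
    next
      fix z :: complex assume "z \<in> sphere 0 1"
      then have "norm z = 1" by simp
      then have "z = exp (\<i> * of_real (Arg2pi z))"
        using Arg2pi [of z] by (simp add: is_Arg_def)
      then have "z = echar 1 (Arg2pi z / (2 * pi))"
        by (simp add: echar_def field_simps)
      moreover have "Arg2pi z / (2 * pi) \<in> {0..1}"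
        using Arg2pi [of z] by auto
      ultimately show "z \<in> echar 1 ` {0..1}" by blast
    qed
    then show "echar 1 ` topspace (top_of_set {0..1}) = topspace (top_of_set (sphere 0 1))"
      by simp
    show "continuous_map (top_of_set {0..1}) (top_of_set (sphere 0 1)) (echar 1)"
      using img continuous_on_echar by (auto simp: continuous_map_in_subtopology)
  qed (auto simp: compact_space_subtopology Hausdorff_space_subtopology)
  moreover have "continuous_map (top_of_set {0..1}) euclidean (H \<circ> echar 1)"
  proof -
    have "continuous_on {0..1} h" using cont continuous_on_subset by blast
    then have "continuous_on {0..1} (H \<circ> echar 1)"
      by (rule continuous_on_eq) (simp add: Heq)
    then show ?thesis by simp
  qed
  ultimately have "continuous_map (top_of_set (sphere 0 1)) euclidean H"
    by (rule continuous_compose_quotient_map)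
  then have "continuous_on (sphere 0 1) H" by simp
  then show thesis using that Heq by blast
qed

lemma fourier_coeff_zero_integral_mult:
  fixes h :: "real \<Rightarrow> real"
  assumes cf: "continuous_on {0..1} f" and z: "\<And>k. fourier_coeff f k = 0"
    and h: "continuous_on UNIV h" "\<And>y. h (y + 1) = h y"
  shows "integral {0..1} (\<lambda>y. of_real (h y) * f y) = 0"
proof -
  obtain H where H: "continuous_on (sphere 0 1) H" "\<And>y. y \<in> {0..1} \<Longrightarrow> H (echar 1 y) = h y"
    using continuous_periodic_factor [OF h] by blast
  have "bounded (f ` {0..1})"
    by (intro compact_imp_bounded compact_continuous_image cf) auto
  then obtain B where B: "B > 0" "\<And>y. y \<in> {0..1} \<Longrightarrow> norm (f y) \<le> B"
    by (auto simp: bounded_pos)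
  have ch: "continuous_on {0..1} h" using h continuous_on_subset by blast
  have "norm (integral {0..1} (\<lambda>y. of_real (h y) * f y)) \<le> e" if "e > 0" for e
  proof -
    have "e / B > 0" using B that by simp
    then obtain P where P: "real_polynomial_function P"
        "\<And>x. x \<in> sphere 0 1 \<Longrightarrow> \<bar>H x - P x\<bar> < e / B"
      using Stone_Weierstrass_real_polynomial_function [of "sphere (0::complex) 1" H "e / B"] H
      by auto
    have Pf: "continuous_on {0..1} (\<lambda>y. of_real (P (echar 1 y)) * f y)"
        "fourier_coeff (\<lambda>y. of_real (P (echar 1 y)) * f y) 0 = 0"
      using fourier_coeff_zero_polynomial_mult [OF P(1) cf z] by auto
    have i1: "(\<lambda>y. of_real (h y) * f y) integrable_on {0..1}"
      by (intro integrable_continuous_interval continuous_intros cf ch)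
    have i2: "(\<lambda>y. of_real (P (echar 1 y)) * f y) integrable_on {0..1}"
      by (intro integrable_continuous_interval Pf)
    have "integral {0..1} (\<lambda>y. of_real (h y) * f y)
        = integral {0..1} (\<lambda>y. of_real (h y) * f y - of_real (P (echar 1 y)) * f y)"
      using Pf(2) i1 i2 by (simp add: fourier_coeff_def integral_diff)
    also have "norm \<dots> \<le> e * (1 - 0)"
    proof (rule integral_bound)
      show "continuous_on {0..1} (\<lambda>y. of_real (h y) * f y - of_real (P (echar 1 y)) * f y)"
        by (intro continuous_intros cf ch Pf)
      fix y :: real assume y: "y \<in> {0..1}"
      have "echar 1 y \<in> sphere 0 1" by (auto simp: echar_def norm_exp_eq_Re)
      then have "\<bar>h y - P (echar 1 y)\<bar> \<le> e / B" using P(2) H(2) [OF y] by fastforce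
      then have "\<bar>h y - P (echar 1 y)\<bar> * norm (f y) \<le> e / B * B"
        using B y that by (intro mult_mono) auto
      moreover have "of_real (h y) * f y - of_real (P (echar 1 y)) * f y
          = of_real (h y - P (echar 1 y)) * f y"
        by (simp add: algebra_simps)
      ultimately show "norm (of_real (h y) * f y - of_real (P (echar 1 y)) * f y) \<le> e"
        using B by (simp add: norm_mult del: of_real_diff)
    qed simp
    finally show ?thesis by simp
  qed
  then have "norm (integral {0..1} (\<lambda>y. of_real (h y) * f y)) \<le> 0"
    by (rule field_le_epsilon [where y = 0, simplified])
  then show ?thesis by simp
qed

lemma fourier_coeff_zero_imp_zero:
  assumes cont: "continuous_on UNIV f" and per: "\<And>y. f (y + 1) = f y"
    and z: "\<And>k. fourier_coeff f k = 0"
  shows "f = (\<lambda>_. 0)"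
proof -
  have cf: "continuous_on {0..1} f" using cont continuous_on_subset by blast
  have i: "(\<lambda>y. of_real (h y) * f y) integrable_on {0..1}" if "continuous_on {0..1} h"
    for h :: "real \<Rightarrow> real"
    by (intro integrable_continuous_interval continuous_intros cf that)
  have cR: "continuous_on UNIV (\<lambda>y. Re (f y))" "continuous_on UNIV (\<lambda>y. Im (f y))"
    by (intro continuous_intros cont)+
  have cR': "continuous_on {0..1} (\<lambda>y. Re (f y))" "continuous_on {0..1} (\<lambda>y. Im (f y))"
    by (intro continuous_intros cf)+
  have "integral {0..1} (\<lambda>y. Re (of_real (Re (f y)) * f y)) = 0"
    using fourier_coeff_zero_integral_mult [OF cf z cR(1)] per
      integral_linear [OF i [OF cR'(1)] bounded_linear_Re] by (simp add: o_def)
  then have "\<forall>y\<in>{0..1}. Re (f y) * Re (f y) = 0"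
    by (subst (asm) integral_eq_0_iff) (auto intro!: continuous_intros cf)
  moreover have "integral {0..1} (\<lambda>y. Im (of_real (Im (f y)) * f y)) = 0"
    using fourier_coeff_zero_integral_mult [OF cf z cR(2)] per
      integral_linear [OF i [OF cR'(2)] bounded_linear_Im] by (simp add: o_def)
  then have "\<forall>y\<in>{0..1}. Im (f y) * Im (f y) = 0"
    by (subst (asm) integral_eq_0_iff) (auto intro!: continuous_intros cf)
  ultimately have 0: "f y = 0" if "y \<in> {0..1}" for y
    using that by (simp add: complex_eq_iff)
  have nat: "f (y + real n) = f y" for y n
  proof (induction n)
    case (Suc n)
    then show ?case using per [of "y + real n"] by (simp add: algebra_simps)
  qed simp
  have "f y = f (frac y)" for y
  proof (cases "\<lfloor>y\<rfloor> \<ge> 0")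
    case True
    then show ?thesis using nat [of "frac y" "nat \<lfloor>y\<rfloor>"] by (simp add: frac_def)
  next
    case False
    then show ?thesis using nat [of y "nat (- \<lfloor>y\<rfloor>)"] by (simp add: frac_def)
  qed
  moreover have "frac y \<in> {0..1}" for y :: real
    by (simp add: frac_ge_0 frac_lt_1 less_imp_le)
  ultimately show ?thesis using 0 by (metis (no_types))
qed


section \<open>The Hilbert space \<open>\<H>\<^sup>1\<close>\<close>

text \<open>
  Elements of \<open>\<H>\<^sup>1\<close> have absolutely convergent Fourier series, so each one has exactly one
  continuous representative; the type consists of these representatives, written as
  1-periodic functions on the real line.
\<close>

typedef h1 = "{f :: real \<Rightarrow> complex. continuous_on UNIV f \<and> (\<forall>y. f (y + 1) = f y) \<and>
    (\<lambda>k. (cmod (fourier_coeff f k))\<^sup>2 * (jap k)\<^sup>2) summable_on UNIV}"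
  morphisms h1_fun Abs_h1
proof -
  have "fourier_coeff (\<lambda>_. 0) k = 0" for k
    by (simp add: fourier_coeff_def)
  then show ?thesis
    by (intro exI [of _ "\<lambda>_. 0"]) auto
qed

setup_lifting type_definition_h1

abbreviation h1_coeff :: "h1 \<Rightarrow> int \<Rightarrow> complex" where
  "h1_coeff f \<equiv> fourier_coeff (h1_fun f)"

lemma
  shows h1_fun_continuous: "continuous_on A (h1_fun f)"
    and h1_fun_periodic: "h1_fun f (y + 1) = h1_fun f y"
    and h1_summable: "(\<lambda>k. (cmod (h1_coeff f k))\<^sup>2 * (jap k)\<^sup>2) summable_on UNIV"
  using h1_fun [of f] continuous_on_subset by auto

lemma square_sum_bound: "(cmod (a + b))\<^sup>2 \<le> 2 * (cmod a)\<^sup>2 + 2 * (cmod b)\<^sup>2"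
proof -
  have "(cmod (a + b))\<^sup>2 \<le> (cmod a + cmod b)\<^sup>2"
    by (intro power_mono norm_triangle_ineq) auto
  also have "\<dots> \<le> 2 * (cmod a)\<^sup>2 + 2 * (cmod b)\<^sup>2"
    using sum_squares_bound [of "cmod a" "cmod b"] by (simp add: power2_sum)
  finally show ?thesis .
qed

instantiation h1 :: real_vector
begin

lift_definition zero_h1 :: h1 is "\<lambda>_. 0"
  by (simp add: fourier_coeff_def)

lift_definition plus_h1 :: "h1 \<Rightarrow> h1 \<Rightarrow> h1" is "\<lambda>f g y. f y + g y"
proof (intro CollectI conjI; (elim CollectE conjE)?)
  fix f g :: "real \<Rightarrow> complex"
  assume c: "continuous_on UNIV f" "continuous_on UNIV g"
    and p: "\<forall>y. f (y + 1) = f y" "\<forall>y. g (y + 1) = g y"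
    and s: "(\<lambda>k. (cmod (fourier_coeff f k))\<^sup>2 * (jap k)\<^sup>2) summable_on UNIV"
      "(\<lambda>k. (cmod (fourier_coeff g k))\<^sup>2 * (jap k)\<^sup>2) summable_on UNIV"
  show "continuous_on UNIV (\<lambda>y. f y + g y)"
    by (intro continuous_intros c)
  show "\<forall>y. f (y + 1) + g (y + 1) = f y + g y"
    using p by simp
  have eq: "fourier_coeff (\<lambda>y. f y + g y) k = fourier_coeff f k + fourier_coeff g k" for k
    by (intro fourier_coeff_add continuous_on_subset [OF c(1)] continuous_on_subset [OF c(2)]) auto
  have "(\<lambda>k. 2 * ((cmod (fourier_coeff f k))\<^sup>2 * (jap k)\<^sup>2) +
      2 * ((cmod (fourier_coeff g k))\<^sup>2 * (jap k)\<^sup>2)) summable_on UNIV"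
    by (intro summable_on_add summable_on_cmult_right s)
  then show "(\<lambda>k. (cmod (fourier_coeff (\<lambda>y. f y + g y) k))\<^sup>2 * (jap k)\<^sup>2) summable_on UNIV"
  proof (rule summable_on_comparison_test)
    fix k
    show "(cmod (fourier_coeff (\<lambda>y. f y + g y) k))\<^sup>2 * (jap k)\<^sup>2
        \<le> 2 * ((cmod (fourier_coeff f k))\<^sup>2 * (jap k)\<^sup>2)
          + 2 * ((cmod (fourier_coeff g k))\<^sup>2 * (jap k)\<^sup>2)"
      using mult_right_mono [OF square_sum_bound, of "(jap k)\<^sup>2"]
      by (simp add: eq algebra_simps)
  qed simp
qed

lift_definition uminus_h1 :: "h1 \<Rightarrow> h1" is "\<lambda>f y. - f y"
proof (intro CollectI conjI; elim CollectE conjE)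
  fix f :: "real \<Rightarrow> complex"
  show "(\<lambda>k. (cmod (fourier_coeff (\<lambda>y. - f y) k))\<^sup>2 * (jap k)\<^sup>2) summable_on UNIV"
    if "(\<lambda>k. (cmod (fourier_coeff f k))\<^sup>2 * (jap k)\<^sup>2) summable_on UNIV"
    using that fourier_coeff_scale [of "-1" f] by simp
qed (auto intro: continuous_on_minus)

lift_definition scaleR_h1 :: "real \<Rightarrow> h1 \<Rightarrow> h1" is "\<lambda>r f y. r *\<^sub>R f y"
proof (intro CollectI conjI; elim CollectE conjE)
  fix r and f :: "real \<Rightarrow> complex"
  show "(\<lambda>k. (cmod (fourier_coeff (\<lambda>y. r *\<^sub>R f y) k))\<^sup>2 * (jap k)\<^sup>2) summable_on UNIV"
    if "(\<lambda>k. (cmod (fourier_coeff f k))\<^sup>2 * (jap k)\<^sup>2) summable_on UNIV"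
    using summable_on_cmult_right [OF that, of "r\<^sup>2"]
    by (simp add: scaleR_conv_of_real fourier_coeff_scale norm_mult power_mult_distrib mult.assoc)
qed (auto intro: continuous_on_scaleR continuous_on_const)

definition minus_h1 :: "h1 \<Rightarrow> h1 \<Rightarrow> h1" where
  "minus_h1 f g = f + - g"

instance
proof
  fix f g h :: h1 and a b :: real
  show "f + g + h = f + (g + h)" "f + g = g + f" "0 + f = f" "- f + f = 0"
    by (transfer; simp add: algebra_simps)+
  show "f - g = f + - g"
    by (rule minus_h1_def)
  show "a *\<^sub>R (f + g) = a *\<^sub>R f + a *\<^sub>R g" "(a + b) *\<^sub>R f = a *\<^sub>R f + b *\<^sub>R f"
    "a *\<^sub>R b *\<^sub>R f = (a * b) *\<^sub>R f" "1 *\<^sub>R f = f"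
    by (transfer; simp add: algebra_simps)+
qed

end

lemma
  shows h1_fun_0 [simp]: "h1_fun 0 y = 0"
    and h1_fun_add [simp]: "h1_fun (f + g) y = h1_fun f y + h1_fun g y"
    and h1_fun_minus [simp]: "h1_fun (- f) y = - h1_fun f y"
    and h1_fun_scaleR [simp]: "h1_fun (r *\<^sub>R f) y = r *\<^sub>R h1_fun f y"
  by (transfer; simp)+

lemma h1_coeff_0 [simp]: "h1_coeff 0 k = 0"
  by (simp add: fourier_coeff_def)

lemma h1_coeff_add: "h1_coeff (f + g) k = h1_coeff f k + h1_coeff g k"
proof -
  have "h1_fun (f + g) = (\<lambda>y. h1_fun f y + h1_fun g y)" by auto
  then show ?thesis by (simp add: fourier_coeff_add h1_fun_continuous)
qed

lemma h1_coeff_scaleR: "h1_coeff (r *\<^sub>R f) k = r *\<^sub>R h1_coeff f k"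
proof -
  have "h1_fun (r *\<^sub>R f) = (\<lambda>y. of_real r * h1_fun f y)" by (auto simp: scaleR_conv_of_real)
  then show ?thesis by (simp add: fourier_coeff_scale scaleR_conv_of_real)
qed

lemma h1_coeff_eq_0: "f = 0" if "\<And>k. h1_coeff f k = 0"
proof -
  have "h1_fun f = (\<lambda>_. 0)"
    by (intro fourier_coeff_zero_imp_zero h1_fun_continuous h1_fun_periodic that)
  then show ?thesis by (metis h1_fun_0 h1_fun_inject ext)
qed

lemma h1_inner_summable:
  "(\<lambda>k. Re (h1_coeff f k * cnj (h1_coeff g k)) * (jap k)\<^sup>2) summable_on UNIV"
proof -
  have "(\<lambda>k. (cmod (h1_coeff f k))\<^sup>2 * (jap k)\<^sup>2 + (cmod (h1_coeff g k))\<^sup>2 * (jap k)\<^sup>2)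
      summable_on UNIV"
    by (intro summable_on_add h1_summable)
  then have "(\<lambda>k. norm (Re (h1_coeff f k * cnj (h1_coeff g k)) * (jap k)\<^sup>2)) summable_on UNIV"
  proof (rule Infinite_Sum.abs_summable_on_comparison_test')
    fix k
    have "\<bar>Re (h1_coeff f k * cnj (h1_coeff g k))\<bar> \<le> cmod (h1_coeff f k) * cmod (h1_coeff g k)"
      by (metis abs_Re_le_cmod complex_mod_cnj norm_mult)
    also have "\<dots> \<le> (cmod (h1_coeff f k))\<^sup>2 + (cmod (h1_coeff g k))\<^sup>2"
      using sum_squares_bound [of "cmod (h1_coeff f k)" "cmod (h1_coeff g k)"]
        mult_nonneg_nonneg [OF norm_ge_zero norm_ge_zero, of "h1_coeff f k" "h1_coeff g k"]
      by linarith
    finally show "norm (Re (h1_coeff f k * cnj (h1_coeff g k)) * (jap k)\<^sup>2)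
        \<le> (cmod (h1_coeff f k))\<^sup>2 * (jap k)\<^sup>2 + (cmod (h1_coeff g k))\<^sup>2 * (jap k)\<^sup>2"
      using mult_right_mono [of _ _ "(jap k)\<^sup>2"]
      by (simp add: abs_mult distrib_right [symmetric] del: times_complex.sel)
  qed
  then show ?thesis by (rule abs_summable_summable)
qed

text \<open>
  \<open>h1\<close> is made a real normed space through the real part of its Hermitian inner product;
  the induced norm is the \<open>\<H>\<^sup>1\<close>-norm (lemma \<open>norm_h1_eq\<close>).
\<close>

instantiation h1 :: real_inner
begin

definition inner_h1 :: "h1 \<Rightarrow> h1 \<Rightarrow> real" where
  "inner_h1 f g = (\<Sum>\<^sub>\<infinity>k. Re (h1_coeff f k * cnj (h1_coeff g k)) * (jap k)\<^sup>2)"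

definition norm_h1 :: "h1 \<Rightarrow> real" where
  "norm_h1 f = sqrt (inner f f)"

definition sgn_h1 :: "h1 \<Rightarrow> h1" where
  "sgn_h1 f = f /\<^sub>R norm f"

definition dist_h1 :: "h1 \<Rightarrow> h1 \<Rightarrow> real" where
  "dist_h1 f g = norm (f - g)"

definition uniformity_h1 :: "(h1 \<times> h1) filter" where
  "uniformity_h1 = (INF e\<in>{0<..}. principal {(x, y). dist x y < e})"

definition open_h1 :: "h1 set \<Rightarrow> bool" where
  "open_h1 U \<longleftrightarrow> (\<forall>x\<in>U. eventually (\<lambda>(x', y). x' = x \<longrightarrow> y \<in> U) uniformity)"

instance
proof
  fix f g h :: h1 and r :: real and U :: "h1 set"
  show "dist f g = norm (f - g)" by (rule dist_h1_def)
  show "sgn f = f /\<^sub>R norm f" by (rule sgn_h1_def)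
  show "uniformity = (INF e\<in>{0<..}. principal {(x, y :: h1). dist x y < e})"
    by (rule uniformity_h1_def)
  show "open U \<longleftrightarrow> (\<forall>x\<in>U. eventually (\<lambda>(x', y). x' = x \<longrightarrow> y \<in> U) uniformity)"
    by (rule open_h1_def)
  show "norm f = sqrt (inner f f)" by (rule norm_h1_def)
  show "inner f g = inner g f"
    by (simp add: inner_h1_def algebra_simps)
  show "inner (f + g) h = inner f h + inner g h"
  proof -
    have "Re (h1_coeff (f + g) k * cnj (h1_coeff h k)) * (jap k)\<^sup>2 =
        Re (h1_coeff f k * cnj (h1_coeff h k)) * (jap k)\<^sup>2 +
        Re (h1_coeff g k * cnj (h1_coeff h k)) * (jap k)\<^sup>2" for k
      by (simp add: h1_coeff_add algebra_simps)
    then show ?thesis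
      by (simp add: inner_h1_def infsum_add h1_inner_summable del: times_complex.sel)
  qed
  show "inner (r *\<^sub>R f) g = r * inner f g"
    unfolding inner_h1_def
    by (subst infsum_cmult_right' [symmetric])
      (auto simp: h1_coeff_scaleR algebra_simps intro!: infsum_cong)
  have nn: "Re (h1_coeff f k * cnj (h1_coeff f k)) * (jap k)\<^sup>2 \<ge> 0" for k
    by simp
  then show "0 \<le> inner f f"
    unfolding inner_h1_def by (intro infsum_nonneg) auto
  show "inner f f = 0 \<longleftrightarrow> f = 0"
  proof
    assume "inner f f = 0"
    then have "Re (h1_coeff f k * cnj (h1_coeff f k)) * (jap k)\<^sup>2 = 0" for k
      unfolding inner_h1_def
      using nonneg_infsum_le_0D [OF _ h1_inner_summable [of f f] nn, of k] by auto
    then have "h1_coeff f k = 0" for k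
      by (simp add: jap_pos [THEN less_imp_neq, symmetric] complex_eq_iff)
    then show "f = 0" by (rule h1_coeff_eq_0)
  qed (simp add: inner_h1_def)
qed

end

lemma norm_h1_eq: "norm f = sqrt (\<Sum>\<^sub>\<infinity>k. (cmod (h1_coeff f k))\<^sup>2 * (jap k)\<^sup>2)"
  by (simp add: norm_h1_def inner_h1_def complex_mult_cnj cmod_power2)

lift_definition h1_mode :: "complex \<Rightarrow> int \<Rightarrow> h1" is "\<lambda>z l y. z * echar l y"
proof (intro CollectI conjI allI)
  fix z :: complex and l :: int
  show "continuous_on UNIV (\<lambda>y. z * echar l y)"
    by (intro continuous_intros)
  show "z * echar l (y + 1) = z * echar l y" for y
    by (simp add: echar_periodic)
  have "finite {k. (cmod (fourier_coeff (\<lambda>y. z * echar l y) k))\<^sup>2 * (jap k)\<^sup>2 \<noteq> 0}"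
    by (rule finite_subset [of _ "{l}"]) (auto simp: fourier_coeff_mode)
  then show "(\<lambda>k. (cmod (fourier_coeff (\<lambda>y. z * echar l y) k))\<^sup>2 * (jap k)\<^sup>2) summable_on UNIV"
    by (intro finite_nonzero_values_imp_summable_on) simp
qed


section \<open>Projections, pairing and the spaces \<open>\<H>\<^sup>1\<^sup>,\<^sup>+\<^sub>0\<close> and \<open>\<O>\<close>\<close>

definition Pi_plus :: "(real \<Rightarrow> complex) \<Rightarrow> real \<Rightarrow> complex" where
  "Pi_plus f y = (\<Sum>\<^sub>\<infinity>k\<in>{0..}. fourier_coeff f k * echar k y)"

definition Pi_plus0 :: "(real \<Rightarrow> complex) \<Rightarrow> real \<Rightarrow> complex" where
  "Pi_plus0 f y = (\<Sum>\<^sub>\<infinity>k\<in>{1..}. fourier_coeff f k * echar k y)"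

definition pairing :: "(real \<Rightarrow> complex) \<Rightarrow> (real \<Rightarrow> complex) \<Rightarrow> complex" where
  "pairing f g = (\<Sum>\<^sub>\<infinity>k. fourier_coeff f k * fourier_coeff g k)"

definition H1p0 :: "h1 set" where
  "H1p0 = {f. \<forall>k\<le>0. h1_coeff f k = 0}"

definition Oset :: "h1 set" where
  "Oset = {w \<in> H1p0. \<forall>y. h1_fun w y \<noteq> 0}"

section \<open>The functions \<open>H\<^sub>f\<close> and \<open>J\<^sub>k\<close>\<close>

definition reflect :: "(real \<Rightarrow> complex) \<Rightarrow> real \<Rightarrow> complex" where
  "reflect f y = f (- y)"

definition shift :: "(real \<Rightarrow> complex) \<Rightarrow> real \<Rightarrow> complex" where
  "shift f y = f y * echar (-1) y"

definition A_op :: "nat \<Rightarrow> (real \<Rightarrow> complex) \<Rightarrow> (real \<Rightarrow> complex) \<Rightarrow> real \<Rightarrow> complex" where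
  "A_op k w g y = g y * Pi_plus ((shift ^^ (k + 1)) w) y - w y * Pi_plus ((shift ^^ (k + 1)) g) y"

definition Gamma_op :: "(real \<Rightarrow> complex) \<Rightarrow> (real \<Rightarrow> complex) \<Rightarrow> real \<Rightarrow> complex" where
  "Gamma_op w p = Pi_plus0 (\<lambda>y. w y * reflect p y)"

definition I_fun :: "nat \<Rightarrow> (real \<Rightarrow> complex) \<Rightarrow> (real \<Rightarrow> complex) \<Rightarrow> complex" where
  "I_fun k w p = pairing (A_op k w (Gamma_op w p)) p"

fun H_ham :: "h1 \<Rightarrow> h1 \<times> h1 \<Rightarrow> complex" where
  "H_ham f (w, p) = pairing (h1_fun w) (\<lambda>y. (h1_fun p y)\<^sup>2)
     + integral {0..1} (\<lambda>y. h1_fun f y / h1_fun w y)"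

fun J_int :: "h1 \<Rightarrow> nat \<Rightarrow> h1 \<times> h1 \<Rightarrow> complex" where
  "J_int f k (w, p) = I_fun k (h1_fun w) (h1_fun p)
     - fourier_coeff (\<lambda>y. h1_fun w y * Pi_plus0 (\<lambda>x. h1_fun f x / h1_fun w x) y) (int k + 1)"

section \<open>\<open>C\<^sup>l\<close> curves and the Hamiltonian equation on \<open>\<O> \<times> \<H>\<^sup>1\<^sup>,\<^sup>+\<^sub>0\<close>\<close>

fun Ck_on :: "nat \<Rightarrow> real set \<Rightarrow> (real \<Rightarrow> 'a::real_normed_vector) \<Rightarrow> bool" where
  "Ck_on 0 S u \<longleftrightarrow> continuous_on S u"
| "Ck_on (Suc n) S u \<longleftrightarrow>
     (\<exists>u'. (\<forall>t\<in>S. (u has_vector_derivative u' t) (at t within S)) \<and> Ck_on n S u')"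

text \<open>
  \<open>D\<close> is the Frechet derivative of \<open>F\<close> along \<open>\<O> \<times> \<H>\<^sup>1\<^sup>,\<^sup>+\<^sub>0\<close>; \<open>has_derivative\<close> alone only yields
  real linearity, but the representation through the complex bilinear pairing forces \<open>D\<close> to be
  complex linear on \<open>\<H>\<^sup>1\<^sup>,\<^sup>+\<^sub>0 \<times> \<H>\<^sup>1\<^sup>,\<^sup>+\<^sub>0\<close>. Only there is \<open>D\<close> determined by \<open>F\<close>.
\<close>

definition has_gradient :: "(h1 \<times> h1 \<Rightarrow> complex) \<Rightarrow> h1 \<times> h1 \<Rightarrow> h1 \<Rightarrow> h1 \<Rightarrow> bool" where
  "has_gradient F x gw gp \<longleftrightarrow> gw \<in> H1p0 \<and> gp \<in> H1p0 \<and>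
     (\<exists>D. (F has_derivative D) (at x within Oset \<times> H1p0) \<and>
       (\<forall>dw\<in>H1p0. pairing (h1_fun gw) (h1_fun dw) = D (dw, 0)) \<and>
       (\<forall>dp\<in>H1p0. pairing (h1_fun gp) (h1_fun dp) = D (0, dp)))"

definition is_X :: "(h1 \<times> h1 \<Rightarrow> complex) \<Rightarrow> h1 \<times> h1 \<Rightarrow> h1 \<times> h1 \<Rightarrow> bool" where
  "is_X F x v \<longleftrightarrow> (\<exists>gw gp. has_gradient F x gw gp \<and> v = (gp, - gw))"

definition ham_solution ::
    "(h1 \<times> h1 \<Rightarrow> complex) \<Rightarrow> real set \<Rightarrow> (real \<Rightarrow> h1) \<Rightarrow> (real \<Rightarrow> h1) \<Rightarrow> bool" where
  "ham_solution F S w p \<longleftrightarrow> (\<forall>t\<in>S. w t \<in> Oset \<and> p t \<in> H1p0 \<and>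
     (\<exists>v. ((\<lambda>s. (w s, p s)) has_vector_derivative v) (at t within S) \<and> is_X F (w t, p t) v))"

section \<open>The finite-dimensional reduction\<close>

definition F_space :: "nat \<Rightarrow> h1 set" where
  "F_space N = {(\<Sum>k=1..N. h1_mode (c k) (int k)) + h1_mode 1 (int N + 1) |c. True}"

definition PF_space :: "nat \<Rightarrow> (h1 \<times> h1) set" where
  "PF_space N = (Oset \<inter> F_space N) \<times> {(\<Sum>k=1..N. h1_mode (c k) (int k)) |c. True}"

definition HF_space :: "nat \<Rightarrow> (h1 \<times> h1) set" where
  "HF_space N = (Oset \<inter> F_space N) \<times> H1p0"

definition Pi_le :: "nat \<Rightarrow> h1 \<Rightarrow> h1" where
  "Pi_le N p = (\<Sum>k=1..N. h1_mode (h1_coeff p (int k)) (int k))"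

text \<open>
  Complex partial derivatives in the coordinates \<open>w\<^sub>l\<close>, \<open>p\<^sub>l\<close>: increasing a coordinate by \<open>z\<close> means
  adding \<open>z e\<^sub>l\<close>. Since \<open>\<O>\<close> is open, they only involve values of \<open>F\<close> on \<open>PF_space N\<close>
  when taken at a point of \<open>PF_space N\<close> with \<open>l \<le> N\<close>.
\<close>

fun dF_w :: "(h1 \<times> h1 \<Rightarrow> complex) \<Rightarrow> nat \<Rightarrow> h1 \<times> h1 \<Rightarrow> complex" where
  "dF_w F l (w, p) = deriv (\<lambda>z. F (w + h1_mode z (int l), p)) 0"

fun dF_p :: "(h1 \<times> h1 \<Rightarrow> complex) \<Rightarrow> nat \<Rightarrow> h1 \<times> h1 \<Rightarrow> complex" where
  "dF_p F l (w, p) = deriv (\<lambda>z. F (w, p + h1_mode z (int l))) 0"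

definition PF_differentiable :: "nat \<Rightarrow> (h1 \<times> h1 \<Rightarrow> complex) \<Rightarrow> bool" where
  "PF_differentiable N F \<longleftrightarrow> (\<forall>(w, p)\<in>PF_space N. \<forall>l\<in>{1..N}.
     (\<lambda>z. F (w + h1_mode z (int l), p)) field_differentiable (at 0) \<and>
     (\<lambda>z. F (w, p + h1_mode z (int l))) field_differentiable (at 0))"

definition PF_solution ::
    "nat \<Rightarrow> (h1 \<times> h1 \<Rightarrow> complex) \<Rightarrow> real set \<Rightarrow> (real \<Rightarrow> h1) \<Rightarrow> (real \<Rightarrow> h1) \<Rightarrow> bool" where
  "PF_solution N F S w p \<longleftrightarrow> (\<forall>t\<in>S. (w t, p t) \<in> PF_space N \<and> (\<forall>l\<in>{1..N}.
     ((\<lambda>s. h1_coeff (w s) (int l)) has_vector_derivative dF_p F l (w t, p t)) (at t within S) \<and>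
     ((\<lambda>s. h1_coeff (p s) (int l)) has_vector_derivative - dF_w F l (w t, p t)) (at t within S)))"

text \<open>The Poisson bracket determined by \<open>{w\<^sub>k, w\<^sub>l} = {p\<^sub>k, p\<^sub>l} = 0\<close> and \<open>{p\<^sub>l, w\<^sub>k} = \<delta>\<^sub>l\<^sub>k\<close>.\<close>

definition poisson ::
    "nat \<Rightarrow> (h1 \<times> h1 \<Rightarrow> complex) \<Rightarrow> (h1 \<times> h1 \<Rightarrow> complex) \<Rightarrow> h1 \<times> h1 \<Rightarrow> complex" where
  "poisson N F G x = (\<Sum>l=1..N. dF_p F l x * dF_w G l x - dF_w F l x * dF_p G l x)"

definition PF_integral :: "nat \<Rightarrow> (h1 \<times> h1 \<Rightarrow> complex) \<Rightarrow> (h1 \<times> h1 \<Rightarrow> complex) \<Rightarrow> bool" where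
  "PF_integral N F G \<longleftrightarrow> (\<forall>S w p. is_interval S \<and> PF_solution N F S w p \<longrightarrow>
     (\<forall>s\<in>S. \<forall>t\<in>S. G (w s, p s) = G (w t, p t)))"

definition in_involution :: "nat \<Rightarrow> (h1 \<times> h1 \<Rightarrow> complex) \<Rightarrow> (h1 \<times> h1 \<Rightarrow> complex) \<Rightarrow> bool" where
  "in_involution N F G \<longleftrightarrow> (\<forall>x\<in>PF_space N. poisson N F G x = 0)"

end

theory Submission
  imports Defs "HOL-Computational_Algebra.Fundamental_Theorem_Algebra"
begin

text \<open>
  The Fourier coefficients of \<open>g = \<Gamma>(w)p\<close> and of \<open>\<Gamma>(w)p\<^sup>2\<close> turn \<open>I_k\<close> into a finite expression. The
  gradient of \<open>H_f\<close> or \<open>J_k\<close> in \<open>p\<close> then has components that involve only higher modes of \<open>w\<close>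
  linearly, so the modes of \<open>w\<close> beyond \<open>N + 1\<close> satisfy a homogeneous linear system with bounded
  coefficients and stay \<open>0\<close>; hence \<open>w\<close> stays in \<open>F_space N\<close>, where \<open>H_f\<close> and \<open>J_k\<close> depend on \<open>p\<close>
  only through its first \<open>N\<close> modes.

  On \<open>PF_space N\<close>, \<open>\<partial>J_k/\<partial>p_l\<close> is twice the Bezoutian \<open>B\<close> of \<open>g\<close> and \<open>w\<close>, while \<open>\<partial>J_k/\<partial>w_l\<close> is a
  combination \<open>\<Sum>\<^sub>s 2 p_s K\<^sup>g_k_s_l - q_s K\<^sup>w_k_s_l\<close> with \<open>q\<close> determined by \<open>p\<^sup>2\<close> and \<open>f/w\<^sup>2\<close>, where \<open>K\<^sup>w\<close> are
  the structure constants of the algebra of polynomials modulo \<open>w(X)/X\<close>. Since the Bezoutian is an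
  invariant form on that algebra, \<open>\<Sum>\<^sub>l B_j_l K_k_s_l\<close> is symmetric in \<open>j\<close> and \<open>k\<close>, which is
  \<open>{J_j, J_k} = 0\<close>. Finally \<open>H_f\<close> differs from \<open>J_N\<close> by the constant \<open>f\<^sub>N\<^sub>+\<^sub>1\<close> on \<open>PF_space N\<close>.
\<close>

section \<open>Bezoutians\<close>

text \<open>The symmetry of \<open>\<Sum>l. B_j_l K_k_s_l\<close> is needed with \<open>K\<close>
  built from \<open>w\<close> and again with \<open>K\<close> built from \<open>g\<close>. The mode
  of \<open>g\<close> at \<open>N + 1\<close> is 0, so the second case has no monic modulus of
  degree \<open>N\<close> and no quotient algebra to appeal to. Both cases are therefore covered by
  one identity for coefficient sequences: moving one unit of index from \<open>k\<close> to
  \<open>j\<close> changes the sum by a defect that is antisymmetric in \<open>j\<close> and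
  \<open>k\<close>.

  The analytic obstacle is that \<open>Pi_plus0\<close> is an infinite sum, so the projection of
  \<open>f / w\<close> has the expected modes only when the coefficients of \<open>f / w\<close> are
  absolutely summable. For \<open>w\<close> in \<open>F_space N\<close> this comes from elementary
  factorisation, since \<open>w\<close> is a polynomial in \<open>e_1\<close>. Before
  \<open>w\<close> is known to stay there, only derivatives in \<open>p\<close> are computed, and
  these do not see \<open>f\<close>.\<close>

definition minor :: "(int \<Rightarrow> complex) \<Rightarrow> (int \<Rightarrow> complex) \<Rightarrow> int \<Rightarrow> int \<Rightarrow> complex" where
  "minor u v i j = u i * v j - v i * u j"

text \<open>For \<open>j, l \<ge> 0\<close> this is the coefficient of \<open>X^j Y^l\<close> in
  \<open>(U(X) V(Y) - V(X) U(Y)) / (Y - X)\<close>, where \<open>U\<close> and \<open>V\<close> are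
  the generating functions of the entries of \<open>u\<close> and \<open>v\<close> with positive
  index.\<close>

definition bez :: "(int \<Rightarrow> complex) \<Rightarrow> (int \<Rightarrow> complex) \<Rightarrow> int \<Rightarrow> int \<Rightarrow> complex" where
  "bez u v j l = (\<Sum>i=1..j. minor u v i (j + l + 1 - i))"

text \<open>
  If \<open>v (N + 1) = 1\<close> and \<open>m = v 1 + v 2 X + \<dots> + v (N + 1) X\<^sup>N\<close>, these are the structure constants of the
  polynomials modulo \<open>m\<close> in the basis of the negated Horner polynomials
  \<open>- (v (k + 1) + v (k + 2) X + \<dots> + v (N + 1) X\<^sup>N\<^sup>-\<^sup>k)\<close>, \<open>1 \<le> k \<le> N\<close>.
\<close>

definition horner_mult :: "(int \<Rightarrow> complex) \<Rightarrow> int \<Rightarrow> int \<Rightarrow> int \<Rightarrow> complex" where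
  "horner_mult v k s l =
     v (k + s + 1 - l) * (of_bool (max k s < l) - of_bool (l \<le> min k s))"

lemma minor_swap: "minor u v i j = - minor u v j i"
  by (simp add: minor_def algebra_simps)

lemma minor_commute: "minor v u i j = - minor u v i j"
  by (simp add: minor_def algebra_simps)

lemma sum_reflect_int: "(\<Sum>i=a..b. f i) = (\<Sum>i=a..b. f (a + b - i))" for f :: "int \<Rightarrow> complex"
  by (rule sum.reindex_bij_witness [of _ "\<lambda>i. a + b - i" "\<lambda>i. a + b - i"]) auto

text \<open>The reflection of the range exchanges the two arguments of \<open>minor\<close>, which
  reverses the sign.\<close>

lemma sum_minor_symmetric_range: "(\<Sum>i=a..b. minor u v i (a + b - i)) = 0"
proof -
  have "(\<Sum>i=a..b. minor u v i (a + b - i)) = (\<Sum>i=a..b. minor u v (a + b - i) (a + b - (a + b - i)))"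
    by (rule sum_reflect_int)
  also have "\<dots> = - (\<Sum>i=a..b. minor u v i (a + b - i))"
    unfolding sum_negf [symmetric] by (intro sum.cong refl) (subst minor_swap, simp)
  finally show ?thesis by (simp add: equal_neg_zero)
qed

lemma sum_split_int: "a \<le> c + 1 \<Longrightarrow> c \<le> b \<Longrightarrow> (\<Sum>i=a..b. f i) = (\<Sum>i=a..c. f i) + (\<Sum>i=c+1..b. f i)"
  for f :: "int \<Rightarrow> complex"
proof -
  assume "a \<le> c + 1" "c \<le> b"
  then have "{a..b} = {a..c} \<union> {c+1..b}" by auto
  then show ?thesis by (simp add: sum.union_disjoint)
qed

text \<open>This is the symmetry of the Bezoutian in its two indices: the terms with
  \<open>i\<close> strictly beyond the smaller of \<open>j\<close> and \<open>l\<close> fill a range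
  that \<open>i \<mapsto> j + l + 1 - i\<close> maps to itself, so they cancel.\<close>

lemma bez_upper:
  assumes "0 \<le> j" "0 \<le> l"
  shows "(\<Sum>i=1..l. minor u v i (j + l + 1 - i)) = bez u v j l"
proof -
  have *: "(\<Sum>i=1..b. minor u v i (a + b + 1 - i)) = (\<Sum>i=1..a. minor u v i (a + b + 1 - i))"
    if "0 \<le> a" "a \<le> b" for a b
    using that sum_minor_symmetric_range [of u v "a + 1" b]
    by (subst sum_split_int [of 1 a b]) (simp_all add: algebra_simps)
  show ?thesis
  proof (cases "j \<le> l")
    case True then show ?thesis using * [of j l] assms by (simp add: bez_def)
  next
    case False then show ?thesis using * [of l j] assms by (simp add: bez_def add.commute)
  qed
qed

text \<open>Coefficient form of multiplying the Bezoutian by \<open>Y - X\<close>.\<close>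

lemma bez_shift:
  assumes "0 \<le> j"
  shows "bez u v (j + 1) l = bez u v j (l + 1) + minor u v (j + 1) (l + 1)"
  using assms unfolding bez_def
  by (subst sum_split_int [of 1 j "j + 1"]) (simp_all add: algebra_simps)

lemma bez_commute: "bez v u j l = - bez u v j l"
  by (simp add: bez_def minor_commute [of v u] sum_negf)

lemma bez_0 [simp]: "bez u v 0 l = 0"
  by (simp add: bez_def)

text \<open>The index \<open>k + s + 1 - l\<close> of \<open>v\<close> does not change. Only the
  indicators do, and only at \<open>l = s\<close>: there either the first one switches on
  (\<open>k < s\<close>) or the second one switches off (\<open>s \<le> k\<close>).\<close>

lemma horner_mult_shift: "horner_mult v (k + 1) s (l + 1) = horner_mult v k s l + v (k + 1) * of_bool (l = s)"
  by (auto simp: horner_mult_def of_bool_def min_def max_def algebra_simps add.commute [of k 1])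

text \<open>No value of \<open>v (N + 1)\<close> is prescribed, because the locale is used with the
  modes of \<open>w\<close> as \<open>v\<close> and also with those of \<open>\<Gamma>(w)p\<close>,
  whose mode \<open>N + 1\<close> is 0.\<close>

locale bez_pair =
  fixes u v :: "int \<Rightarrow> complex" and N :: int
  assumes N: "0 \<le> N"
    and v0: "\<And>i. i \<le> 0 \<Longrightarrow> v i = 0"
    and uN: "\<And>i. i > N + 1 \<Longrightarrow> u i = 0" and vN: "\<And>i. i > N + 1 \<Longrightarrow> v i = 0"
begin

text \<open>The trilinear form that pairs the \<open>j\<close>-th basis element with the product of
  the \<open>k\<close>-th and the \<open>s\<close>-th. Invariance of the form becomes symmetry in
  \<open>j\<close> and \<open>k\<close>.\<close>

definition tri :: "int \<Rightarrow> int \<Rightarrow> int \<Rightarrow> complex" where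
  "tri j k s = (\<Sum>l=1..N. bez u v j l * horner_mult v k s l)"

lemma bez_beyond: "l > N \<Longrightarrow> bez u v j l = 0"
  unfolding bez_def minor_def by (intro sum.neutral) (auto simp: uN vN)

text \<open>Under \<open>l \<mapsto> k + s - l\<close> the terms above \<open>max k s\<close> become
  those below \<open>min k s\<close>. The product of the two values of \<open>v\<close> is
  invariant, so everything cancels except the term \<open>l = min k s\<close>.\<close>

lemma sum_v_horner_mult:
  assumes "0 \<le> k" "0 \<le> s"
  shows "(\<Sum>l=0..N. v (l + 1) * horner_mult v k s l) = - v (k + 1) * v (s + 1)"
proof -
  let ?A = "\<lambda>l. v (l + 1) * v (k + s + 1 - l)"
  \<comment> \<open>The range \<open>0..N\<close> is exchanged for \<open>0..k+s\<close>, on which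
    the reflection acts. The summand vanishes beyond either bound, so both are compared with
    \<open>0..k+s+N\<close>.\<close>
  have big: "(\<Sum>l=0..N. f l) = (\<Sum>l=0..k+s+N. f l)" if "\<And>l. l > N \<Longrightarrow> f l = 0" for f :: "int \<Rightarrow> complex"
    using assms that N by (intro sum.mono_neutral_left) auto
  have big': "(\<Sum>l=0..k+s. f l) = (\<Sum>l=0..k+s+N. f l)" if "\<And>l. l > k + s \<Longrightarrow> f l = 0" for f :: "int \<Rightarrow> complex"
    using assms that N by (intro sum.mono_neutral_left) auto
  have "(\<Sum>l=0..N. v (l + 1) * horner_mult v k s l) = (\<Sum>l=0..k+s. v (l + 1) * horner_mult v k s l)"
    by (subst big, simp add: vN, subst big') (auto simp: horner_mult_def v0)
  also have "\<dots> = (\<Sum>l=0..k+s. ?A l * of_bool (max k s < l)) - (\<Sum>l=0..k+s. ?A l * of_bool (l \<le> min k s))"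
    by (simp add: horner_mult_def algebra_simps sum_subtractf)
  also have "(\<Sum>l=0..k+s. ?A l * of_bool (max k s < l)) = (\<Sum>l=0..k+s. ?A l * of_bool (l < min k s))"
    by (subst sum_reflect_int) (auto intro!: sum.cong simp: algebra_simps min_def max_def)
  also have "\<dots> - (\<Sum>l=0..k+s. ?A l * of_bool (l \<le> min k s)) = (\<Sum>l=0..k+s. - ?A l * of_bool (l = min k s))"
    unfolding sum_subtractf [symmetric] by (intro sum.cong refl) (auto simp: of_bool_def)
  also have "\<dots> = - ?A (min k s)"
    using assms by (subst sum.remove [of _ "min k s"]) auto
  finally show ?thesis by (auto simp: min_def algebra_simps split: if_splits)
qed

text \<open>The same reflection now exchanges the roles of \<open>u\<close> and \<open>v\<close>.
  The terms below \<open>min k s\<close> no longer cancel but pair up into minors, whose sum is a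
  Bezoutian.\<close>

lemma sum_u_horner_mult:
  assumes "0 \<le> k" "0 \<le> s"
  shows "(\<Sum>l=0..N. u (l + 1) * horner_mult v k s l) = - bez u v k (s + 1) - u (k + 1) * v (s + 1)"
proof -
  let ?A = "\<lambda>l. u (l + 1) * v (k + s + 1 - l)"
  let ?B = "\<lambda>l. v (l + 1) * u (k + s + 1 - l)"
  have big: "(\<Sum>l=0..N. f l) = (\<Sum>l=0..k+s+N. f l)" if "\<And>l. l > N \<Longrightarrow> f l = 0" for f :: "int \<Rightarrow> complex"
    using assms that N by (intro sum.mono_neutral_left) auto
  have big': "(\<Sum>l=0..k+s. f l) = (\<Sum>l=0..k+s+N. f l)" if "\<And>l. l > k + s \<Longrightarrow> f l = 0" for f :: "int \<Rightarrow> complex"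
    using assms that N by (intro sum.mono_neutral_left) auto
  have "(\<Sum>l=0..N. u (l + 1) * horner_mult v k s l) = (\<Sum>l=0..k+s. u (l + 1) * horner_mult v k s l)"
    by (subst big, simp add: uN, subst big') (auto simp: horner_mult_def v0)
  also have "\<dots> = (\<Sum>l=0..k+s. ?A l * of_bool (max k s < l)) - (\<Sum>l=0..k+s. ?A l * of_bool (l \<le> min k s))"
    by (simp add: horner_mult_def algebra_simps sum_subtractf)
  also have "(\<Sum>l=0..k+s. ?A l * of_bool (max k s < l)) = (\<Sum>l=0..k+s. ?B l * of_bool (l < min k s))"
    by (subst sum_reflect_int) (auto intro!: sum.cong simp: algebra_simps min_def max_def)
  also have "\<dots> - (\<Sum>l=0..k+s. ?A l * of_bool (l \<le> min k s)) =
      (\<Sum>l=0..k+s. - minor u v (l + 1) (k + s + 1 - l) * of_bool (l < min k s) - ?A l * of_bool (l = min k s))"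
    unfolding sum_subtractf [symmetric] by (intro sum.cong refl) (auto simp: of_bool_def minor_def algebra_simps)
  also have "\<dots> = - (\<Sum>l=0..k+s. minor u v (l + 1) (k + s + 1 - l) * of_bool (l < min k s)) - ?A (min k s)"
  proof -
    have "(\<Sum>l=0..k+s. ?A l * of_bool (l = min k s)) = ?A (min k s)"
      using assms by (subst sum.remove [of _ "min k s"]) auto
    then show ?thesis by (simp add: sum_subtractf sum_negf)
  qed
  also have "(\<Sum>l=0..k+s. minor u v (l + 1) (k + s + 1 - l) * of_bool (l < min k s))
      = (\<Sum>i=1..min k s. minor u v i (k + s + 2 - i))"
  proof -
    have "(\<Sum>l=0..k+s. minor u v (l + 1) (k + s + 1 - l) * of_bool (l < min k s)) =
        (\<Sum>l=0..min k s - 1. minor u v (l + 1) (k + s + 1 - l))"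
      using assms by (intro sum.mono_neutral_cong_right) auto
    also have "\<dots> = (\<Sum>i=1..min k s. minor u v i (k + s + 2 - i))"
      by (rule sum.reindex_bij_witness [of _ "\<lambda>i. i - 1" "\<lambda>i. i + 1"]) (auto simp: algebra_simps)
    finally show ?thesis .
  qed
  finally have *: "(\<Sum>l=0..N. u (l + 1) * horner_mult v k s l) =
      - (\<Sum>i=1..min k s. minor u v i (k + s + 2 - i)) - ?A (min k s)" .
  show ?thesis
  proof (cases "k \<le> s")
    case True
    then show ?thesis unfolding * by (simp add: bez_def min_def algebra_simps)
  next
    case False
    \<comment> \<open>The minors stop at \<open>min k s = s\<close>, so \<open>bez_upper\<close> is
      used to stop the Bezoutian at \<open>s + 1\<close>. The one extra minor turns
      \<open>u (s + 1) * v (k + 1)\<close> into \<open>u (k + 1) * v (s + 1)\<close>.\<close>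
    have "bez u v k (s + 1) = (\<Sum>i=1..s+1. minor u v i (k + (s + 1) + 1 - i))"
      using bez_upper [of k "s + 1" u v] assms by simp
    also have "\<dots> = (\<Sum>i=1..s. minor u v i (k + s + 2 - i)) + minor u v (s + 1) (k + 1)"
      using assms by (subst sum_split_int [of 1 s "s + 1"]) (auto simp: algebra_simps)
    finally show ?thesis using False unfolding *
      by (simp add: min_def minor_def algebra_simps)
  qed
qed

lemma tri_shift:
  assumes "0 \<le> j" "0 \<le> k" "0 \<le> s"
  shows "tri (j + 1) k s - tri j (k + 1) s =
    v (s + 1) * (v (j + 1) * u (k + 1) - u (j + 1) * v (k + 1))
    + v (j + 1) * bez u v k (s + 1) - v (k + 1) * bez u v j (s + 1)"
proof -
  have ext: "(\<Sum>l=0..N. f l) = f 0 + (\<Sum>l=1..N. f l)" for f :: "int \<Rightarrow> complex"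
    using N by (subst sum_split_int [of 0 0 N]) auto
  have "tri j (k + 1) s = (\<Sum>l=0..N-1. bez u v j (l + 1) * horner_mult v (k + 1) s (l + 1))"
    unfolding tri_def by (rule sum.reindex_bij_witness [of _ "\<lambda>l. l + 1" "\<lambda>l. l - 1"]) auto
  \<comment> \<open>The added term \<open>l = N\<close> contains
    \<open>bez u v j (N + 1) = 0\<close>. Both sums now have the range on which the two preceding
    lemmas evaluate.\<close>
  also have "\<dots> = (\<Sum>l=0..N. bez u v j (l + 1) * horner_mult v (k + 1) s (l + 1))"
    using N by (intro sum.mono_neutral_left) (auto simp: bez_beyond)
  also have "\<dots> = (\<Sum>l=0..N. bez u v j (l + 1) * horner_mult v k s l)
      + (\<Sum>l=0..N. bez u v j (l + 1) * v (k + 1) * of_bool (l = s))"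
    unfolding sum.distrib [symmetric] by (intro sum.cong refl) (simp only: horner_mult_shift, simp add: algebra_simps)
  also have "(\<Sum>l=0..N. bez u v j (l + 1) * v (k + 1) * of_bool (l = s)) = bez u v j (s + 1) * v (k + 1)"
  proof (cases "s \<le> N")
    case True
    then show ?thesis using assms by (subst sum.remove [of _ s]) auto
  next
    case False
    then show ?thesis by (subst bez_beyond) (auto intro!: sum.neutral)
  qed
  finally have 1: "tri j (k + 1) s = (\<Sum>l=0..N. bez u v j (l + 1) * horner_mult v k s l) + bez u v j (s + 1) * v (k + 1)" .
  have b1: "bez u v (j + 1) 0 = 0"
    using sum_minor_symmetric_range [of u v 1 "j + 1"] by (simp add: bez_def algebra_simps)
  have "tri (j + 1) k s = (\<Sum>l=0..N. bez u v (j + 1) l * horner_mult v k s l)"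
    unfolding ext tri_def by (simp add: b1)
  also have "\<dots> = (\<Sum>l=0..N. bez u v j (l + 1) * horner_mult v k s l)
     + (\<Sum>l=0..N. minor u v (j + 1) (l + 1) * horner_mult v k s l)"
    unfolding bez_shift [OF assms(1)] by (simp add: sum.distrib distrib_right)
  also have "(\<Sum>l=0..N. minor u v (j + 1) (l + 1) * horner_mult v k s l) =
     u (j + 1) * (\<Sum>l=0..N. v (l + 1) * horner_mult v k s l) - v (j + 1) * (\<Sum>l=0..N. u (l + 1) * horner_mult v k s l)"
    by (simp add: minor_def sum_distrib_left algebra_simps sum_subtractf)
  finally show ?thesis unfolding 1 sum_v_horner_mult [OF assms(2,3)] sum_u_horner_mult [OF assms(2,3)]
    by (simp add: algebra_simps)
qed

lemma tri_0_left [simp]: "tri 0 k s = 0"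
  by (simp add: tri_def)

lemma tri_0_right: "0 \<le> s \<Longrightarrow> tri j 0 s = 0"
  unfolding tri_def by (intro sum.neutral) (auto simp: horner_mult_def v0 max_def)

text \<open>The right-hand side of \<open>tri_shift\<close> changes sign when \<open>j\<close> and
  \<open>k\<close> are exchanged. Hence \<open>tri j k s - tri k j s\<close> keeps its value when
  one unit moves from \<open>j\<close> to \<open>k\<close>, and at \<open>j = 0\<close> it is
  0.\<close>

theorem tri_symmetric:
  assumes "0 \<le> j" "0 \<le> k" "0 \<le> s"
  shows "tri j k s = tri k j s"
proof -
  have "\<forall>k\<ge>0. tri (int n) k s = tri k (int n) s" for n
  proof (induction n)
    case 0
    then show ?case using tri_0_right assms(3) by simp
  next
    case (Suc n)
    show ?case
    proof (intro allI impI)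
      fix k :: int assume k: "k \<ge> 0"
      have "tri (int n + 1) k s - tri k (int n + 1) s = 
         (tri (int n) (k + 1) s - tri (k + 1) (int n) s)
         + (tri (int n + 1) k s - tri (int n) (k + 1) s) + (tri (k + 1) (int n) s - tri k (int n + 1) s)"
        by simp
      also have "\<dots> = 0"
        using k Suc assms(3) by (subst (1 2) tri_shift) (auto simp: algebra_simps)
      finally show "tri (int (Suc n)) k s = tri k (int (Suc n)) s"
        unfolding of_nat_Suc add.commute [of 1 "int n"] by simp
    qed
  qed
  from this [of "nat j"] show ?thesis using assms by simp
qed

end

section \<open>Summable Fourier coefficients\<close>

lemma norm_echar [simp]: "cmod (echar k y) = 1"
  by (simp add: echar_def norm_exp_eq_Re)

lemma echar_minus_mult [simp]: "echar (- k) y * echar k y = 1"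
  using echar_add [of "- k" k y] by simp

lemma summable_inverse_jap_sq: "(\<lambda>k. 1 / (jap k)\<^sup>2) summable_on UNIV"
proof -
  have "summable (\<lambda>n. 1 / (jap (int n))\<^sup>2)"
  proof (subst summable_cong)
    show "eventually (\<lambda>n. 1 / (jap (int n))\<^sup>2 = inverse (real n ^ 2)) sequentially"
      using eventually_gt_at_top [of 0] by eventually_elim (auto simp: jap_def field_simps)
  qed (use inverse_power_summable [of 2, where 'a = real] in simp)
  then have nat: "(\<lambda>n. 1 / (jap (int n))\<^sup>2) summable_on UNIV"
    by (intro norm_summable_imp_summable_on) simp
  have jm: "jap (- k) = jap k" for k by (simp add: jap_def)
  have "(\<lambda>k. 1 / (jap k)\<^sup>2) summable_on range int"
    using nat by (subst summable_on_reindex) (auto simp: o_def)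
  moreover have "(\<lambda>k. 1 / (jap k)\<^sup>2) summable_on range (\<lambda>n. - int n)"
    using nat by (subst summable_on_reindex) (auto simp: o_def inj_on_def jm)
  ultimately have "(\<lambda>k. 1 / (jap k)\<^sup>2) summable_on (range int \<union> range (\<lambda>n. - int n))"
    by (rule summable_on_union)
  moreover have "range int \<union> range (\<lambda>n. - int n) = UNIV"
    by (auto intro: int_cases2)
  ultimately show ?thesis by simp
qed

text \<open>The Cauchy-Schwarz constant of the embedding of the space \<open>h1\<close> into
  absolutely convergent Fourier series, and so into bounded functions.\<close>

definition h1_const :: real where
  "h1_const = sqrt (\<Sum>\<^sub>\<infinity>k. 1 / (jap k)\<^sup>2)"

lemma sum_norm_h1_coeff_le: "finite F \<Longrightarrow> (\<Sum>k\<in>F. cmod (h1_coeff f k)) \<le> h1_const * norm f"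
proof -
  assume F: "finite F"
  have "(\<Sum>k\<in>F. cmod (h1_coeff f k)) = (\<Sum>k\<in>F. \<bar>1 / jap k\<bar> * \<bar>cmod (h1_coeff f k) * jap k\<bar>)"
    using less_imp_neq [OF jap_pos] by (intro sum.cong refl) (simp add: abs_mult)
  also have "\<dots> \<le> L2_set (\<lambda>k. 1 / jap k) F * L2_set (\<lambda>k. cmod (h1_coeff f k) * jap k) F"
    by (rule L2_set_mult_ineq)
  also have "\<dots> \<le> h1_const * norm f"
  proof (intro mult_mono)
    show "L2_set (\<lambda>k. 1 / jap k) F \<le> h1_const"
      unfolding L2_set_def h1_const_def power_divide one_power2
      by (intro real_sqrt_le_mono finite_sum_le_infsum summable_inverse_jap_sq F) auto
    show "L2_set (\<lambda>k. cmod (h1_coeff f k) * jap k) F \<le> norm f"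
      unfolding L2_set_def norm_h1_eq power_mult_distrib
      by (intro real_sqrt_le_mono finite_sum_le_infsum h1_summable F) auto
  qed (auto simp: h1_const_def intro!: infsum_nonneg L2_set_nonneg)
  finally show ?thesis .
qed

lemma h1_const_nonneg: "0 \<le> h1_const"
  by (auto simp: h1_const_def intro!: infsum_nonneg)

lemma summable_h1_coeff: "h1_coeff f summable_on UNIV"
proof -
  have "(\<lambda>k. cmod (h1_coeff f k)) summable_on UNIV"
    using sum_norm_h1_coeff_le by (intro nonneg_bdd_above_summable_on) (auto intro!: bdd_aboveI2)
  then show ?thesis by (rule abs_summable_summable)
qed

lemma norm_h1_coeff_le: "cmod (h1_coeff f k) \<le> norm f"
proof -
  have "(cmod (h1_coeff f k))\<^sup>2 * 1 \<le> (cmod (h1_coeff f k))\<^sup>2 * (jap k)\<^sup>2"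
    by (intro mult_left_mono one_le_power) (auto simp: jap_def)
  also have "\<dots> = (\<Sum>k\<in>{k}. (cmod (h1_coeff f k))\<^sup>2 * (jap k)\<^sup>2)"
    by simp
  also have "\<dots> \<le> (\<Sum>\<^sub>\<infinity>k. (cmod (h1_coeff f k))\<^sup>2 * (jap k)\<^sup>2)"
    by (intro finite_sum_le_infsum h1_summable) auto
  finally have "sqrt ((cmod (h1_coeff f k))\<^sup>2) \<le> norm f"
    unfolding norm_h1_eq by (intro real_sqrt_le_mono) simp
  then show ?thesis by simp
qed

section \<open>Absolutely convergent Fourier series and the Wiener algebra\<close>

definition fser :: "(int \<Rightarrow> complex) \<Rightarrow> real \<Rightarrow> complex" where
  "fser c y = (\<Sum>\<^sub>\<infinity>k. c k * echar k y)"

lemma has_sum_fser: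
  assumes "c summable_on UNIV"
  shows "((\<lambda>k. c k * echar k y) has_sum fser c y) UNIV"
proof -
  have "(\<lambda>k. c k * echar k y) summable_on UNIV"
    using assms by (simp add: summable_on_iff_abs_summable_on_complex norm_mult)
  then show ?thesis by (simp add: fser_def)
qed

lemma continuous_fser:
  assumes "c summable_on UNIV"
  shows "continuous_on A (fser c)"
proof (rule uniform_limit_theorem)
  show "uniform_limit A (\<lambda>F y. \<Sum>k\<in>F. c k * echar k y) (fser c) (finite_subsets_at_top UNIV)"
    using assms unfolding fser_def [abs_def]
    by (intro Weierstrass_m_test_general [where M = "\<lambda>k. cmod (c k)"])
      (auto simp: norm_mult summable_on_iff_abs_summable_on_complex)
qed (auto intro!: always_eventually continuous_intros)

lemma fser_periodic: "fser c (y + 1) = fser c y"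
  by (simp add: fser_def echar_periodic)

text \<open>Uniform convergence of the series permits termwise integration. The second factor need
  only be continuous, which later admits \<open>f / w\<^sup>2\<close> without any summability of its
  coefficients.\<close>

lemma has_sum_fourier_coeff_fser_mult:
  assumes c: "c summable_on UNIV" and g: "continuous_on {0..1} g"
  shows "((\<lambda>k. c k * fourier_coeff g (n - k)) has_sum fourier_coeff (\<lambda>y. fser c y * g y) n) UNIV"
proof -
  let ?f = "\<lambda>k y. c k * echar k y * (g y * echar (- n) y)"
  have "bounded (g ` {0..1})"
    by (intro compact_imp_bounded compact_continuous_image g) auto
  then obtain B where B: "\<And>y. y \<in> {0..1} \<Longrightarrow> cmod (g y) \<le> B"
    unfolding bounded_iff by blast
  have lim: "uniform_limit {0..1} (\<lambda>F y. \<Sum>k\<in>F. ?f k y) (\<lambda>y. fser c y * (g y * echar (- n) y))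
      (finite_subsets_at_top UNIV)"
  proof (rule Weierstrass_m_test_general' [where M = "\<lambda>k. cmod (c k) * B"])
    show "(\<lambda>k. cmod (c k) * B) summable_on UNIV"
      using c by (intro summable_on_cmult_left) (simp add: summable_on_iff_abs_summable_on_complex)
  qed (auto simp: norm_mult intro!: mult_left_mono B has_sum_cmult_left has_sum_fser c)
  obtain I J where IJ: "\<And>F. ((\<lambda>y. \<Sum>k\<in>F. ?f k y) has_integral I F) {0..1}"
      "((\<lambda>y. fser c y * (g y * echar (- n) y)) has_integral J) {0..1}"
      "(I \<longlongrightarrow> J) (finite_subsets_at_top UNIV)"
    by (rule uniform_limit_integral [OF lim]) (auto intro!: continuous_intros g)
  have 1: "J = fourier_coeff (\<lambda>y. fser c y * g y) n"
    using IJ(2) by (simp add: fourier_coeff_def integral_unique mult.assoc)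
  have 2: "I F = (\<Sum>k\<in>F. c k * fourier_coeff g (n - k))" if "finite F" for F
  proof -
    have "?f k y = c k * (g y * echar (- (n - k)) y)" for k y
      using echar_add [of k "- n" y] by simp
    then have "I F = integral {0..1} (\<lambda>y. \<Sum>k\<in>F. c k * (g y * echar (- (n - k)) y))"
      using integral_unique [OF IJ(1) [of F]] by presburger
    also have "\<dots> = (\<Sum>k\<in>F. c k * fourier_coeff g (n - k))"
      using that by (subst integral_sum)
        (auto simp: fourier_coeff_def intro!: integrable_on_mult_right fourier_coeff_integrable [of g "- _", simplified] integrable_continuous_interval continuous_intros g)
    finally show ?thesis .
  qed
  have "((\<lambda>F. \<Sum>k\<in>F. c k * fourier_coeff g (n - k)) \<longlongrightarrow> J) (finite_subsets_at_top UNIV)"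
    using IJ(3) by (rule Lim_transform_eventually) (auto intro!: eventually_finite_subsets_at_top_weakI simp: 2)
  then show ?thesis unfolding has_sum_def 1 .
qed

lemma fourier_coeff_const: "fourier_coeff (\<lambda>_. z) k = (if k = 0 then z else 0)"
  using fourier_coeff_mode [of z 0 k] by simp

lemma fourier_coeff_fser:
  assumes "c summable_on UNIV"
  shows "fourier_coeff (fser c) = c"
proof
  fix n
  have "((\<lambda>k. c k * fourier_coeff (\<lambda>_. 1) (n - k)) has_sum fourier_coeff (\<lambda>y. fser c y * 1) n) UNIV"
    by (intro has_sum_fourier_coeff_fser_mult assms) auto
  moreover have "((\<lambda>k. c k * fourier_coeff (\<lambda>_. 1) (n - k)) has_sum c n) UNIV"
    by (rule has_sum_finite_neutralI [where B = "{n}"]) (auto simp: fourier_coeff_const)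
  ultimately show "fourier_coeff (fser c) n = c n"
    using has_sum_unique by fastforce
qed

text \<open>The class in which projections behave: \<open>Pi_plus\<close> and
  \<open>Pi_plus0\<close> are infinite sums with default value 0, and summable coefficients ensure
  that they have the truncated spectrum.\<close>

definition wiener :: "(real \<Rightarrow> complex) \<Rightarrow> bool" where
  "wiener f \<longleftrightarrow> continuous_on UNIV f \<and> (\<forall>y. f (y + 1) = f y) \<and> fourier_coeff f summable_on UNIV"

lemma wiener_fser: "c summable_on UNIV \<Longrightarrow> wiener (fser c)"
  by (simp add: wiener_def continuous_fser fser_periodic fourier_coeff_fser)

lemma wiener_continuous: "wiener f \<Longrightarrow> continuous_on A f"
  unfolding wiener_def using continuous_on_subset by blast

lemma wiener_summable: "wiener f \<Longrightarrow> fourier_coeff f summable_on A"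
  unfolding wiener_def using summable_on_subset_banach by blast

lemma wiener_eq_fser:
  assumes "wiener f"
  shows "fser (fourier_coeff f) = f"
proof -
  let ?g = "fser (fourier_coeff f)"
  have s: "fourier_coeff f summable_on UNIV" using assms wiener_summable by blast
  have "(\<lambda>y. ?g y + (-1) * f y) = (\<lambda>_. 0)"
  proof (rule fourier_coeff_zero_imp_zero)
    show "fourier_coeff (\<lambda>y. ?g y + (-1) * f y) k = 0" for k
      using s assms by (subst fourier_coeff_add)
        (simp_all only: fourier_coeff_scale fourier_coeff_fser continuous_fser wiener_continuous continuous_on_mult_left, simp)
  qed (use s assms in \<open>auto simp: wiener_def fser_periodic intro!: continuous_intros continuous_fser\<close>)
  then show ?thesis by (auto simp: fun_eq_iff)
qed

lemma wiener_h1 [simp]: "wiener (h1_fun f)"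
  by (simp add: wiener_def h1_fun_continuous h1_fun_periodic summable_h1_coeff)

lemma has_sum_fourier_coeff_mult:
  assumes "wiener f" "continuous_on {0..1} g"
  shows "((\<lambda>k. fourier_coeff f k * fourier_coeff g (n - k)) has_sum fourier_coeff (\<lambda>y. f y * g y) n) UNIV"
  using has_sum_fourier_coeff_fser_mult [OF wiener_summable [OF assms(1)] assms(2)]
  by (simp add: wiener_eq_fser assms)

text \<open>The family \<open>a_k b_l\<close> is absolutely summable over pairs. The shear
  \<open>(k, l) \<mapsto> (k + l, k)\<close> turns its row sums into convolution
  coefficients.\<close>

lemma wiener_mult:
  assumes "wiener f" "wiener g"
  shows "wiener (\<lambda>y. f y * g y)"
proof -
  let ?a = "fourier_coeff f" and ?b = "fourier_coeff g"
  have ab: "(\<lambda>k. norm (?a k)) summable_on UNIV" "(\<lambda>k. norm (?b k)) summable_on UNIV"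
    using assms wiener_summable summable_on_iff_abs_summable_on_complex by blast+
  have "(\<lambda>(k, l). norm (?a k) * norm (?b l)) summable_on UNIV \<times> UNIV"
    using ab by (intro summable_on_SigmaI [where g = "\<lambda>k. norm (?a k) * (\<Sum>\<^sub>\<infinity>l. norm (?b l))"])
      (auto intro!: has_sum_cmult_right summable_on_cmult_left)
  then have "(\<lambda>(n, k). norm (?a k) * norm (?b (n - k))) summable_on UNIV \<times> UNIV"
    by (subst (asm) summable_on_reindex_bij_witness [of _ "\<lambda>(n, k). (k, n - k)" "\<lambda>(k, l). (k + l, k)"]) auto
  then have "(\<lambda>(n, k). norm (?a k * ?b (n - k))) summable_on (SIGMA n:UNIV. UNIV)"
    by (simp add: norm_mult)
  then have "(\<lambda>(n, k). ?a k * ?b (n - k)) summable_on (SIGMA n:UNIV. UNIV)"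
    by (rule abs_summable_summable [OF summable_on_cong [THEN iffD1, rotated]]) auto
  then have "(\<lambda>n. \<Sum>\<^sub>\<infinity>k. ?a k * ?b (n - k)) summable_on UNIV"
    by (rule summable_on_Sigma_banach)
  moreover have "(\<Sum>\<^sub>\<infinity>k. ?a k * ?b (n - k)) = fourier_coeff (\<lambda>y. f y * g y) n" for n
    using has_sum_fourier_coeff_mult [OF assms(1) wiener_continuous [OF assms(2)]] by (rule infsumI)
  ultimately show ?thesis
    using assms by (auto simp: wiener_def intro!: continuous_on_mult)
qed

lemma
  assumes "wiener f"
  shows wiener_Pi_plus: "wiener (Pi_plus f)"
    and fourier_coeff_Pi_plus: "fourier_coeff (Pi_plus f) k = (if 0 \<le> k then fourier_coeff f k else 0)"
    and wiener_Pi_plus0: "wiener (Pi_plus0 f)"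
    and fourier_coeff_Pi_plus0: "fourier_coeff (Pi_plus0 f) k = (if 1 \<le> k then fourier_coeff f k else 0)"
proof -
  have gen: "(\<lambda>y. \<Sum>\<^sub>\<infinity>k\<in>A. fourier_coeff f k * echar k y) = fser (\<lambda>k. if k \<in> A then fourier_coeff f k else 0)" for A
    unfolding fser_def by (intro ext infsum_cong_neutral) auto
  have s: "(\<lambda>k. if k \<in> A then fourier_coeff f k else 0) summable_on UNIV" for A
    using wiener_summable [OF assms, of A] by (rule summable_on_cong_neutral [THEN iffD1, rotated -1]) auto
  have 1: "Pi_plus f = fser (\<lambda>k. if k \<in> {0..} then fourier_coeff f k else 0)"
    unfolding gen [symmetric] by (auto simp: Pi_plus_def)
  have 2: "Pi_plus0 f = fser (\<lambda>k. if k \<in> {1..} then fourier_coeff f k else 0)"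
    unfolding gen [symmetric] by (auto simp: Pi_plus0_def)
  show "wiener (Pi_plus f)" "wiener (Pi_plus0 f)"
    unfolding 1 2 by (intro wiener_fser s)+
  show "fourier_coeff (Pi_plus f) k = (if 0 \<le> k then fourier_coeff f k else 0)"
     "fourier_coeff (Pi_plus0 f) k = (if 1 \<le> k then fourier_coeff f k else 0)"
    unfolding 1 2 by (subst fourier_coeff_fser [OF s], simp)+
qed

lemma shift_power: "(shift ^^ m) f = (\<lambda>y. echar (- int m) y * f y)"
proof (induction m)
  case (Suc m)
  then show ?case using echar_add [of "- 1" "- int m"] by (auto simp: shift_def algebra_simps)
qed auto

lemma fourier_coeff_shift_power: "fourier_coeff ((shift ^^ m) f) k = fourier_coeff f (k + int m)"
  by (simp add: shift_power fourier_coeff_echar_shift)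

lemma wiener_echar: "wiener (echar l)"
  unfolding wiener_def
proof (intro conjI allI)
  have "fourier_coeff (echar l) = (\<lambda>k. if k = l then 1 else 0)"
    using fourier_coeff_mode [of 1 l] by auto
  then show "fourier_coeff (echar l) summable_on UNIV"
    by (auto intro!: finite_nonzero_values_imp_summable_on)
qed (auto simp: echar_periodic intro: continuous_intros)

lemma wiener_shift_power: "wiener f \<Longrightarrow> wiener ((shift ^^ m) f)"
  unfolding shift_power by (intro wiener_mult wiener_echar)

lemma
  assumes "wiener f"
  shows wiener_reflect: "wiener (reflect f)"
    and fourier_coeff_reflect: "fourier_coeff (reflect f) k = fourier_coeff f (- k)"
proof -
  have b: "bij_betw uminus (UNIV :: int set) UNIV"
    by (rule bij_betwI [where g = uminus]) auto
  have s: "(\<lambda>k. fourier_coeff f (- k)) summable_on UNIV"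
    using wiener_summable [OF assms, of UNIV] summable_on_reindex_bij_betw [OF b, of "fourier_coeff f"] by simp
  have "reflect f = fser (\<lambda>k. fourier_coeff f (- k))"
  proof
    fix y
    have "reflect f y = (\<Sum>\<^sub>\<infinity>k. fourier_coeff f k * echar k (- y))"
      using wiener_eq_fser [OF assms] by (simp add: reflect_def fser_def fun_eq_iff)
    also have "\<dots> = (\<Sum>\<^sub>\<infinity>k. fourier_coeff f (- k) * echar (- k) (- y))"
      using infsum_reindex_bij_betw [OF b, of "\<lambda>k. fourier_coeff f k * echar k (- y)"] by simp
    finally show "reflect f y = fser (\<lambda>k. fourier_coeff f (- k)) y"
      by (simp add: fser_def echar_def)
  qed
  then show "wiener (reflect f)" "fourier_coeff (reflect f) k = fourier_coeff f (- k)"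
    using wiener_fser [OF s] fourier_coeff_fser [OF s] by auto
qed

section \<open>Reciprocals of polynomials in \<open>e_1\<close>\<close>

lemma wiener_const: "wiener (\<lambda>_. z)"
proof -
  have "fourier_coeff (\<lambda>_. z) = (\<lambda>k. if k = 0 then z else 0)"
    using fourier_coeff_const by auto
  then have "fourier_coeff (\<lambda>_. z) summable_on UNIV"
    by (auto intro!: finite_nonzero_values_imp_summable_on)
  then show ?thesis by (simp add: wiener_def)
qed

lemma wiener_geometric:
  assumes b: "cmod b < 1" and \<sigma>: "\<sigma> = 1 \<or> \<sigma> = - 1"
  shows "wiener (\<lambda>y. 1 / (1 - b * echar \<sigma> y))"
proof -
  define c where "c k = (if k \<in> range (\<lambda>n. \<sigma> * int n) then b ^ nat (\<sigma> * k) else 0)" for k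
  have inj: "inj (\<lambda>n. \<sigma> * int n)" using \<sigma> by (auto simp: inj_def)
  have nat: "c (\<sigma> * int n) = b ^ n" for n using \<sigma> by (auto simp: c_def)
  have "(\<lambda>n. b ^ n) summable_on UNIV"
    using b by (intro norm_summable_imp_summable_on) (simp add: norm_power summable_geometric)
  then have "c summable_on range (\<lambda>n. \<sigma> * int n)"
    by (subst summable_on_reindex [OF inj]) (simp add: o_def nat)
  then have c: "c summable_on UNIV"
    by (rule summable_on_cong_neutral [THEN iffD1, rotated -1]) (auto simp: c_def)
  have "fser c y = 1 / (1 - b * echar \<sigma> y)" for y
  proof -
    have pow: "echar (\<sigma> * int n) y = echar \<sigma> y ^ n" for n
      by (induction n) (auto simp: ring_distribs echar_add)
    have "((\<lambda>n. (b * echar \<sigma> y) ^ n) has_sum 1 / (1 - b * echar \<sigma> y)) UNIV"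
      using b by (intro norm_summable_imp_has_sum geometric_sums)
        (auto simp: norm_mult norm_power intro!: summable_geometric)
    then have "((\<lambda>k. c k * echar k y) has_sum 1 / (1 - b * echar \<sigma> y)) (range (\<lambda>n. \<sigma> * int n))"
      by (subst has_sum_reindex [OF inj]) (simp add: o_def nat pow power_mult_distrib)
    then have "((\<lambda>k. c k * echar k y) has_sum 1 / (1 - b * echar \<sigma> y)) UNIV"
      by (rule has_sum_cong_neutral [THEN iffD1, rotated -1]) (auto simp: c_def)
    then show ?thesis unfolding fser_def by (rule infsumI)
  qed
  then show ?thesis using wiener_fser [OF c] by presburger
qed

text \<open>For a root inside the unit circle the reciprocal expands in powers of
  \<open>e_(-1)\<close>, for a root outside in powers of \<open>e_1\<close>.\<close>

lemma wiener_inverse_linear: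
  assumes "cmod a \<noteq> 1"
  shows "wiener (\<lambda>y. 1 / (echar 1 y - a))"
proof (cases "cmod a < 1")
  case True
  have "1 / (echar 1 y - a) = echar (- 1) y * (1 / (1 - a * echar (- 1) y))" for y
  proof -
    have 1: "echar (- 1) y \<noteq> 0" by (metis norm_echar norm_zero zero_neq_one)
    have "1 - a * echar (- 1) y = echar (- 1) y * (echar 1 y - a)"
      using echar_minus_mult [of 1 y] by (simp add: algebra_simps)
    then show ?thesis using 1 by simp
  qed
  then show ?thesis
    using wiener_mult [OF wiener_echar wiener_geometric [OF True, of "- 1"]] by simp
next
  case False
  then have "1 < cmod a" using assms by simp
  then have a: "cmod (1 / a) < 1" "a \<noteq> 0" by (auto simp: norm_divide divide_less_eq)
  have "1 / (echar 1 y - a) = - (1 / a) * (1 / (1 - 1 / a * echar 1 y))" for y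
  proof -
    have "echar 1 y - a = - a * (1 - 1 / a * echar 1 y)" using a by (simp add: field_simps)
    then show ?thesis by simp
  qed
  then show ?thesis
    using wiener_mult [OF wiener_const wiener_geometric [OF a(1), of 1]] by presburger
qed

text \<open>Linear factors are split off one at a time. No root lies on the unit circle, because
  \<open>echar 1\<close> attains every value there.\<close>

lemma wiener_inverse_poly:
  fixes q :: "complex poly"
  assumes "\<And>y. poly q (echar 1 y) \<noteq> 0"
  shows "wiener (\<lambda>y. 1 / poly q (echar 1 y))"
  using assms
proof (induction "degree q" arbitrary: q)
  case 0
  then obtain z where "q = [:z:]" by (metis degree_0_id)
  then show ?case by (simp add: wiener_const)
next
  case (Suc n)
  then have "\<not> constant (poly q)" by (simp add: constant_degree)
  then obtain a where "poly q a = 0" using fundamental_theorem_of_algebra by blast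
  then obtain r where q: "q = [:- a, 1:] * r" by (metis dvdE poly_eq_0_iff_dvd)
  have "r \<noteq> 0" using Suc.prems q by auto
  then have "degree r = n" using Suc.hyps(2) unfolding q by (subst (asm) degree_mult_eq) auto
  moreover have "poly r (echar 1 y) \<noteq> 0" for y using Suc.prems [of y] q by auto
  ultimately have r: "wiener (\<lambda>y. 1 / poly r (echar 1 y))" using Suc.hyps(1) by blast
  have "cmod a \<noteq> 1"
  proof
    assume "cmod a = 1"
    then have "a = echar 1 (Arg2pi a / (2 * pi))"
      using Arg2pi_eq [of a] by (simp add: echar_def field_simps)
    then show False using Suc.prems \<open>poly q a = 0\<close> by metis
  qed
  then show ?case
    using wiener_mult [OF wiener_inverse_linear r] by (simp add: q algebra_simps)
qed

section \<open>The functions \<open>I_k\<close> in Fourier coefficients\<close>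

declare h1_fun_0 [simp del] h1_fun_add [simp del] h1_fun_minus [simp del] h1_fun_scaleR [simp del]

lemma has_sum_finite_sum:
  fixes f :: "'a \<Rightarrow> 'b \<Rightarrow> 'c :: topological_comm_monoid_add"
  assumes "finite I" "\<And>i. i \<in> I \<Longrightarrow> (f i has_sum S i) A"
  shows "((\<lambda>x. \<Sum>i\<in>I. f i x) has_sum (\<Sum>i\<in>I. S i)) A"
  using assms by (induction I rule: finite_induct) (simp_all add: has_sum_add)

text \<open>The bound on \<open>c\<close> is demanded only where \<open>d\<close> is nonzero. With
  \<open>d\<close> the modes of \<open>p\<close>, which has positive modes only, this confines the
  estimate to the high modes of \<open>w\<close>.\<close>

lemma
  fixes c d :: "int \<Rightarrow> complex"
  assumes d: "d summable_on UNIV" and c: "\<And>n. d n \<noteq> 0 \<Longrightarrow> cmod (c n) \<le> B"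
  shows summable_bounded_mult: "(\<lambda>n. c n * d n) summable_on UNIV"
    and norm_infsum_bounded_mult: "cmod (\<Sum>\<^sub>\<infinity>n. c n * d n) \<le> B * (\<Sum>\<^sub>\<infinity>n. cmod (d n))"
proof -
  have d': "(\<lambda>n. cmod (d n)) summable_on UNIV"
    using d by (simp add: summable_on_iff_abs_summable_on_complex)
  have le: "cmod (c n * d n) \<le> B * cmod (d n)" for n
    using c [of n] by (cases "d n = 0") (auto simp: norm_mult intro: mult_right_mono)
  have s: "(\<lambda>n. B * cmod (d n)) summable_on UNIV"
    using d' by (rule summable_on_cmult_right)
  have s': "(\<lambda>n. cmod (c n * d n)) summable_on UNIV"
    by (rule summable_on_comparison_test [OF s]) (use le in auto)
  then show "(\<lambda>n. c n * d n) summable_on UNIV"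
    by (rule abs_summable_summable)
  have "cmod (\<Sum>\<^sub>\<infinity>n. c n * d n) \<le> (\<Sum>\<^sub>\<infinity>n. cmod (c n * d n))"
    by (rule norm_infsum_bound [OF s'])
  also have "\<dots> \<le> (\<Sum>\<^sub>\<infinity>n. B * cmod (d n))"
    by (intro infsum_mono s s' le)
  also have "\<dots> = B * (\<Sum>\<^sub>\<infinity>n. cmod (d n))"
    using d' by (intro infsum_cmult_right) auto
  finally show "cmod (\<Sum>\<^sub>\<infinity>n. c n * d n) \<le> B * (\<Sum>\<^sub>\<infinity>n. cmod (d n))" .
qed

lemma infsum_norm_h1_coeff_le: "(\<Sum>\<^sub>\<infinity>k. cmod (h1_coeff f k)) \<le> h1_const * norm f"
  using summable_h1_coeff [of f] sum_norm_h1_coeff_le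
  by (intro infsum_le_finite_sums) (auto simp: summable_on_iff_abs_summable_on_complex)

lemma h1_fun_mode: "h1_fun (h1_mode z l) y = z * echar l y"
  by (transfer; simp)

lemma h1_coeff_mode [simp]: "h1_coeff (h1_mode z l) k = (if k = l then z else 0)"
  using fourier_coeff_mode [of z l k] by (simp add: h1_mode.rep_eq)

lemma h1_coeff_minus [simp]: "h1_coeff (- f) k = - h1_coeff f k"
  using h1_coeff_add [of f "- f" k] by (simp add: eq_neg_iff_add_eq_0 add.commute)

lemma h1_coeff_diff: "h1_coeff (f - g) k = h1_coeff f k - h1_coeff g k"
  using h1_coeff_add [of f "- g" k] by simp

lemma h1_coeff_sum: "h1_coeff (\<Sum>i\<in>I. f i) k = (\<Sum>i\<in>I. h1_coeff (f i) k)"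
  by (induction I rule: infinite_finite_induct) (auto simp: h1_coeff_add)

lemma h1_eqI: "(\<And>k. h1_coeff f k = h1_coeff g k) \<Longrightarrow> f = g"
  using h1_coeff_eq_0 [of "f - g"] by (simp add: h1_coeff_diff)

lemma norm_h1_mode: "norm (h1_mode z l) = cmod z * jap l"
proof -
  have "(\<Sum>\<^sub>\<infinity>k. (cmod (h1_coeff (h1_mode z l) k))\<^sup>2 * (jap k)\<^sup>2) = (cmod z)\<^sup>2 * (jap l)\<^sup>2"
    by (rule infsumI, rule has_sum_finite_neutralI [where B = "{l}"]) auto
  then show ?thesis
    using jap_pos [of l] by (simp add: norm_h1_eq real_sqrt_mult)
qed

lemma bounded_linear_h1_mode: "bounded_linear (\<lambda>z. h1_mode z l)"
  by (rule bounded_linear_intro [where K = "jap l"])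
    (auto intro!: h1_eqI simp: h1_coeff_add h1_coeff_scaleR norm_h1_mode)

lemma bounded_linear_h1_coeff: "bounded_linear (\<lambda>f. h1_coeff f k)"
  by (rule bounded_linear_intro [where K = 1])
    (auto simp: h1_coeff_add h1_coeff_scaleR norm_h1_coeff_le)

lemma norm_h1_fun_le: "cmod (h1_fun f y) \<le> h1_const * norm f"
proof -
  have "h1_fun f y = (\<Sum>\<^sub>\<infinity>k. echar k y * h1_coeff f k)"
    using wiener_eq_fser [OF wiener_h1, of f] by (simp add: fser_def fun_eq_iff mult.commute)
  also have "cmod \<dots> \<le> 1 * (\<Sum>\<^sub>\<infinity>k. cmod (h1_coeff f k))"
    by (rule norm_infsum_bounded_mult [OF summable_h1_coeff]) simp
  finally show ?thesis using infsum_norm_h1_coeff_le [of f] by simp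
qed

lemma H1p0_coeff: "f \<in> H1p0 \<Longrightarrow> k \<le> 0 \<Longrightarrow> h1_coeff f k = 0"
  by (simp add: H1p0_def)

lemma H1p0_add: "f \<in> H1p0 \<Longrightarrow> g \<in> H1p0 \<Longrightarrow> f + g \<in> H1p0"
  by (simp add: H1p0_def h1_coeff_add)

lemma H1p0_mode: "1 \<le> l \<Longrightarrow> h1_mode z l \<in> H1p0"
  by (simp add: H1p0_def)

lemma Oset_H1p0: "w \<in> Oset \<Longrightarrow> w \<in> H1p0"
  by (simp add: Oset_def)

text \<open>Mode \<open>i\<close> of \<open>w(y) p(-y)\<close>, that is, the Hankel matrix of
  \<open>w\<close> applied to the modes of \<open>p\<close>.\<close>

definition hankel :: "h1 \<Rightarrow> h1 \<Rightarrow> int \<Rightarrow> complex" where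
  "hankel w p i = (\<Sum>\<^sub>\<infinity>m. h1_coeff w (m + i) * h1_coeff p m)"

definition gam :: "h1 \<Rightarrow> h1 \<Rightarrow> int \<Rightarrow> complex" where
  "gam w p i = (if 1 \<le> i then hankel w p i else 0)"

text \<open>The coefficients of \<open>\<Gamma>(w)p\<^sup>2\<close> for \<open>i \<ge> 1\<close>; \<open>gam2 w p 0\<close> is \<open>\<langle>w, p\<^sup>2\<rangle>\<close>.\<close>

definition gam2 :: "h1 \<Rightarrow> h1 \<Rightarrow> int \<Rightarrow> complex" where
  "gam2 w p i = (\<Sum>\<^sub>\<infinity>m. gam w p (m + i) * h1_coeff p m)"

lemma has_sum_hankel:
  "((\<lambda>m. h1_coeff w (m + i) * h1_coeff p m) has_sum hankel w p i) UNIV"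
  unfolding hankel_def
  by (intro has_sum_infsum summable_bounded_mult [OF summable_h1_coeff]) (rule norm_h1_coeff_le)

lemma norm_hankel_le:
  assumes "0 \<le> B" "\<And>m. h1_coeff p m \<noteq> 0 \<Longrightarrow> cmod (h1_coeff w (m + i)) \<le> B"
  shows "cmod (hankel w p i) \<le> B * (h1_const * norm p)"
proof -
  have "cmod (hankel w p i) \<le> B * (\<Sum>\<^sub>\<infinity>m. cmod (h1_coeff p m))"
    unfolding hankel_def by (rule norm_infsum_bounded_mult [OF summable_h1_coeff assms(2)])
  also have "\<dots> \<le> B * (h1_const * norm p)"
    by (intro mult_left_mono infsum_norm_h1_coeff_le assms)
  finally show ?thesis .
qed

lemma norm_gam_le: "cmod (gam w p i) \<le> norm w * (h1_const * norm p)"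
  using norm_hankel_le [of "norm w" p w i] norm_h1_coeff_le h1_const_nonneg
  by (auto simp: gam_def)

lemma has_sum_gam2:
  "((\<lambda>m. gam w p (m + i) * h1_coeff p m) has_sum gam2 w p i) UNIV"
  unfolding gam2_def
  by (intro has_sum_infsum summable_bounded_mult [OF summable_h1_coeff]) (rule norm_gam_le)

lemma
  shows wiener_Gamma_op: "wiener (Gamma_op (h1_fun w) (h1_fun p))"
    and fourier_coeff_Gamma_op: "fourier_coeff (Gamma_op (h1_fun w) (h1_fun p)) = gam w p"
proof -
  let ?q = "\<lambda>y. h1_fun w y * reflect (h1_fun p) y"
  have q: "wiener ?q" by (intro wiener_mult wiener_reflect wiener_h1)
  then show "wiener (Gamma_op (h1_fun w) (h1_fun p))"
    unfolding Gamma_op_def [abs_def] by (rule wiener_Pi_plus0)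
  have "fourier_coeff ?q i = hankel w p i" for i
  proof -
    have "((\<lambda>k. h1_coeff w k * fourier_coeff (reflect (h1_fun p)) (i - k)) has_sum fourier_coeff ?q i) UNIV"
      by (intro has_sum_fourier_coeff_mult wiener_continuous wiener_reflect wiener_h1)
    then have "((\<lambda>k. h1_coeff w k * h1_coeff p (k - i)) has_sum fourier_coeff ?q i) UNIV"
      by (simp add: fourier_coeff_reflect)
    then have "((\<lambda>m. h1_coeff w (m + i) * h1_coeff p m) has_sum fourier_coeff ?q i) UNIV"
      by (subst (asm) has_sum_reindex_bij_witness [of _ "\<lambda>m. m + i" "\<lambda>k. k - i"]) auto
    then show ?thesis using has_sum_hankel has_sum_unique by blast
  qed
  then show "fourier_coeff (Gamma_op (h1_fun w) (h1_fun p)) = gam w p"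
    unfolding Gamma_op_def [abs_def] by (auto simp: fourier_coeff_Pi_plus0 [OF q] gam_def)
qed

lemma fourier_coeff_diff:
  assumes "continuous_on {0..1} f" "continuous_on {0..1} g"
  shows "fourier_coeff (\<lambda>y. f y - g y) k = fourier_coeff f k - fourier_coeff g k"
  using fourier_coeff_add [of f "\<lambda>y. - 1 * g y" k] assms fourier_coeff_scale [of "- 1" g k]
  by (simp add: continuous_on_minus)

text \<open>The convolution is finite: \<open>a\<close> removes \<open>i \<le> 0\<close> and the
  projection removes \<open>i > n\<close>.\<close>

lemma fourier_coeff_mult_shift:
  assumes a: "wiener a" "\<And>i. i \<le> 0 \<Longrightarrow> fourier_coeff a i = 0" and b: "wiener b"
  shows "fourier_coeff (\<lambda>y. a y * Pi_plus ((shift ^^ m) b) y) n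
    = (\<Sum>i=1..n. fourier_coeff a i * fourier_coeff b (n + int m - i))"
proof -
  have w: "wiener (Pi_plus ((shift ^^ m) b))" by (intro wiener_Pi_plus wiener_shift_power b)
  have "((\<lambda>i. fourier_coeff a i * fourier_coeff (Pi_plus ((shift ^^ m) b)) (n - i))
      has_sum (\<Sum>i=1..n. fourier_coeff a i * fourier_coeff b (n + int m - i))) UNIV"
    by (rule has_sum_finite_neutralI [where B = "{1..n}"])
      (auto simp: fourier_coeff_Pi_plus [OF wiener_shift_power [OF b]] fourier_coeff_shift_power
        algebra_simps not_le intro: a(2))
  then show ?thesis
    using has_sum_fourier_coeff_mult [OF a(1) wiener_continuous [OF w]] has_sum_unique by blast
qed

text \<open>This is where the Bezoutian enters: the shift by \<open>k + 1\<close> in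
  \<open>A_k\<close> produces the index \<open>n + k + 1 - i\<close> of its defining sum.\<close>

lemma fourier_coeff_A_op:
  assumes "wiener a" "\<And>i. i \<le> 0 \<Longrightarrow> fourier_coeff a i = 0"
    and "wiener b" "\<And>i. i \<le> 0 \<Longrightarrow> fourier_coeff b i = 0"
  shows "fourier_coeff (A_op k b a) n = bez (fourier_coeff a) (fourier_coeff b) n (int k)"
proof -
  have "fourier_coeff (A_op k b a) n =
      (\<Sum>i=1..n. fourier_coeff a i * fourier_coeff b (n + int (k + 1) - i)) -
      (\<Sum>i=1..n. fourier_coeff b i * fourier_coeff a (n + int (k + 1) - i))"
    unfolding A_op_def [abs_def] using assms
    by (subst fourier_coeff_diff)
      (auto simp only: fourier_coeff_mult_shift intro!: wiener_continuous wiener_mult wiener_Pi_plus wiener_shift_power)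
  then show ?thesis
    unfolding bez_def minor_def sum_subtractf by (simp add: algebra_simps)
qed

text \<open>Antisymmetry of \<open>minor\<close> reduces the sum over \<open>{1..n}\<close> defining the \<open>n\<close>-th coefficient of
  \<open>A_k g\<close> to one over \<open>{1..k}\<close>; this makes \<open>I_k\<close> a finite expression in the coefficients of
  \<open>\<Gamma>(w)p\<close> and \<open>\<Gamma>(w)p\<^sup>2\<close>.\<close>

lemma I_fun_eq:
  assumes "w \<in> H1p0" "p \<in> H1p0"
  shows "I_fun k (h1_fun w) (h1_fun p) =
    (\<Sum>i=1..int k. gam w p i * gam w p (int k + 1 - i) - h1_coeff w i * gam2 w p (int k + 1 - i))"
proof -
  let ?k = "int k" and ?W = "h1_coeff w" and ?P = "h1_coeff p"
  have A: "fourier_coeff (A_op k (h1_fun w) (Gamma_op (h1_fun w) (h1_fun p))) n * ?P n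
      = (\<Sum>i=1..?k. gam w p i * (?W (n + (?k + 1 - i)) * ?P n) - ?W i * (gam w p (n + (?k + 1 - i)) * ?P n))" for n
  proof (cases "n \<le> 0")
    case True
    then show ?thesis using assms by (simp add: H1p0_coeff)
  next
    case False
    have "fourier_coeff (A_op k (h1_fun w) (Gamma_op (h1_fun w) (h1_fun p))) n = bez (gam w p) ?W n ?k"
      using assms
      by (subst fourier_coeff_A_op) (auto simp: wiener_Gamma_op fourier_coeff_Gamma_op H1p0_coeff gam_def)
    also have "\<dots> = (\<Sum>i=1..?k. minor (gam w p) ?W i (n + ?k + 1 - i))"
      using False by (simp add: bez_upper)
    finally show ?thesis
      by (simp add: minor_def sum_distrib_left algebra_simps)
  qed
  have "((\<lambda>n. \<Sum>i=1..?k. gam w p i * (?W (n + (?k + 1 - i)) * ?P n) - ?W i * (gam w p (n + (?k + 1 - i)) * ?P n))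
      has_sum (\<Sum>i=1..?k. gam w p i * hankel w p (?k + 1 - i) - ?W i * gam2 w p (?k + 1 - i))) UNIV"
    using has_sum_add [OF has_sum_cmult_right [OF has_sum_hankel] has_sum_cmult_right [OF has_sum_gam2, of "- _"]]
    by (intro has_sum_finite_sum) auto
  then have "I_fun k (h1_fun w) (h1_fun p) = (\<Sum>i=1..?k. gam w p i * hankel w p (?k + 1 - i) - ?W i * gam2 w p (?k + 1 - i))"
    unfolding I_fun_def pairing_def A by (rule infsumI)
  also have "\<dots> = (\<Sum>i=1..?k. gam w p i * gam w p (?k + 1 - i) - ?W i * gam2 w p (?k + 1 - i))"
    by (intro sum.cong refl) (auto simp: gam_def)
  finally show ?thesis .
qed

section \<open>Perturbation of a single mode of \<open>p\<close>\<close>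

lemma hankel_perturb: "hankel w (p + h1_mode z j) i = hankel w p i + z * h1_coeff w (i + j)"
proof -
  have "((\<lambda>m. h1_coeff w (m + i) * h1_coeff (h1_mode z j) m) has_sum z * h1_coeff w (i + j)) UNIV"
    by (rule has_sum_finite_neutralI [where B = "{j}"]) (auto simp: add.commute)
  from has_sum_add [OF has_sum_hankel [of w i p] this]
  show ?thesis unfolding hankel_def [of w "p + _"]
    by (intro infsumI) (simp add: h1_coeff_add distrib_left)
qed

lemma gam_perturb:
  "1 \<le> i \<Longrightarrow> gam w (p + h1_mode z j) i = gam w p i + z * h1_coeff w (i + j)"
  by (simp add: gam_def hankel_perturb)

text \<open>The factor 2 arises because perturbing \<open>p\<close> inside \<open>gam\<close> and
  perturbing the outer \<open>p\<close> both contribute the Hankel sum at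
  \<open>i + j\<close>.\<close>

lemma gam2_perturb:
  assumes "1 \<le> i" "1 \<le> j" "p \<in> H1p0"
  shows "gam2 w (p + h1_mode z j) i = gam2 w p i + 2 * z * gam w p (i + j) + z\<^sup>2 * h1_coeff w (i + 2 * j)"
proof -
  let ?W = "h1_coeff w" and ?P = "h1_coeff p"
  have "((\<lambda>m. (gam w p (m + i) + z * ?W (m + i + j)) * h1_coeff (h1_mode z j) m) has_sum
      z * gam w p (i + j) + z\<^sup>2 * ?W (i + 2 * j)) UNIV"
    by (rule has_sum_finite_neutralI [where B = "{j}"]) (auto simp: algebra_simps power2_eq_square)
  from has_sum_add [OF has_sum_add [OF has_sum_gam2 has_sum_cmult_right [OF has_sum_hankel, of z]] this]
  have "((\<lambda>m. gam w p (m + i) * ?P m + z * (?W (m + (i + j)) * ?P m)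
        + (gam w p (m + i) + z * ?W (m + i + j)) * h1_coeff (h1_mode z j) m)
      has_sum gam2 w p i + z * hankel w p (i + j) + (z * gam w p (i + j) + z\<^sup>2 * ?W (i + 2 * j))) UNIV"
    by blast
  also have "(\<lambda>m. gam w p (m + i) * ?P m + z * (?W (m + (i + j)) * ?P m)
        + (gam w p (m + i) + z * ?W (m + i + j)) * h1_coeff (h1_mode z j) m) =
      (\<lambda>m. gam w (p + h1_mode z j) (m + i) * h1_coeff (p + h1_mode z j) m)"
  proof
    fix m
    show "gam w p (m + i) * ?P m + z * (?W (m + (i + j)) * ?P m)
        + (gam w p (m + i) + z * ?W (m + i + j)) * h1_coeff (h1_mode z j) m =
      gam w (p + h1_mode z j) (m + i) * h1_coeff (p + h1_mode z j) m"
    proof (cases "m \<le> 0")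
      case True
      then show ?thesis using assms by (simp add: H1p0_coeff h1_coeff_add)
    next
      case False
      then have "gam w (p + h1_mode z j) (m + i) = gam w p (m + i) + z * ?W (m + i + j)"
        using assms by (intro gam_perturb) auto
      then show ?thesis by (simp only: h1_coeff_add) (simp add: algebra_simps)
    qed
  qed
  finally show ?thesis
    unfolding gam2_def [of w "p + _"] using assms by (intro infsumI) (simp add: gam_def algebra_simps)
qed

text \<open>The dependence on \<open>z\<close> is exactly quadratic, so the derivative at 0 can be
  read off and \<open>Q\<close> may stay anonymous. The reflection
  \<open>i \<mapsto> k + 1 - i\<close> merges the two linear terms that come from
  \<open>g_i g_(k+1-i)\<close>.\<close>

lemma I_fun_perturb:
  assumes w: "w \<in> H1p0" and p: "p \<in> H1p0" and j: "1 \<le> j"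
  obtains Q where "\<And>z. I_fun k (h1_fun w) (h1_fun (p + h1_mode z j)) = I_fun k (h1_fun w) (h1_fun p)
    + z * (2 * (\<Sum>i=1..int k. h1_coeff w (i + j) * gam w p (int k + 1 - i)
            - h1_coeff w i * gam w p (int k + 1 - i + j))) + z\<^sup>2 * Q"
proof -
  let ?k = "int k" and ?W = "h1_coeff w" and ?g = "gam w p"
  define Q where "Q = (\<Sum>i=1..?k. ?W (i + j) * ?W (?k + 1 - i + j) - ?W i * ?W (?k + 1 - i + 2 * j))"
  have "I_fun k (h1_fun w) (h1_fun (p + h1_mode z j)) = I_fun k (h1_fun w) (h1_fun p)
    + z * (2 * (\<Sum>i=1..?k. ?W (i + j) * ?g (?k + 1 - i) - ?W i * ?g (?k + 1 - i + j))) + z\<^sup>2 * Q" for z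
  proof -
    have "I_fun k (h1_fun w) (h1_fun (p + h1_mode z j)) =
      (\<Sum>i=1..?k. (?g i + z * ?W (i + j)) * (?g (?k + 1 - i) + z * ?W (?k + 1 - i + j)) -
         ?W i * (gam2 w p (?k + 1 - i) + 2 * z * ?g (?k + 1 - i + j) + z\<^sup>2 * ?W (?k + 1 - i + 2 * j)))"
      unfolding I_fun_eq [OF w H1p0_add [OF p H1p0_mode [OF j]]]
      by (intro sum.cong refl) (simp add: gam_perturb gam2_perturb [OF _ j p])
    also have "\<dots> = (\<Sum>i=1..?k. ?g i * ?g (?k + 1 - i) - ?W i * gam2 w p (?k + 1 - i))
       + z * ((\<Sum>i=1..?k. ?g i * ?W (?k + 1 - i + j)) + (\<Sum>i=1..?k. ?W (i + j) * ?g (?k + 1 - i))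
         - 2 * (\<Sum>i=1..?k. ?W i * ?g (?k + 1 - i + j))) + z\<^sup>2 * Q"
      by (simp add: Q_def sum_distrib_left sum.distrib [symmetric] sum_subtractf [symmetric] algebra_simps power2_eq_square)
    also have "(\<Sum>i=1..?k. ?g i * ?W (?k + 1 - i + j)) = (\<Sum>i=1..?k. ?W (i + j) * ?g (?k + 1 - i))"
      by (subst sum_reflect_int) (simp add: algebra_simps)
    finally show ?thesis
      unfolding I_fun_eq [OF w p] by (simp add: sum_subtractf algebra_simps)
  qed
  then show thesis by (rule that)
qed

lemma J_int_deriv_p:
  assumes "w \<in> H1p0" "p \<in> H1p0" "1 \<le> j"
  shows "((\<lambda>z. J_int f k (w, p + h1_mode z j)) has_field_derivative
    2 * (\<Sum>i=1..int k. h1_coeff w (i + j) * gam w p (int k + 1 - i)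
            - h1_coeff w i * gam w p (int k + 1 - i + j))) (at 0)"
proof -
  obtain Q where Q: "\<And>z. I_fun k (h1_fun w) (h1_fun (p + h1_mode z j)) = I_fun k (h1_fun w) (h1_fun p)
    + z * (2 * (\<Sum>i=1..int k. h1_coeff w (i + j) * gam w p (int k + 1 - i)
            - h1_coeff w i * gam w p (int k + 1 - i + j))) + z\<^sup>2 * Q"
    using I_fun_perturb [OF assms] by blast
  show ?thesis
    unfolding J_int.simps Q by (auto intro!: derivative_eq_intros)
qed

lemma pairing_mult_mode:
  "((\<lambda>k. h1_coeff w k * fourier_coeff (\<lambda>y. h1_fun p y * echar j y) k) has_sum hankel w p j) UNIV"
proof -
  have "fourier_coeff (\<lambda>y. h1_fun p y * echar j y) k = h1_coeff p (k - j)" for k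
    using fourier_coeff_echar_shift [of j "h1_fun p" k] by (simp add: mult.commute)
  moreover have "((\<lambda>k. h1_coeff w k * h1_coeff p (k - j)) has_sum hankel w p j) UNIV"
    using has_sum_hankel [of w j p]
    by (subst has_sum_reindex_bij_witness [of _ "\<lambda>m. m + j" "\<lambda>k. k - j"]) auto
  ultimately show ?thesis by simp
qed

lemma H_ham_deriv_p:
  "((\<lambda>z. H_ham f (w, p + h1_mode z j)) has_field_derivative 2 * hankel w p j) (at 0)"
proof -
  let ?W = "h1_coeff w"
  have p2: "wiener (\<lambda>y. (h1_fun p y)\<^sup>2)" unfolding power2_eq_square by (intro wiener_mult wiener_h1)
  \<comment> \<open>The pairing is an infinite sum with a default value, so it can be split into
    summands only once it is known to converge.\<close>
  have "(\<lambda>k. fourier_coeff (\<lambda>y. (h1_fun p y)\<^sup>2) k * ?W k) summable_on UNIV"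
  proof (rule summable_bounded_mult [OF summable_h1_coeff])
    fix n
    have "cmod (fourier_coeff (\<lambda>y. (h1_fun p y)\<^sup>2) n) = (\<Sum>k\<in>{n}. cmod (fourier_coeff (\<lambda>y. (h1_fun p y)\<^sup>2) k))"
      by simp
    also have "\<dots> \<le> (\<Sum>\<^sub>\<infinity>k. cmod (fourier_coeff (\<lambda>y. (h1_fun p y)\<^sup>2) k))"
      using wiener_summable [OF p2, of UNIV] by (intro finite_sum_le_infsum) (auto simp: summable_on_iff_abs_summable_on_complex)
    finally show "cmod (fourier_coeff (\<lambda>y. (h1_fun p y)\<^sup>2) n) \<le> (\<Sum>\<^sub>\<infinity>k. cmod (fourier_coeff (\<lambda>y. (h1_fun p y)\<^sup>2) k))" .
  qed
  then have 1: "((\<lambda>k. ?W k * fourier_coeff (\<lambda>y. (h1_fun p y)\<^sup>2) k) has_sum pairing (h1_fun w) (\<lambda>y. (h1_fun p y)\<^sup>2)) UNIV"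
    by (simp add: pairing_def mult.commute)
  have 2: "((\<lambda>k. ?W k * fourier_coeff (echar (2 * j)) k) has_sum ?W (2 * j)) UNIV"
    using fourier_coeff_mode [of 1 "2 * j"] by (intro has_sum_finite_neutralI [where B = "{2 * j}"]) auto
  have "pairing (h1_fun w) (\<lambda>y. (h1_fun (p + h1_mode z j) y)\<^sup>2) =
      pairing (h1_fun w) (\<lambda>y. (h1_fun p y)\<^sup>2) + z * (2 * hankel w p j) + z\<^sup>2 * ?W (2 * j)" for z
  proof -
    have eq: "(\<lambda>y. (h1_fun (p + h1_mode z j) y)\<^sup>2) =
        (\<lambda>y. (h1_fun p y)\<^sup>2 + (2 * z * (h1_fun p y * echar j y) + z\<^sup>2 * echar (2 * j) y))"
      by (auto simp: h1_fun_add h1_fun_mode power2_eq_square algebra_simps echar_add [symmetric])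
    have "fourier_coeff (\<lambda>y. (h1_fun (p + h1_mode z j) y)\<^sup>2) k = fourier_coeff (\<lambda>y. (h1_fun p y)\<^sup>2) k +
        (2 * z * fourier_coeff (\<lambda>y. h1_fun p y * echar j y) k + z\<^sup>2 * fourier_coeff (echar (2 * j)) k)" for k
      unfolding eq by (subst fourier_coeff_add, (intro continuous_intros h1_fun_continuous)+)+ (simp only: fourier_coeff_scale)
    then show ?thesis unfolding pairing_def [of _ "\<lambda>y. (h1_fun (p + _) y)\<^sup>2"]
      using has_sum_add [OF has_sum_add [OF 1 has_sum_cmult_right [OF pairing_mult_mode, of "2 * z"]] has_sum_cmult_right [OF 2, of "z\<^sup>2"]]
      by (intro infsumI) (simp add: algebra_simps)
  qed
  then show ?thesis by (auto intro!: derivative_eq_intros)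
qed

section \<open>Gradients\<close>

lemma pairing_mode: "pairing (h1_fun g) (h1_fun (h1_mode z l)) = h1_coeff g l * z"
  unfolding pairing_def by (rule infsumI, rule has_sum_finite_neutralI [where B = "{l}"]) auto

lemma h1_fun_lower_bound:
  assumes "\<And>y. h1_fun w y \<noteq> 0"
  obtains m where "m > 0" "\<And>y. m \<le> cmod (h1_fun w y)"
proof -
  have "continuous_on {0..1::real} (\<lambda>y. cmod (h1_fun w y))"
    by (intro continuous_intros h1_fun_continuous)
  then obtain x where x: "x \<in> {0..1}" "\<And>y. y \<in> {0..1} \<Longrightarrow> cmod (h1_fun w x) \<le> cmod (h1_fun w y)"
    using continuous_attains_inf [of "{0..1::real}" "\<lambda>y. cmod (h1_fun w y)"] by auto
  interpret periodic_fun_simple' "h1_fun w"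
    by unfold_locales (rule h1_fun_periodic)
  have "cmod (h1_fun w x) \<le> cmod (h1_fun w y)" for y
  proof -
    have "h1_fun w (frac y) = h1_fun w y"
      using minus_of_int [of y "\<lfloor>y\<rfloor>"] by (simp add: frac_def)
    then show ?thesis using x(2) [of "frac y"] by (simp add: frac_ge_0 frac_lt_1 less_imp_le)
  qed
  then show thesis using that [of "cmod (h1_fun w x)"] assms by simp
qed

lemma Oset_perturb:
  assumes "w \<in> Oset"
  obtains \<delta> where "\<delta> > 0" "\<And>v. v \<in> H1p0 \<Longrightarrow> norm v < \<delta> \<Longrightarrow> w + v \<in> Oset"
proof -
  obtain m where m: "m > 0" "\<And>y. m \<le> cmod (h1_fun w y)"
    using h1_fun_lower_bound assms by (auto simp: Oset_def)
  show thesis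
  \<comment> \<open>The sup norm of \<open>v\<close> is at most \<open>h1_const * norm v\<close>,
    which this radius keeps below \<open>m\<close>. The added 1 avoids a division by a constant
    known only to be nonnegative.\<close>
  proof (rule that [of "m / (h1_const + 1)"])
    show "m / (h1_const + 1) > 0" using m h1_const_nonneg by simp
    fix v assume v: "v \<in> H1p0" "norm v < m / (h1_const + 1)"
    have "h1_fun (w + v) y \<noteq> 0" for y
    proof
      assume "h1_fun (w + v) y = 0"
      then have "cmod (h1_fun w y) = cmod (h1_fun v y)"
        by (metis h1_fun_add add_eq_0_iff norm_minus_cancel)
      also have "\<dots> \<le> h1_const * norm v" by (rule norm_h1_fun_le)
      also have "\<dots> \<le> (h1_const + 1) * norm v" by (intro mult_right_mono) auto
      also have "\<dots> < m" using v h1_const_nonneg by (simp add: field_simps)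
      finally show False using m(2) [of y] by simp
    qed
    then show "w + v \<in> Oset"
      using assms v by (auto simp: Oset_def intro: H1p0_add)
  qed
qed

lemma Oset_perturb_mode:
  assumes "w \<in> Oset" "1 \<le> l"
  obtains \<delta> where "\<delta> > 0" "\<And>z. cmod z < \<delta> \<Longrightarrow> w + h1_mode z l \<in> Oset"
proof -
  obtain \<delta> where \<delta>: "\<delta> > 0" "\<And>v. v \<in> H1p0 \<Longrightarrow> norm v < \<delta> \<Longrightarrow> w + v \<in> Oset"
    using Oset_perturb [OF assms(1)] by blast
  show thesis
  proof (rule that [of "\<delta> / jap l"])
    show "\<delta> / jap l > 0" using \<delta> jap_pos by simp
    show "w + h1_mode z l \<in> Oset" if "cmod z < \<delta> / jap l" for z
      using that assms(2) jap_pos [of l] by (intro \<delta>(2) H1p0_mode) (simp_all add: norm_h1_mode field_simps)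
  qed
qed

lemma has_derivative_h1_mode: "((\<lambda>z. h1_mode z l) has_derivative (\<lambda>z. h1_mode z l)) F"
  by (rule bounded_linear.has_derivative [OF bounded_linear_h1_mode has_derivative_ident])

text \<open>Along one complex mode the derivative \<open>D\<close> is multiplication by the paired
  coefficient, so it is a complex derivative. Uniqueness of derivatives then identifies every
  component of a given gradient with a computed formula.\<close>

lemma has_gradient_p:
  assumes "has_gradient F (w, p) gw gp" "w \<in> Oset" "p \<in> H1p0" "1 \<le> l"
  shows "((\<lambda>z. F (w, p + h1_mode z l)) has_field_derivative h1_coeff gp l) (at 0)"
proof -
  obtain D where D: "(F has_derivative D) (at (w, p) within Oset \<times> H1p0)"
    "\<And>dp. dp \<in> H1p0 \<Longrightarrow> pairing (h1_fun gp) (h1_fun dp) = D (0, dp)"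
    using assms(1) by (auto simp: has_gradient_def)
  let ?c = "\<lambda>z. (w, p + h1_mode z l)"
  have c0: "?c 0 = (w, p)" using h1_eqI [of "h1_mode 0 l" 0] by simp
  have "((\<lambda>z. F (?c z)) has_derivative (\<lambda>z. D (0, h1_mode z l))) (at 0)"
  proof (rule has_derivative_in_compose [where f = ?c and g = F])
    show "(?c has_derivative (\<lambda>z. (0, h1_mode z l))) (at 0)"
      by (auto intro!: derivative_eq_intros has_derivative_h1_mode)
    show "(F has_derivative D) (at (?c 0) within range ?c)"
      unfolding c0 using assms by (intro has_derivative_subset [OF D(1)]) (auto intro!: H1p0_add H1p0_mode)
  qed
  moreover have "D (0, h1_mode z l) = h1_coeff gp l * z" for z
    using D(2) [OF H1p0_mode [OF assms(4)]] by (simp add: pairing_mode)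
  ultimately show ?thesis by (simp add: has_field_derivative_def)
qed

text \<open>As for \<open>p\<close>, except that \<open>w + h1_mode z l\<close> stays in
  \<open>Oset\<close> only for small \<open>z\<close>; hence the disc.\<close>

lemma has_gradient_w:
  assumes "has_gradient F (w, p) gw gp" "w \<in> Oset" "p \<in> H1p0" "1 \<le> l"
  shows "((\<lambda>z. F (w + h1_mode z l, p)) has_field_derivative h1_coeff gw l) (at 0)"
proof -
  obtain D where D: "(F has_derivative D) (at (w, p) within Oset \<times> H1p0)"
    "\<And>dw. dw \<in> H1p0 \<Longrightarrow> pairing (h1_fun gw) (h1_fun dw) = D (dw, 0)"
    using assms(1) by (auto simp: has_gradient_def)
  obtain \<delta> where \<delta>: "\<delta> > 0" "\<And>z. cmod z < \<delta> \<Longrightarrow> w + h1_mode z l \<in> Oset"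
    using Oset_perturb_mode [OF assms(2,4)] by blast
  let ?c = "\<lambda>z. (w + h1_mode z l, p)"
  have c0: "?c 0 = (w, p)" using h1_eqI [of "h1_mode 0 l" 0] by simp
  have "((\<lambda>z. F (?c z)) has_derivative (\<lambda>z. D (h1_mode z l, 0))) (at 0 within ball 0 \<delta>)"
  proof (rule has_derivative_in_compose [where f = ?c and g = F])
    show "(?c has_derivative (\<lambda>z. (h1_mode z l, 0))) (at 0 within ball 0 \<delta>)"
      by (auto intro!: derivative_eq_intros has_derivative_h1_mode)
    show "(F has_derivative D) (at (?c 0) within ?c ` ball 0 \<delta>)"
      unfolding c0 using assms \<delta> by (intro has_derivative_subset [OF D(1)]) auto
  qed
  moreover have "D (h1_mode z l, 0) = h1_coeff gw l * z" for z
    using D(2) [OF H1p0_mode [OF assms(4)]] by (simp add: pairing_mode)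
  ultimately show ?thesis using \<delta>(1) by (simp add: has_field_derivative_def at_within_open [of 0 "ball 0 \<delta>"])
qed

text \<open>The \<open>j\<close>-th component of \<open>\<nabla>\<^sub>pF\<close> is controlled by the coefficients of \<open>w\<close> beyond \<open>j\<close>,
  so \<open>w' = \<nabla>\<^sub>pF\<close> is a triangular linear system for the high modes of \<open>w\<close>.\<close>

lemma gradient_tail_bound:
  assumes F: "F = H_ham f \<or> F = J_int f k"
    and grad: "has_gradient F (w, p) gw gp" and w: "w \<in> Oset" and p: "p \<in> H1p0"
    and j: "1 \<le> j" and \<epsilon>: "0 \<le> \<epsilon>" and tail: "\<And>i. j < i \<Longrightarrow> cmod (h1_coeff w i) \<le> \<epsilon>"
  shows "cmod (h1_coeff gp j) \<le> (2 + 4 * real k * norm w) * (h1_const * norm p) * \<epsilon>"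
proof -
  have pos: "0 \<le> h1_const * norm p" using h1_const_nonneg by simp
  have hk: "cmod (hankel w p i) \<le> \<epsilon> * (h1_const * norm p)" if "j \<le> i" for i
  proof (intro norm_hankel_le \<epsilon> tail)
    fix m assume "h1_coeff p m \<noteq> 0"
    then have "0 < m" using H1p0_coeff [OF p, of m] by (cases "0 < m") auto
    then show "j < m + i" using that by simp
  qed
  note D = has_gradient_p [OF grad w p j]
  \<comment> \<open>\<open>H_f\<close> accounts for the 2 in the constant and \<open>J_k\<close> for
    \<open>4 * real k * norm w\<close>; one bound serves both.\<close>
  from F show ?thesis
  proof
    assume "F = H_ham f"
    then have "h1_coeff gp j = 2 * hankel w p j"
      using D H_ham_deriv_p DERIV_unique by blast
    then have "cmod (h1_coeff gp j) \<le> 2 * (h1_const * norm p) * \<epsilon>"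
      using hk [of j] by (simp add: norm_mult algebra_simps)
    also have "\<dots> \<le> (2 + 4 * real k * norm w) * (h1_const * norm p) * \<epsilon>"
      using pos \<epsilon> by (intro mult_right_mono) auto
    finally show ?thesis .
  next
    assume "F = J_int f k"
    then have eq: "h1_coeff gp j = 2 * (\<Sum>i=1..int k. h1_coeff w (i + j) * gam w p (int k + 1 - i)
            - h1_coeff w i * gam w p (int k + 1 - i + j))"
      using D J_int_deriv_p [OF Oset_H1p0 [OF w] p j] DERIV_unique by blast
    have "cmod (\<Sum>i=1..int k. h1_coeff w (i + j) * gam w p (int k + 1 - i)
            - h1_coeff w i * gam w p (int k + 1 - i + j))
        \<le> (\<Sum>i=1..int k. 2 * (norm w * (h1_const * norm p) * \<epsilon>))"
    proof (rule sum_norm_le)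
      fix i assume i: "i \<in> {1..int k}"
      \<comment> \<open>Each product has one small factor: in the first the mode
        \<open>i + j\<close> of \<open>w\<close>, in the second \<open>gam\<close> at an index above
        \<open>j\<close>.\<close>
      have "cmod (h1_coeff w (i + j)) * cmod (gam w p (int k + 1 - i)) \<le> \<epsilon> * (norm w * (h1_const * norm p))"
        using i by (intro mult_mono tail norm_gam_le \<epsilon>) auto
      moreover have "cmod (h1_coeff w i) * cmod (gam w p (int k + 1 - i + j)) \<le> norm w * (\<epsilon> * (h1_const * norm p))"
        using i j by (intro mult_mono norm_h1_coeff_le) (auto simp: gam_def intro!: hk)
      ultimately show "cmod (h1_coeff w (i + j) * gam w p (int k + 1 - i) - h1_coeff w i * gam w p (int k + 1 - i + j))
          \<le> 2 * (norm w * (h1_const * norm p) * \<epsilon>)"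
        using norm_triangle_ineq4 [of "h1_coeff w (i + j) * gam w p (int k + 1 - i)" "h1_coeff w i * gam w p (int k + 1 - i + j)"]
        by (simp add: norm_mult algebra_simps)
    qed
    then have "cmod (h1_coeff gp j) \<le> 4 * real k * norm w * (h1_const * norm p) * \<epsilon>"
      unfolding eq by (simp add: norm_mult algebra_simps)
    also have "\<dots> \<le> (2 + 4 * real k * norm w) * (h1_const * norm p) * \<epsilon>"
      using pos \<epsilon> by (intro mult_right_mono) auto
    finally show ?thesis .
  qed
qed

section \<open>Invariance of \<open>F_space\<close>\<close>

text \<open>The supremum over infinitely many modes need not be differentiable, so the estimate is
  iterated mode by mode. Each round integrates the previous bound and yields
  \<open>M (K t)^m / m!\<close>, which tends to 0. Quantifying over \<open>\<epsilon>\<close> in the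
  second assumption on \<open>K\<close> lets the bound of the last round be inserted.\<close>

lemma triangular_system_zero:
  fixes x x' :: "int \<Rightarrow> real \<Rightarrow> 'a :: real_normed_vector"
  assumes deriv: "\<And>j t. n \<le> j \<Longrightarrow> t \<in> {0..\<tau>} \<Longrightarrow> (x j has_vector_derivative x' j t) (at t within {0..\<tau>})"
    and init: "\<And>j. n \<le> j \<Longrightarrow> x j 0 = 0"
    and M: "\<And>j t. n \<le> j \<Longrightarrow> t \<in> {0..\<tau>} \<Longrightarrow> norm (x j t) \<le> M"
    and K: "0 \<le> K" "\<And>j t \<epsilon>. n \<le> j \<Longrightarrow> t \<in> {0..\<tau>} \<Longrightarrow> 0 \<le> \<epsilon> \<Longrightarrow>
        (\<And>i. n \<le> i \<Longrightarrow> norm (x i t) \<le> \<epsilon>) \<Longrightarrow> norm (x' j t) \<le> K * \<epsilon>"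
    and j: "n \<le> j" and t: "t \<in> {0..\<tau>}"
  shows "x j t = 0"
proof -
  have M0: "0 \<le> M" using M [OF j t] norm_ge_zero order_trans by blast
  have iter: "\<forall>j\<ge>n. \<forall>t\<in>{0..\<tau>}. norm (x j t) \<le> M * (K * t) ^ m / fact m" for m
  proof (induction m)
    case 0
    then show ?case using M by simp
  next
    case (Suc m)
    show ?case
    proof (intro allI ballI impI)
      fix j t assume j: "n \<le> j" and t: "t \<in> {0..\<tau>}"
      show "norm (x j t) \<le> M * (K * t) ^ Suc m / fact (Suc m)"
      proof (cases "t = 0")
        case True
        then show ?thesis using init [OF j] by simp
      next
        case False
        let ?\<phi> = "\<lambda>s. M * (K * s) ^ Suc m / fact (Suc m)"
        have "norm (x j t - x j 0) \<le> ?\<phi> t - ?\<phi> 0"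
        proof (rule differentiable_bound_general)
          show "0 < t" using t False by simp
          have "continuous_on {0..\<tau>} (x j)"
            using deriv [OF j] has_vector_derivative_continuous continuous_on_eq_continuous_within by blast
          then show "continuous_on {0..t} (x j)"
            using t by (auto intro: continuous_on_subset)
          show "continuous_on {0..t} ?\<phi>" by (intro continuous_intros) auto
          fix s assume s: "0 < s" "s < t"
          then have s': "s \<in> {0..\<tau>}" using t by auto
          have "at s within {0..\<tau>} = at s"
            using s t by (intro at_within_interior) auto
          then show "(x j has_vector_derivative x' j s) (at s)"
            using deriv [OF j s'] by simp
          show "(?\<phi> has_vector_derivative K * (M * (K * s) ^ m / fact m)) (at s)"
          proof -
            have "(?\<phi> has_real_derivative M * (real (Suc m) * (K * (K * s) ^ (Suc m - Suc 0))) / fact (Suc m)) (at s)"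
              by (intro DERIV_cdivide DERIV_cmult DERIV_power DERIV_cmult_Id)
            also have "M * (real (Suc m) * (K * (K * s) ^ (Suc m - Suc 0))) / fact (Suc m) = K * (M * (K * s) ^ m / fact m)"
              unfolding fact_Suc by (simp del: of_nat_Suc)
            finally show ?thesis
              by (simp add: has_real_derivative_iff_has_vector_derivative)
          qed
          show "norm (x' j s) \<le> K * (M * (K * s) ^ m / fact m)"
            using K(1) M0 s Suc.IH s' by (intro K(2) j s') auto
        qed
        then show ?thesis using init [OF j] by simp
      qed
    qed
  qed
  have "(\<lambda>m. M * (inverse (fact m) * (K * t) ^ m)) \<longlonglongrightarrow> M * 0"
    by (intro tendsto_mult_left summable_LIMSEQ_zero summable_exp)
  then have "(\<lambda>m. M * (K * t) ^ m / fact m) \<longlonglongrightarrow> 0"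
    by (simp add: divide_inverse algebra_simps)
  then have "norm (x j t) \<le> 0"
    using iter j t by (intro LIMSEQ_le_const) auto
  then show ?thesis by simp
qed

lemma F_space_iff: "w \<in> F_space N \<longleftrightarrow>
  (\<forall>k. k \<le> 0 \<or> int N + 1 < k \<longrightarrow> h1_coeff w k = 0) \<and> h1_coeff w (int N + 1) = 1"
proof
  assume "w \<in> F_space N"
  then show "(\<forall>k. k \<le> 0 \<or> int N + 1 < k \<longrightarrow> h1_coeff w k = 0) \<and> h1_coeff w (int N + 1) = 1"
    by (auto simp: F_space_def h1_coeff_add h1_coeff_sum intro!: sum.neutral)
next
  assume w: "(\<forall>k. k \<le> 0 \<or> int N + 1 < k \<longrightarrow> h1_coeff w k = 0) \<and> h1_coeff w (int N + 1) = 1"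
  have "w = (\<Sum>k=1..N. h1_mode (h1_coeff w (int k)) (int k)) + h1_mode 1 (int N + 1)"
  proof (rule h1_eqI)
    fix k
    have "(\<Sum>i=1..N. h1_coeff (h1_mode (h1_coeff w (int i)) (int i)) k) = (if 1 \<le> k \<and> k \<le> int N then h1_coeff w k else 0)"
    proof (cases "1 \<le> k \<and> k \<le> int N")
      case True
      then have "(\<Sum>i=1..N. h1_coeff (h1_mode (h1_coeff w (int i)) (int i)) k) = h1_coeff w k"
        by (subst sum.remove [of _ "nat k"]) (auto intro!: sum.neutral split: if_splits)
      then show ?thesis using True by simp
    qed (auto intro!: sum.neutral)
    then show "h1_coeff w k = h1_coeff ((\<Sum>k=1..N. h1_mode (h1_coeff w (int k)) (int k)) + h1_mode 1 (int N + 1)) k"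
      using w by (auto simp: h1_coeff_add h1_coeff_sum not_le)
  qed
  then show "w \<in> F_space N"
    unfolding F_space_def mem_Collect_eq by (intro exI [of _ "\<lambda>k. h1_coeff w (int k)"] conjI TrueI)
qed

lemma h1_coeff_Pi_le: "h1_coeff (Pi_le N p) k = (if 1 \<le> k \<and> k \<le> int N then h1_coeff p k else 0)"
proof (cases "1 \<le> k \<and> k \<le> int N")
  case True
  then have "h1_coeff (Pi_le N p) k = h1_coeff p k"
    unfolding Pi_le_def h1_coeff_sum by (subst sum.remove [of _ "nat k"]) (auto intro!: sum.neutral split: if_splits)
  then show ?thesis using True by simp
qed (auto simp: Pi_le_def h1_coeff_sum intro!: sum.neutral)

lemma modes_space_iff: "(\<exists>c. p = (\<Sum>k=1..N. h1_mode (c k) (int k))) \<longleftrightarrow>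
  (\<forall>k. k \<le> 0 \<or> int N < k \<longrightarrow> h1_coeff p k = 0)"
proof
  assume "\<forall>k. k \<le> 0 \<or> int N < k \<longrightarrow> h1_coeff p k = 0"
  then have "p = Pi_le N p"
    by (intro h1_eqI) (auto simp: h1_coeff_Pi_le not_le)
  then show "\<exists>c. p = (\<Sum>k=1..N. h1_mode (c k) (int k))" 
    unfolding Pi_le_def by (rule exI [of _ "\<lambda>k. h1_coeff p (int k)"])
qed (auto simp: h1_coeff_sum intro!: sum.neutral)

lemma PF_space_iff: "(w, p) \<in> PF_space N \<longleftrightarrow> w \<in> Oset \<and> w \<in> F_space N \<and>
  (\<forall>k. k \<le> 0 \<or> int N < k \<longrightarrow> h1_coeff p k = 0)"
  using modes_space_iff [of p N] by (auto simp: PF_space_def)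

lemma ham_solution_gradients:
  assumes "ham_solution F S w p"
  obtains gw gp where "\<And>t. t \<in> S \<Longrightarrow> has_gradient F (w t, p t) (gw t) (gp t)"
    "\<And>t k. t \<in> S \<Longrightarrow> ((\<lambda>s. h1_coeff (w s) k) has_vector_derivative h1_coeff (gp t) k) (at t within S)"
    "\<And>t k. t \<in> S \<Longrightarrow> ((\<lambda>s. h1_coeff (p s) k) has_vector_derivative - h1_coeff (gw t) k) (at t within S)"
    "continuous_on S w" "continuous_on S p"
    "\<And>t. t \<in> S \<Longrightarrow> w t \<in> Oset" "\<And>t. t \<in> S \<Longrightarrow> p t \<in> H1p0"
proof -
  have "\<forall>t\<in>S. \<exists>g. has_gradient F (w t, p t) (fst g) (snd g) \<and>
      ((\<lambda>s. (w s, p s)) has_vector_derivative (snd g, - fst g)) (at t within S)"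
  proof
    fix t assume "t \<in> S"
    then obtain v a b where "((\<lambda>s. (w s, p s)) has_vector_derivative v) (at t within S)"
      "has_gradient F (w t, p t) a b" "v = (b, - a)"
      using assms unfolding ham_solution_def is_X_def by blast
    then show "\<exists>g. has_gradient F (w t, p t) (fst g) (snd g) \<and>
        ((\<lambda>s. (w s, p s)) has_vector_derivative (snd g, - fst g)) (at t within S)"
      by (intro exI [of _ "(a, b)"]) simp
  qed
  from bchoice [OF this] obtain g where g: "\<And>t. t \<in> S \<Longrightarrow> has_gradient F (w t, p t) (fst (g t)) (snd (g t))"
    "\<And>t. t \<in> S \<Longrightarrow> ((\<lambda>s. (w s, p s)) has_vector_derivative (snd (g t), - fst (g t))) (at t within S)"
    by blast
  have wp: "continuous_on S (\<lambda>s. (w s, p s))"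
    using g(2) has_vector_derivative_continuous continuous_on_eq_continuous_within by blast
  show thesis
  proof (rule that)
    show "continuous_on S w" "continuous_on S p"
      using continuous_on_fst [OF wp] continuous_on_snd [OF wp] by simp_all
    fix t k assume t: "t \<in> S"
    show "has_gradient F (w t, p t) (fst (g t)) (snd (g t))" using g t by blast
    show "((\<lambda>s. h1_coeff (w s) k) has_vector_derivative h1_coeff (snd (g t)) k) (at t within S)"
      using bounded_linear.has_vector_derivative [OF bounded_linear_compose [OF bounded_linear_h1_coeff bounded_linear_fst] g(2) [OF t]]
      by simp
    show "((\<lambda>s. h1_coeff (p s) k) has_vector_derivative - h1_coeff (fst (g t)) k) (at t within S)"
      using bounded_linear.has_vector_derivative [OF bounded_linear_compose [OF bounded_linear_h1_coeff bounded_linear_snd] g(2) [OF t]]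
      by simp
    show "w t \<in> Oset" "p t \<in> H1p0" using assms t by (auto simp: ham_solution_def)
  qed
qed

lemma F_space_invariant:
  assumes F: "F = H_ham f \<or> F = J_int f k" and sol: "ham_solution F {0..<T} w p"
    and w0: "w 0 \<in> F_space N" and \<tau>: "\<tau> \<in> {0..<T}"
  shows "w \<tau> \<in> F_space N"
proof -
  obtain gw gp where g: "\<And>t. t \<in> {0..<T} \<Longrightarrow> has_gradient F (w t, p t) (gw t) (gp t)"
    "\<And>t k. t \<in> {0..<T} \<Longrightarrow> ((\<lambda>s. h1_coeff (w s) k) has_vector_derivative h1_coeff (gp t) k) (at t within {0..<T})"
    "\<And>t k. t \<in> {0..<T} \<Longrightarrow> ((\<lambda>s. h1_coeff (p s) k) has_vector_derivative - h1_coeff (gw t) k) (at t within {0..<T})"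
    and cont: "continuous_on {0..<T} w" "continuous_on {0..<T} p"
    and wO: "\<And>t. t \<in> {0..<T} \<Longrightarrow> w t \<in> Oset" and pH: "\<And>t. t \<in> {0..<T} \<Longrightarrow> p t \<in> H1p0"
    by (rule ham_solution_gradients [OF sol]) blast
  have sub: "{0..\<tau>} \<subseteq> {0..<T}" using \<tau> by auto
  have d: "((\<lambda>s. h1_coeff (w s) k) has_vector_derivative h1_coeff (gp t) k) (at t within {0..\<tau>})"
    if "t \<in> {0..\<tau>}" for t k
    using g(2) [of t k] that sub has_vector_derivative_within_subset by blast
  \<comment> \<open>The norms may blow up at \<open>T\<close>; compactness of
    \<open>[0, \<tau>]\<close> makes the coefficients of the linear system bounded.\<close>
  have "bounded (w ` {0..\<tau>})" "bounded (p ` {0..\<tau>})"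
    by (intro compact_imp_bounded compact_continuous_image continuous_on_subset [OF cont(1) sub]
        continuous_on_subset [OF cont(2) sub]; simp)+
  then obtain A B where A: "\<And>t. t \<in> {0..\<tau>} \<Longrightarrow> norm (w t) \<le> A" and B: "\<And>t. t \<in> {0..\<tau>} \<Longrightarrow> norm (p t) \<le> B"
    unfolding bounded_iff by blast
  have AB: "0 \<le> A" "0 \<le> B" 
    using order_trans [OF norm_ge_zero A [of 0]] order_trans [OF norm_ge_zero B [of 0]] \<tau> by simp_all
  have init: "h1_coeff (w 0) j = 0" if "j \<le> 0 \<or> int N + 2 \<le> j" for j
    using w0 that by (auto simp: F_space_iff)
  have high: "h1_coeff (w t) j = 0" if "int N + 2 \<le> j" "t \<in> {0..\<tau>}" for j t
  proof (rule triangular_system_zero [where n = "int N + 2" and x' = "\<lambda>j t. h1_coeff (gp t) j" and x = "\<lambda>j t. h1_coeff (w t) j"])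
    show "0 \<le> (2 + 4 * real k * A) * (h1_const * B)"
      using AB h1_const_nonneg by simp
    show "norm (h1_coeff (w t) j) \<le> A" if "t \<in> {0..\<tau>}" for j t
      using norm_h1_coeff_le A that order_trans by blast
    fix j t \<epsilon>
    assume j: "int N + 2 \<le> j" and t: "t \<in> {0..\<tau>}" and \<epsilon>: "0 \<le> (\<epsilon>::real)"
      and tail: "\<And>i. int N + 2 \<le> i \<Longrightarrow> norm (h1_coeff (w t) i) \<le> \<epsilon>"
    have t': "t \<in> {0..<T}" using t sub by blast
    have "cmod (h1_coeff (gp t) j) \<le> (2 + 4 * real k * norm (w t)) * (h1_const * norm (p t)) * \<epsilon>"
      using j by (intro gradient_tail_bound [OF F g(1) [OF t'] wO [OF t'] pH [OF t']] \<epsilon> tail) auto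
    also have "\<dots> \<le> (2 + 4 * real k * A) * (h1_const * B) * \<epsilon>"
      using AB h1_const_nonneg \<epsilon> A [OF t] B [OF t]
      by (intro mult_right_mono mult_mono mult_left_mono add_left_mono) auto
    finally show "norm (h1_coeff (gp t) j) \<le> (2 + 4 * real k * A) * (h1_const * B) * \<epsilon>" .
  qed (use d init that in auto)
  \<comment> \<open>The modes beyond \<open>N + 1\<close> are already 0, so the tail bound holds
    with tail size 0. The leading mode of \<open>w\<close> is thus constant and keeps its value
    1.\<close>
  have "h1_coeff (gp t) (int N + 1) = 0" if t: "t \<in> {0..\<tau>}" for t
  proof -
    have t': "t \<in> {0..<T}" using t sub by blast
    have "cmod (h1_coeff (gp t) (int N + 1)) \<le> (2 + 4 * real k * norm (w t)) * (h1_const * norm (p t)) * 0"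
      by (rule gradient_tail_bound [OF F g(1) [OF t'] wO [OF t'] pH [OF t']]) (use high t in auto)
    then show ?thesis by simp
  qed
  then have "((\<lambda>s. h1_coeff (w s) (int N + 1)) has_derivative (\<lambda>h. 0)) (at t within {0..\<tau>})" if "t \<in> {0..\<tau>}" for t
    using d [OF that, of "int N + 1"] that by (simp add: has_vector_derivative_def)
  then obtain c where "\<And>t. t \<in> {0..\<tau>} \<Longrightarrow> h1_coeff (w t) (int N + 1) = c"
    using has_derivative_zero_constant [of "{0..\<tau>}" "\<lambda>s. h1_coeff (w s) (int N + 1)"] by auto
  then have "h1_coeff (w \<tau>) (int N + 1) = h1_coeff (w 0) (int N + 1)" using \<tau> by simp
  then show ?thesis
    using w0 high \<tau> Oset_H1p0 [OF wO [OF \<tau>]] by (auto simp: F_space_iff H1p0_coeff)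
qed

section \<open>Reduction to finitely many modes\<close>

lemma F_space_coeff: "w \<in> F_space N \<Longrightarrow> int N + 1 < k \<Longrightarrow> h1_coeff w k = 0"
  by (simp add: F_space_iff)

text \<open>Every mode of \<open>p\<close> has index at least 1, so \<open>\<Gamma>(w)p\<close>
  stops at \<open>N\<close> although \<open>w\<close> reaches \<open>N + 1\<close>.\<close>

lemma gam_eq_0: "w \<in> F_space N \<Longrightarrow> p \<in> H1p0 \<Longrightarrow> int N < i \<Longrightarrow> gam w p i = 0"
proof -
  assume w: "w \<in> F_space N" and p: "p \<in> H1p0" and i: "int N < i"
  have "h1_coeff w (m + i) * h1_coeff p m = 0" for m
    using F_space_coeff [OF w, of "m + i"] H1p0_coeff [OF p, of m] i by (cases "m \<le> 0") auto
  then have "(\<lambda>m. h1_coeff w (m + i) * h1_coeff p m) = (\<lambda>_. 0)" by blast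
  then show ?thesis by (simp add: gam_def hankel_def)
qed

lemma gam_finite:
  assumes w: "w \<in> F_space N" and p: "p \<in> H1p0" and i: "1 \<le> i"
  shows "gam w p i = (\<Sum>m=1..int N. h1_coeff w (m + i) * h1_coeff p m)"
proof -
  have "h1_coeff w (m + i) * h1_coeff p m = 0" if "m \<notin> {1..int N}" for m
    using F_space_coeff [OF w, of "m + i"] H1p0_coeff [OF p, of m] i that by (cases "m \<le> 0") auto
  then have "((\<lambda>m. h1_coeff w (m + i) * h1_coeff p m) has_sum (\<Sum>m=1..int N. h1_coeff w (m + i) * h1_coeff p m)) UNIV"
    by (intro has_sum_finite_neutralI) auto
  then show ?thesis using i by (simp add: gam_def hankel_def infsumI)
qed

lemma gam2_finite:
  assumes w: "w \<in> F_space N" and p: "p \<in> H1p0" and i: "0 \<le> i"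
  shows "gam2 w p i = (\<Sum>m=1..int N. gam w p (m + i) * h1_coeff p m)"
proof -
  have "gam w p (m + i) * h1_coeff p m = 0" if "m \<notin> {1..int N}" for m
    using gam_eq_0 [OF w p, of "m + i"] H1p0_coeff [OF p, of m] i that by (cases "m \<le> 0") auto
  then have "((\<lambda>m. gam w p (m + i) * h1_coeff p m) has_sum (\<Sum>m=1..int N. gam w p (m + i) * h1_coeff p m)) UNIV"
    by (intro has_sum_finite_neutralI) auto
  then show ?thesis by (simp add: gam2_def infsumI)
qed

lemma Pi_le_H1p0: "Pi_le N p \<in> H1p0"
  by (simp add: H1p0_def h1_coeff_Pi_le)

lemma gam_Pi_le: "w \<in> F_space N \<Longrightarrow> p \<in> H1p0 \<Longrightarrow> gam w (Pi_le N p) i = gam w p i"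
  by (cases "1 \<le> i") (simp add: gam_finite Pi_le_H1p0 h1_coeff_Pi_le, simp add: gam_def)

lemma gam2_Pi_le: "w \<in> F_space N \<Longrightarrow> p \<in> H1p0 \<Longrightarrow> 0 \<le> i \<Longrightarrow> gam2 w (Pi_le N p) i = gam2 w p i"
  by (simp add: gam2_finite Pi_le_H1p0 h1_coeff_Pi_le gam_Pi_le)

lemma F_space_H1p0: "w \<in> F_space N \<Longrightarrow> w \<in> H1p0"
  by (simp add: F_space_iff H1p0_def)

text \<open>Both sides are the double sum of \<open>w_k p_m p_(k-m)\<close>, with the summations in
  opposite order.\<close>

lemma pairing_square_eq:
  assumes w: "w \<in> F_space N" and p: "p \<in> H1p0"
  shows "pairing (h1_fun w) (\<lambda>y. (h1_fun p y)\<^sup>2) = gam2 w p 0"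
proof -
  let ?W = "h1_coeff w" and ?P = "h1_coeff p"
  have W0: "?W k = 0" if "k \<notin> {1..int N + 1}" for k
    using w that by (auto simp: F_space_iff)
  \<comment> \<open>For \<open>k \<le> N + 1\<close> a factor \<open>p_m\<close> with
    \<open>m > N\<close> meets \<open>p_(k-m)\<close> of index at most 0, so only the first
    \<open>N\<close> modes survive, even though \<open>p\<close> itself may have infinitely
    many.\<close>
  have sq: "fourier_coeff (\<lambda>y. (h1_fun p y)\<^sup>2) k = (\<Sum>m=1..int N. ?P m * ?P (k - m))" if "k \<le> int N + 1" for k
  proof -
    have "((\<lambda>m. ?P m * ?P (k - m)) has_sum fourier_coeff (\<lambda>y. h1_fun p y * h1_fun p y) k) UNIV"
      by (intro has_sum_fourier_coeff_mult wiener_h1 h1_fun_continuous)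
    moreover have "((\<lambda>m. ?P m * ?P (k - m)) has_sum (\<Sum>m=1..int N. ?P m * ?P (k - m))) UNIV"
    proof (rule has_sum_finite_neutralI)
      fix m assume "m \<in> UNIV - {1..int N}"
      then show "?P m * ?P (k - m) = 0"
        using H1p0_coeff [OF p, of m] H1p0_coeff [OF p, of "k - m"] that by (cases "m \<le> 0") auto
    qed auto
    ultimately show ?thesis using has_sum_unique unfolding power2_eq_square by blast
  qed
  have hk: "hankel w p m = (\<Sum>k=1..int N + 1. ?W k * ?P (k - m))" for m
  proof -
    have "((\<lambda>k. ?W k * ?P (k - m)) has_sum hankel w p m) UNIV"
      using has_sum_hankel [of w m p]
      by (subst has_sum_reindex_bij_witness [of _ "\<lambda>n. n + m" "\<lambda>k. k - m"]) auto
    moreover have "((\<lambda>k. ?W k * ?P (k - m)) has_sum (\<Sum>k=1..int N + 1. ?W k * ?P (k - m))) UNIV"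
      by (rule has_sum_finite_neutralI) (auto intro: W0)
    ultimately show ?thesis using has_sum_unique by blast
  qed
  have "pairing (h1_fun w) (\<lambda>y. (h1_fun p y)\<^sup>2) = (\<Sum>k=1..int N + 1. ?W k * fourier_coeff (\<lambda>y. (h1_fun p y)\<^sup>2) k)"
    unfolding pairing_def by (rule infsumI, rule has_sum_finite_neutralI) (auto intro: W0)
  also have "\<dots> = (\<Sum>k=1..int N + 1. \<Sum>m=1..int N. ?P m * (?W k * ?P (k - m)))"
    by (intro sum.cong refl) (simp add: sq sum_distrib_left mult_ac)
  also have "\<dots> = (\<Sum>m=1..int N. ?P m * hankel w p m)"
    by (subst sum.swap) (simp add: hk sum_distrib_left)
  also have "\<dots> = gam2 w p 0"
    unfolding gam2_finite [OF w p order_refl] by (intro sum.cong refl) (simp add: gam_def mult.commute)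
  finally show ?thesis .
qed

lemma reduced_Pi_le:
  assumes F: "F = H_ham f \<or> F = J_int f k" and w: "w \<in> F_space N" and p: "p \<in> H1p0"
  shows "F (w, Pi_le N p) = F (w, p)"
  using F
proof
  assume "F = H_ham f"
  then show ?thesis
    using pairing_square_eq [OF w p] pairing_square_eq [OF w Pi_le_H1p0] gam2_Pi_le [OF w p, of 0] by simp
next
  assume "F = J_int f k"
  moreover have "I_fun k (h1_fun w) (h1_fun (Pi_le N p)) = I_fun k (h1_fun w) (h1_fun p)"
    unfolding I_fun_eq [OF F_space_H1p0 [OF w] p] I_fun_eq [OF F_space_H1p0 [OF w] Pi_le_H1p0]
    using w p by (intro sum.cong refl) (simp add: gam_Pi_le gam2_Pi_le)
  ultimately show ?thesis by simp
qed

section \<open>Coordinate derivatives on the reduced phase space\<close>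

lemma h1_mode_0 [simp]: "h1_mode 0 l = 0"
  by (rule h1_eqI) simp

lemma F_space_add_mode: "w \<in> F_space N \<Longrightarrow> 1 \<le> l \<Longrightarrow> l \<le> int N \<Longrightarrow> w + h1_mode z l \<in> F_space N"
  by (auto simp: F_space_iff h1_coeff_add)

lemma PF_space_add_p: "(w, p) \<in> PF_space N \<Longrightarrow> 1 \<le> l \<Longrightarrow> l \<le> int N \<Longrightarrow> (w, p + h1_mode z l) \<in> PF_space N"
  by (auto simp: PF_space_iff h1_coeff_add)

lemma eventually_PF_space_add_w:
  assumes "(w, p) \<in> PF_space N" "1 \<le> l" "l \<le> int N"
  shows "\<forall>\<^sub>F z in nhds 0. (w + h1_mode z l, p) \<in> PF_space N"
proof -
  obtain \<delta> where "\<delta> > 0" "\<And>z. cmod z < \<delta> \<Longrightarrow> w + h1_mode z l \<in> Oset"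
    using Oset_perturb_mode assms by (auto simp: PF_space_iff)
  then show ?thesis
    using assms by (auto simp: eventually_nhds_metric PF_space_iff F_space_add_mode intro!: exI [of _ \<delta>])
qed

text \<open>Outside \<open>PF_space N\<close> the restriction is \<open>undefined\<close>. The
  derivative is inherited because small perturbations of \<open>w\<close> remain in
  \<open>Oset\<close>; perturbations of \<open>p\<close> never leave the space.\<close>

lemma restrict_PF_deriv_w:
  assumes "(w, p) \<in> PF_space N" "1 \<le> l" "l \<le> N"
    and "((\<lambda>z. F (w + h1_mode z (int l), p)) has_field_derivative d) (at 0)"
  shows "((\<lambda>z. restrict F (PF_space N) (w + h1_mode z (int l), p)) has_field_derivative d) (at 0)"
    and "dF_w (restrict F (PF_space N)) l (w, p) = d"
proof -
  have "\<forall>\<^sub>F z in nhds 0. restrict F (PF_space N) (w + h1_mode z (int l), p) = F (w + h1_mode z (int l), p)"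
    using eventually_PF_space_add_w [OF assms(1), of "int l"] assms by (auto elim: eventually_mono)
  then show *: "((\<lambda>z. restrict F (PF_space N) (w + h1_mode z (int l), p)) has_field_derivative d) (at 0)"
    using assms(4) by (subst DERIV_cong_ev [OF refl _ refl]) auto
  then show "dF_w (restrict F (PF_space N)) l (w, p) = d" by (simp add: DERIV_imp_deriv)
qed

lemma restrict_PF_deriv_p:
  assumes "(w, p) \<in> PF_space N" "1 \<le> l" "l \<le> N"
    and "((\<lambda>z. F (w, p + h1_mode z (int l))) has_field_derivative d) (at 0)"
  shows "((\<lambda>z. restrict F (PF_space N) (w, p + h1_mode z (int l))) has_field_derivative d) (at 0)"
    and "dF_p (restrict F (PF_space N)) l (w, p) = d"
proof -
  show *: "((\<lambda>z. restrict F (PF_space N) (w, p + h1_mode z (int l))) has_field_derivative d) (at 0)"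
    using assms PF_space_add_p [OF assms(1)] by simp
  then show "dF_p (restrict F (PF_space N)) l (w, p) = d" by (simp add: DERIV_imp_deriv)
qed

lemma bounded_linear_Pi_le: "bounded_linear (Pi_le N)"
  unfolding Pi_le_def [abs_def]
  by (intro bounded_linear_sum bounded_linear_compose [OF bounded_linear_h1_mode bounded_linear_h1_coeff])

lemma Ck_on_bounded_linear:
  assumes "bounded_linear L" "Ck_on n S u"
  shows "Ck_on n S (\<lambda>t. L (u t))"
  using assms(2)
proof (induction n arbitrary: u)
  case 0
  then show ?case using bounded_linear.continuous_on [OF assms(1)] by simp
next
  case (Suc n)
  then show ?case
    using bounded_linear.has_vector_derivative [OF assms(1)] unfolding Ck_on.simps by meson
qed

text \<open>\<open>F\<close> takes the same values at \<open>p\<close> and at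
  \<open>Pi_le N p\<close>, and the projection commutes with adding a mode \<open>l \<le> N\<close>.
  So the gradient components at \<open>(w, p)\<close> are the coordinate derivatives at the
  projected point.\<close>

lemma ham_solution_reduces:
  assumes F: "F = H_ham f \<or> F = J_int f k" and sol: "ham_solution F {0..<T} w p"
    and w0: "w 0 \<in> F_space N"
  shows "PF_solution N (restrict F (PF_space N)) {0..<T} w (\<lambda>t. Pi_le N (p t))"
  unfolding PF_solution_def
proof (intro ballI conjI)
  obtain gw gp where g: "\<And>t. t \<in> {0..<T} \<Longrightarrow> has_gradient F (w t, p t) (gw t) (gp t)"
    "\<And>t k. t \<in> {0..<T} \<Longrightarrow> ((\<lambda>s. h1_coeff (w s) k) has_vector_derivative h1_coeff (gp t) k) (at t within {0..<T})"
    "\<And>t k. t \<in> {0..<T} \<Longrightarrow> ((\<lambda>s. h1_coeff (p s) k) has_vector_derivative - h1_coeff (gw t) k) (at t within {0..<T})"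
    and cont: "continuous_on {0..<T} w" "continuous_on {0..<T} p"
    and wO: "\<And>t. t \<in> {0..<T} \<Longrightarrow> w t \<in> Oset" and pH: "\<And>t. t \<in> {0..<T} \<Longrightarrow> p t \<in> H1p0"
    by (rule ham_solution_gradients [OF sol]) blast
  fix t assume t: "t \<in> {0..<T}"
  have wF: "w t \<in> F_space N" by (rule F_space_invariant [OF F sol w0 t])
  show PF: "(w t, Pi_le N (p t)) \<in> PF_space N"
    using wF wO [OF t] by (auto simp: PF_space_iff h1_coeff_Pi_le)
  fix l assume l: "l \<in> {1..N}"
  have Pi: "Pi_le N (p t) + h1_mode z (int l) = Pi_le N (p t + h1_mode z (int l))" for z
    using l by (intro h1_eqI) (auto simp: h1_coeff_Pi_le h1_coeff_add)
  have "((\<lambda>z. F (w t, Pi_le N (p t) + h1_mode z (int l))) has_field_derivative h1_coeff (gp t) (int l)) (at 0)"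
    using has_gradient_p [OF g(1) [OF t] wO [OF t] pH [OF t], of "int l"] l
    unfolding Pi by (simp add: reduced_Pi_le [OF F wF] H1p0_add pH [OF t] H1p0_mode)
  then show "((\<lambda>s. h1_coeff (w s) (int l)) has_vector_derivative dF_p (restrict F (PF_space N)) l (w t, Pi_le N (p t))) (at t within {0..<T})"
    using g(2) [OF t] l by (subst restrict_PF_deriv_p(2) [OF PF]) auto
  have "((\<lambda>z. F (w t + h1_mode z (int l), Pi_le N (p t))) has_field_derivative h1_coeff (gw t) (int l)) (at 0)"
    using has_gradient_w [OF g(1) [OF t] wO [OF t] pH [OF t], of "int l"] l
    by (simp add: reduced_Pi_le [OF F F_space_add_mode [OF wF]] pH [OF t])
  then show "((\<lambda>s. h1_coeff (Pi_le N (p s)) (int l)) has_vector_derivative - dF_w (restrict F (PF_space N)) l (w t, Pi_le N (p t))) (at t within {0..<T})"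
    using g(3) [OF t, of "int l"] l by (subst restrict_PF_deriv_w(2) [OF PF]) (auto simp: h1_coeff_Pi_le)
qed

section \<open>The derivative of \<open>J_k\<close> in the coordinates\<close>

definition phi :: "h1 \<Rightarrow> h1 \<Rightarrow> int \<Rightarrow> complex" where
  "phi f w m = fourier_coeff (\<lambda>y. h1_fun f y / h1_fun w y) m"

definition psi :: "h1 \<Rightarrow> h1 \<Rightarrow> int \<Rightarrow> complex" where
  "psi f w m = fourier_coeff (\<lambda>y. h1_fun f y / (h1_fun w y)\<^sup>2) m"

lemma norm_fourier_coeff_le:
  assumes "continuous_on {0..1} g" "\<And>y. y \<in> {0..1} \<Longrightarrow> cmod (g y) \<le> B"
  shows "cmod (fourier_coeff g k) \<le> B"
proof -
  have "cmod (integral {0..1} (\<lambda>y. g y * echar (- k) y)) \<le> B * (1 - 0)"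
    using assms by (intro integral_bound) (auto simp: norm_mult intro!: continuous_intros)
  then show ?thesis by (simp add: fourier_coeff_def)
qed

text \<open>With \<open>v = u - w\<close> the remainder is exact:
  \<open>1/u - 1/w + v/w\<^sup>2 = v\<^sup>2/(w\<^sup>2 u)\<close>, quadratic in \<open>v\<close>
  while \<open>u\<close> stays away from 0.\<close>

lemma phi_has_derivative:
  assumes nz: "\<And>y. h1_fun w y \<noteq> 0"
  shows "((\<lambda>u. phi f u m) has_derivative
    (\<lambda>v. - fourier_coeff (\<lambda>y. h1_fun v y * (h1_fun f y / (h1_fun w y)\<^sup>2)) m)) (at w)"
proof -
  let ?L = "\<lambda>v. - fourier_coeff (\<lambda>y. h1_fun v y * (h1_fun f y / (h1_fun w y)\<^sup>2)) m"
  let ?c = h1_const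
  obtain \<mu> where \<mu>: "\<mu> > 0" "\<And>y. \<mu> \<le> cmod (h1_fun w y)"
    using h1_fun_lower_bound [OF nz] by blast
  have cont: "continuous_on {0..1} (\<lambda>y. h1_fun v y * (h1_fun f y / (h1_fun w y)\<^sup>2))" for v
    using nz by (intro continuous_intros h1_fun_continuous) auto
  have mu2: "\<mu>\<^sup>2 \<le> cmod ((h1_fun w y)\<^sup>2)" for y
    using power_mono [OF \<mu>(2), of 2 y] \<mu>(1) by (simp add: norm_power)
  have fw: "cmod (h1_fun f y / (h1_fun w y)\<^sup>2) \<le> ?c * norm f / \<mu>\<^sup>2" for y
    unfolding norm_divide using \<mu>(1) h1_const_nonneg by (intro frac_le norm_h1_fun_le mu2) auto
  have bl: "bounded_linear ?L"
  proof (rule bounded_linear_intro [where K = "?c * (?c * norm f / \<mu>\<^sup>2)"])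
    show "?L (u + v) = ?L u + ?L v" for u v
      by (simp only: h1_fun_add distrib_right fourier_coeff_add [OF cont cont] minus_add_distrib)
    show "?L (r *\<^sub>R v) = r *\<^sub>R ?L v" for r v
      unfolding h1_fun_scaleR scaleR_conv_of_real mult.assoc fourier_coeff_scale by simp
    show "norm (?L v) \<le> norm v * (?c * (?c * norm f / \<mu>\<^sup>2))" for v
    proof -
      have "norm (?L v) \<le> (?c * norm v) * (?c * norm f / \<mu>\<^sup>2)"
        unfolding norm_minus_cancel
        by (rule norm_fourier_coeff_le [OF cont], subst norm_mult)
          (intro mult_mono norm_h1_fun_le fw, auto simp: h1_const_nonneg)
      then show ?thesis by (simp add: mult_ac)
    qed
  qed
  define C where "C = (?c * norm f / \<mu>\<^sup>2) * (?c\<^sup>2 / (\<mu> / 2))"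
  show ?thesis
  \<comment> \<open>Within this radius the sup norm of \<open>u - w\<close> is at most
    \<open>\<mu> / 2\<close>, which leaves \<open>\<mu> / 2\<close> as a lower bound for
    \<open>u\<close>.\<close>
  proof (rule has_derivativeI_sandwich [where e = "\<mu> / (2 * (?c + 1))" and H = "\<lambda>u. C * norm (u - w)"])
    show "\<mu> / (2 * (?c + 1)) > 0" using \<mu> h1_const_nonneg by simp
    show "bounded_linear ?L" by (rule bl)
    show "((\<lambda>u. C * norm (u - w)) \<longlongrightarrow> 0) (at w)"
      by (rule tendsto_eq_intros refl | simp)+
    fix u assume u: "u \<noteq> w" "dist u w < \<mu> / (2 * (?c + 1))"
    let ?v = "u - w"
    have uv: "h1_fun u y = h1_fun w y + h1_fun ?v y" for y
      using h1_fun_add [of w ?v y] by simp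
    have v: "cmod (h1_fun ?v y) \<le> \<mu> / 2" for y
    proof -
      have "cmod (h1_fun ?v y) \<le> ?c * norm ?v" by (rule norm_h1_fun_le)
      also have "\<dots> \<le> (?c + 1) * (\<mu> / (2 * (?c + 1)))"
        using u h1_const_nonneg by (intro mult_mono) (auto simp: dist_norm)
      also have "\<dots> = \<mu> / 2" using h1_const_nonneg by (simp add: field_simps)
      finally show ?thesis .
    qed
    have ul: "\<mu> / 2 \<le> cmod (h1_fun u y)" for y
      using norm_diff_ineq [of "h1_fun w y" "h1_fun ?v y"] v [of y] \<mu>(2) [of y] unfolding uv by linarith
    have unz: "h1_fun u y \<noteq> 0" for y
      using ul [of y] \<mu>(1) by auto
    have c1: "continuous_on {0..1} (\<lambda>y. h1_fun f y / h1_fun x y)" if "\<And>y. h1_fun x y \<noteq> 0" for x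
      using that by (intro continuous_intros h1_fun_continuous) auto
    let ?r = "\<lambda>y. h1_fun f y / (h1_fun w y)\<^sup>2 * ((h1_fun ?v y)\<^sup>2 / h1_fun u y)"
    have cr: "continuous_on {0..1} ?r"
      using nz unz by (intro continuous_intros h1_fun_continuous) auto
    have "phi f u m - phi f w m - ?L ?v = fourier_coeff (\<lambda>y. (h1_fun f y / h1_fun u y - h1_fun f y / h1_fun w y)
        + h1_fun ?v y * (h1_fun f y / (h1_fun w y)\<^sup>2)) m"
      unfolding phi_def
      by (subst fourier_coeff_add [OF continuous_on_diff [OF c1 c1] cont])
        (auto simp: fourier_coeff_diff [OF c1 c1] nz unz)
    also have "(\<lambda>y. (h1_fun f y / h1_fun u y - h1_fun f y / h1_fun w y)
        + h1_fun ?v y * (h1_fun f y / (h1_fun w y)\<^sup>2)) = ?r"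
    proof
      fix y
      show "(h1_fun f y / h1_fun u y - h1_fun f y / h1_fun w y)
        + h1_fun ?v y * (h1_fun f y / (h1_fun w y)\<^sup>2) = ?r y"
        using nz [of y] unz [of y] uv [of y]
        by (simp add: divide_simps) (simp add: algebra_simps power2_eq_square)
    qed
    finally have eq: "phi f u m - phi f w m - ?L ?v = fourier_coeff ?r m" .
    have "cmod (fourier_coeff ?r m) \<le> (?c * norm f / \<mu>\<^sup>2) * ((?c * norm ?v)\<^sup>2 / (\<mu> / 2))"
    proof (rule norm_fourier_coeff_le [OF cr])
      fix y :: real
      have "cmod ((h1_fun ?v y)\<^sup>2 / h1_fun u y) \<le> (?c * norm ?v)\<^sup>2 / (\<mu> / 2)"
        unfolding norm_divide norm_power using \<mu>(1) ul by (intro frac_le power_mono norm_h1_fun_le) auto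
      then show "cmod (?r y) \<le> (?c * norm f / \<mu>\<^sup>2) * ((?c * norm ?v)\<^sup>2 / (\<mu> / 2))"
        unfolding norm_mult using h1_const_nonneg by (intro mult_mono fw) auto
    qed
    also have "\<dots> = C * norm ?v * norm ?v" by (simp add: C_def power2_eq_square)
    finally show "norm (phi f u m - phi f w m - ?L ?v) / norm ?v \<le> C * norm ?v"
      using u unfolding eq by (simp add: field_simps)
  qed
qed

lemma wiener_divide_F_space:
  assumes w: "w \<in> F_space N" and nz: "\<And>y. h1_fun w y \<noteq> 0"
  shows "wiener (\<lambda>y. h1_fun f y / h1_fun w y)"
proof -
  define q where "q = (\<Sum>k\<le>N + 1. monom (h1_coeff w (int k)) k)"
  have "h1_fun w y = poly q (echar 1 y)" for y
  proof -
    have pow: "echar (int n) y = echar 1 y ^ n" for n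
      by (induction n) (auto simp: echar_add add.commute)
    have "((\<lambda>k. h1_coeff w k * echar k y) has_sum (\<Sum>k\<in>int ` {..N + 1}. h1_coeff w k * echar k y)) UNIV"
    proof (rule has_sum_finite_neutralI)
      fix k assume "k \<in> UNIV - int ` {..N + 1}"
      then have "k < 0 \<or> int N + 1 < k"
        using image_eqI [of k int "nat k" "{..N + 1}"] by fastforce
      then show "h1_coeff w k * echar k y = 0" using w by (auto simp: F_space_iff)
    qed auto
    moreover have "((\<lambda>k. h1_coeff w k * echar k y) has_sum h1_fun w y) UNIV"
      using has_sum_fser [OF summable_h1_coeff, of w y] wiener_eq_fser [OF wiener_h1, of w] by simp
    ultimately have "h1_fun w y = (\<Sum>k\<in>int ` {..N + 1}. h1_coeff w k * echar k y)"
      using has_sum_unique by blast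
    then show ?thesis by (simp add: q_def poly_sum poly_monom sum.reindex pow)
  qed
  then have "wiener (\<lambda>y. h1_fun f y * (1 / h1_fun w y))"
    using wiener_mult [OF wiener_h1 wiener_inverse_poly, of q f] nz by simp
  then show ?thesis by simp
qed

lemma F_space_mult_coeff:
  assumes w: "w \<in> F_space N" and g: "continuous_on {0..1} g"
  shows "fourier_coeff (\<lambda>y. h1_fun w y * g y) n = (\<Sum>i=1..int N + 1. h1_coeff w i * fourier_coeff g (n - i))"
proof -
  have "((\<lambda>i. h1_coeff w i * fourier_coeff g (n - i)) has_sum
      (\<Sum>i=1..int N + 1. h1_coeff w i * fourier_coeff g (n - i))) UNIV"
    by (rule has_sum_finite_neutralI) (use w in \<open>auto simp: F_space_iff\<close>)
  then show ?thesis using has_sum_fourier_coeff_mult [OF wiener_h1 g] has_sum_unique by blast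
qed

text \<open>The projection keeps the modes \<open>k + 1 - i \<ge> 1\<close>, that is
  \<open>i \<le> k\<close>. The \<open>f\<close>-term therefore has the same range as the
  \<open>gam2\<close>-term and merges with it.\<close>

lemma J_int_F_space:
  assumes w: "w \<in> F_space N" and nz: "\<And>y. h1_fun w y \<noteq> 0" and p: "p \<in> H1p0" and k: "k \<le> N"
  shows "J_int f k (w, p) = (\<Sum>i=1..int k. gam w p i * gam w p (int k + 1 - i)
    - h1_coeff w i * (gam2 w p (int k + 1 - i) + phi f w (int k + 1 - i)))"
proof -
  note W = wiener_divide_F_space [OF w nz, of f]
  have "fourier_coeff (\<lambda>y. h1_fun w y * Pi_plus0 (\<lambda>x. h1_fun f x / h1_fun w x) y) (int k + 1)
    = (\<Sum>i=1..int N + 1. h1_coeff w i * (if 1 \<le> int k + 1 - i then phi f w (int k + 1 - i) else 0))"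
    unfolding F_space_mult_coeff [OF w wiener_continuous [OF wiener_Pi_plus0 [OF W]]]
    by (simp only: fourier_coeff_Pi_plus0 [OF W] phi_def)
  also have "\<dots> = (\<Sum>i=1..int k. h1_coeff w i * phi f w (int k + 1 - i))"
    using k by (intro sum.mono_neutral_cong_right) auto
  finally show ?thesis
    by (simp add: I_fun_eq [OF F_space_H1p0 [OF w] p] sum_subtractf sum.distrib algebra_simps)
qed

section \<open>The product rule for \<open>J_k\<close>\<close>

definition psq :: "nat \<Rightarrow> h1 \<Rightarrow> int \<Rightarrow> complex" where
  "psq N p s = (\<Sum>m=1..int N. h1_coeff p m * h1_coeff p (s - m))"

text \<open>Evaluated at \<open>l - i\<close>, this is the derivative of \<open>potential\<close> at
  \<open>i\<close> with respect to \<open>w_l\<close>; the sign in \<open>- s\<close> comes from the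
  convolution with \<open>1 / w\<^sup>2\<close>.\<close>

definition qcoeff :: "nat \<Rightarrow> h1 \<Rightarrow> h1 \<Rightarrow> h1 \<Rightarrow> int \<Rightarrow> complex" where
  "qcoeff N f w p s = psq N p s - psi f w (- s)"

definition potential :: "h1 \<Rightarrow> h1 \<Rightarrow> h1 \<Rightarrow> int \<Rightarrow> complex" where
  "potential f w p i = gam2 w p i + phi f w i"

definition dJ_p :: "h1 \<times> h1 \<Rightarrow> int \<Rightarrow> int \<Rightarrow> complex" where
  "dJ_p x k l = 2 * bez (gam (fst x) (snd x)) (h1_coeff (fst x)) k l"

definition dJ_w :: "nat \<Rightarrow> h1 \<Rightarrow> h1 \<times> h1 \<Rightarrow> int \<Rightarrow> int \<Rightarrow> complex" where
  "dJ_w N f x k l = (case x of (w, p) \<Rightarrow>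
    (\<Sum>i=1..k. 2 * gam w p i * h1_coeff p (l - (k + 1 - i)) - h1_coeff w i * qcoeff N f w p (l - (k + 1 - i)))
    - of_bool (l \<le> k) * potential f w p (k + 1 - l))"

text \<open>The parameter space is an arbitrary real normed space, so one chain rule yields both the
  complex coordinate derivatives (a disc as parameter set) and the derivative along a solution (a
  time interval).\<close>

locale PF_curve =
  fixes N :: nat and S :: "'x :: real_normed_vector set" and x :: 'x
    and w p :: "'x \<Rightarrow> h1" and dw dp :: "'x \<Rightarrow> h1"
  assumes x: "x \<in> S" and PF: "\<And>x. x \<in> S \<Longrightarrow> (w x, p x) \<in> PF_space N"
    and w_deriv: "(w has_derivative dw) (at x within S)"
    and p_deriv: "(p has_derivative dp) (at x within S)"
    and dw_0: "\<And>h k. k \<notin> {1..int N} \<Longrightarrow> h1_coeff (dw h) k = 0"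
    and dp_0: "\<And>h k. k \<notin> {1..int N} \<Longrightarrow> h1_coeff (dp h) k = 0"
begin

abbreviation "W \<equiv> h1_coeff (w x)"
abbreviation "P \<equiv> h1_coeff (p x)"
abbreviation "G \<equiv> gam (w x) (p x)"

lemma wF: "y \<in> S \<Longrightarrow> w y \<in> F_space N" and pH: "y \<in> S \<Longrightarrow> p y \<in> H1p0"
  and nz: "y \<in> S \<Longrightarrow> h1_fun (w y) t \<noteq> 0"
  using PF [of y] by (auto simp: PF_space_iff H1p0_def Oset_def)

lemma W_deriv: "((\<lambda>y. h1_coeff (w y) k) has_derivative (\<lambda>h. h1_coeff (dw h) k)) (at x within S)"
  by (rule bounded_linear.has_derivative [OF bounded_linear_h1_coeff w_deriv])

lemma P_deriv: "((\<lambda>y. h1_coeff (p y) k) has_derivative (\<lambda>h. h1_coeff (dp h) k)) (at x within S)"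
  by (rule bounded_linear.has_derivative [OF bounded_linear_h1_coeff p_deriv])

lemma gam_deriv:
  assumes i: "1 \<le> i"
  shows "((\<lambda>y. gam (w y) (p y) i) has_derivative
    (\<lambda>h. \<Sum>l=1..int N. P (l - i) * h1_coeff (dw h) l + W (l + i) * h1_coeff (dp h) l)) (at x within S)"
proof -
  have "((\<lambda>y. \<Sum>m=1..int N. h1_coeff (w y) (m + i) * h1_coeff (p y) m) has_derivative
      (\<lambda>h. \<Sum>m=1..int N. W (m + i) * h1_coeff (dp h) m + h1_coeff (dw h) (m + i) * P m)) (at x within S)"
    by (intro has_derivative_sum has_derivative_mult W_deriv P_deriv)
  also have "(\<lambda>h. \<Sum>m=1..int N. W (m + i) * h1_coeff (dp h) m + h1_coeff (dw h) (m + i) * P m) =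
      (\<lambda>h. \<Sum>l=1..int N. P (l - i) * h1_coeff (dw h) l + W (l + i) * h1_coeff (dp h) l)"
  proof
    fix h
    have "(\<Sum>m=1..int N. h1_coeff (dw h) (m + i) * P m) = (\<Sum>l=1+i..int N+i. h1_coeff (dw h) l * P (l - i))"
      by (rule sum.reindex_bij_witness [of _ "\<lambda>l. l - i" "\<lambda>m. m + i"]) auto
    also have "\<dots> = (\<Sum>l=1..int N+i. h1_coeff (dw h) l * P (l - i))"
      using i by (intro sum.mono_neutral_left) (auto intro!: H1p0_coeff pH x)
    also have "\<dots> = (\<Sum>l=1..int N. h1_coeff (dw h) l * P (l - i))"
      using i by (intro sum.mono_neutral_right) (auto simp: dw_0)
    finally show "(\<Sum>m=1..int N. W (m + i) * h1_coeff (dp h) m + h1_coeff (dw h) (m + i) * P m) =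
      (\<Sum>l=1..int N. P (l - i) * h1_coeff (dw h) l + W (l + i) * h1_coeff (dp h) l)"
      by (simp add: sum.distrib mult.commute add.commute)
  qed
  finally show ?thesis
    by (rule has_derivative_transform [OF x, rotated]) (simp add: gam_finite wF pH i)
qed

lemma gam2_deriv:
  assumes i: "1 \<le> i"
  shows "((\<lambda>y. gam2 (w y) (p y) i) has_derivative
    (\<lambda>h. \<Sum>l=1..int N. psq N (p x) (l - i) * h1_coeff (dw h) l + 2 * G (l + i) * h1_coeff (dp h) l)) (at x within S)"
proof -
  let ?dG = "\<lambda>i h. \<Sum>l=1..int N. P (l - i) * h1_coeff (dw h) l + W (l + i) * h1_coeff (dp h) l"
  have "((\<lambda>y. \<Sum>m=1..int N. gam (w y) (p y) (m + i) * h1_coeff (p y) m) has_derivative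
      (\<lambda>h. \<Sum>m=1..int N. G (m + i) * h1_coeff (dp h) m + ?dG (m + i) h * P m)) (at x within S)"
    using i by (intro has_derivative_sum has_derivative_mult gam_deriv P_deriv) auto
  also have "(\<lambda>h. \<Sum>m=1..int N. G (m + i) * h1_coeff (dp h) m + ?dG (m + i) h * P m) =
      (\<lambda>h. \<Sum>l=1..int N. psq N (p x) (l - i) * h1_coeff (dw h) l + 2 * G (l + i) * h1_coeff (dp h) l)"
  proof
    fix h
    have "(\<Sum>m=1..int N. ?dG (m + i) h * P m) =
        (\<Sum>m=1..int N. \<Sum>l=1..int N. P m * P (l - i - m) * h1_coeff (dw h) l + W (m + (l + i)) * P m * h1_coeff (dp h) l)"
      by (simp add: sum_distrib_left algebra_simps)
    also have "\<dots> = (\<Sum>l=1..int N. \<Sum>m=1..int N. P m * P (l - i - m) * h1_coeff (dw h) l + W (m + (l + i)) * P m * h1_coeff (dp h) l)"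
      by (rule sum.swap)
    also have "\<dots> = (\<Sum>l=1..int N. psq N (p x) (l - i) * h1_coeff (dw h) l + G (l + i) * h1_coeff (dp h) l)"
      using i by (intro sum.cong refl) (simp add: psq_def gam_finite [OF wF [OF x] pH [OF x]] sum.distrib sum_distrib_right)
    finally have *: "(\<Sum>m=1..int N. ?dG (m + i) h * P m) =
        (\<Sum>l=1..int N. psq N (p x) (l - i) * h1_coeff (dw h) l + G (l + i) * h1_coeff (dp h) l)" .
    show "(\<Sum>m=1..int N. G (m + i) * h1_coeff (dp h) m + ?dG (m + i) h * P m) =
      (\<Sum>l=1..int N. psq N (p x) (l - i) * h1_coeff (dw h) l + 2 * G (l + i) * h1_coeff (dp h) l)"
    proof -
      have "(\<Sum>m=1..int N. G (m + i) * h1_coeff (dp h) m + ?dG (m + i) h * P m) =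
        (\<Sum>l=1..int N. G (l + i) * h1_coeff (dp h) l) + (\<Sum>m=1..int N. ?dG (m + i) h * P m)"
        by (rule sum.distrib)
      also have "\<dots> = (\<Sum>l=1..int N. G (l + i) * h1_coeff (dp h) l +
          (psq N (p x) (l - i) * h1_coeff (dw h) l + G (l + i) * h1_coeff (dp h) l))"
        unfolding * by (rule sum.distrib [symmetric])
      also have "\<dots> = (\<Sum>l=1..int N. psq N (p x) (l - i) * h1_coeff (dw h) l + 2 * G (l + i) * h1_coeff (dp h) l)"
        by (rule sum.cong) (simp_all add: distrib_right)
      finally show ?thesis .
    qed
  qed
  finally show ?thesis
    by (rule has_derivative_transform [OF x, rotated]) (use i in \<open>simp add: gam2_finite wF pH\<close>)
qed

lemma phi_deriv:
  "((\<lambda>y. phi f (w y) i) has_derivative (\<lambda>h. \<Sum>l=1..int N. - psi f (w x) (i - l) * h1_coeff (dw h) l)) (at x within S)"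
proof -
  have "((\<lambda>y. phi f (w y) i) has_derivative
      (\<lambda>h. - fourier_coeff (\<lambda>y. h1_fun (dw h) y * (h1_fun f y / (h1_fun (w x) y)\<^sup>2)) i)) (at x within S)"
    by (rule has_derivative_compose [OF w_deriv phi_has_derivative]) (rule nz [OF x])
  moreover have "fourier_coeff (\<lambda>y. h1_fun (dw h) y * (h1_fun f y / (h1_fun (w x) y)\<^sup>2)) i =
      (\<Sum>l=1..int N. h1_coeff (dw h) l * psi f (w x) (i - l))" for h
  proof -
    have "((\<lambda>l. h1_coeff (dw h) l * psi f (w x) (i - l)) has_sum
        fourier_coeff (\<lambda>y. h1_fun (dw h) y * (h1_fun f y / (h1_fun (w x) y)\<^sup>2)) i) UNIV"
      unfolding psi_def using nz [OF x]
      by (intro has_sum_fourier_coeff_mult wiener_h1 continuous_intros h1_fun_continuous) auto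
    moreover have "((\<lambda>l. h1_coeff (dw h) l * psi f (w x) (i - l)) has_sum
        (\<Sum>l=1..int N. h1_coeff (dw h) l * psi f (w x) (i - l))) UNIV"
      by (rule has_sum_finite_neutralI) (auto simp: dw_0)
    ultimately show ?thesis using has_sum_unique by blast
  qed
  ultimately show ?thesis by (simp add: sum_negf mult.commute)
qed

lemma potential_deriv:
  assumes "1 \<le> i"
  shows "((\<lambda>y. potential f (w y) (p y) i) has_derivative
    (\<lambda>h. \<Sum>l=1..int N. qcoeff N f (w x) (p x) (l - i) * h1_coeff (dw h) l + 2 * G (l + i) * h1_coeff (dp h) l)) (at x within S)"
proof -
  have "(\<lambda>h. \<Sum>l=1..int N. qcoeff N f (w x) (p x) (l - i) * h1_coeff (dw h) l + 2 * G (l + i) * h1_coeff (dp h) l) =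
      (\<lambda>h. (\<Sum>l=1..int N. psq N (p x) (l - i) * h1_coeff (dw h) l + 2 * G (l + i) * h1_coeff (dp h) l)
        + (\<Sum>l=1..int N. - psi f (w x) (i - l) * h1_coeff (dw h) l))"
    by (auto simp: qcoeff_def sum.distrib [symmetric] algebra_simps intro!: sum.cong)
  then show ?thesis
    unfolding potential_def using has_derivative_add [OF gam2_deriv [OF assms] phi_deriv] by simp
qed

text \<open>The two halves of the product rule for \<open>g_i g_(k+1-i)\<close> agree after
  reflection. The \<open>dp\<close>-parts then combine into minors of \<open>g\<close> and
  \<open>w\<close>, and the last term of \<open>dJ_w\<close> comes from differentiating the factor
  \<open>w_i\<close> of the potential.\<close>

lemma J_int_has_derivative:
  assumes k: "k \<le> N"
  shows "((\<lambda>y. J_int f k (w y, p y)) has_derivative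
    (\<lambda>h. \<Sum>l=1..int N. dJ_p (w x, p x) (int k) l * h1_coeff (dp h) l
       + dJ_w N f (w x, p x) (int k) l * h1_coeff (dw h) l)) (at x within S)"
proof -
  let ?k = "int k" and ?V = "potential f (w x) (p x)" and ?q = "qcoeff N f (w x) (p x)"
  let ?dG = "\<lambda>i h. \<Sum>l=1..int N. P (l - i) * h1_coeff (dw h) l + W (l + i) * h1_coeff (dp h) l"
  let ?dV = "\<lambda>i h. \<Sum>l=1..int N. ?q (l - i) * h1_coeff (dw h) l + 2 * G (l + i) * h1_coeff (dp h) l"
  have "((\<lambda>y. \<Sum>i=1..?k. gam (w y) (p y) i * gam (w y) (p y) (?k + 1 - i)
      - h1_coeff (w y) i * potential f (w y) (p y) (?k + 1 - i)) has_derivative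
    (\<lambda>h. \<Sum>i=1..?k. (G i * ?dG (?k + 1 - i) h + ?dG i h * G (?k + 1 - i))
      - (W i * ?dV (?k + 1 - i) h + h1_coeff (dw h) i * ?V (?k + 1 - i)))) (at x within S)"
    by (intro has_derivative_sum has_derivative_diff has_derivative_mult gam_deriv W_deriv potential_deriv) auto
  also have "(\<lambda>h. \<Sum>i=1..?k. (G i * ?dG (?k + 1 - i) h + ?dG i h * G (?k + 1 - i))
      - (W i * ?dV (?k + 1 - i) h + h1_coeff (dw h) i * ?V (?k + 1 - i))) =
    (\<lambda>h. \<Sum>l=1..int N. dJ_p (w x, p x) ?k l * h1_coeff (dp h) l
       + dJ_w N f (w x, p x) ?k l * h1_coeff (dw h) l)"
  proof
    fix h
    let ?b = "h1_coeff (dp h)" and ?a = "h1_coeff (dw h)"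
    have 1: "(\<Sum>i=1..?k. ?dG i h * G (?k + 1 - i)) = (\<Sum>i=1..?k. G i * ?dG (?k + 1 - i) h)"
      using sum_reflect_int [of "\<lambda>i. ?dG i h * G (?k + 1 - i)" 1 ?k] by (simp add: mult.commute add.commute)
    have 2: "(\<Sum>i=1..?k. ?a i * ?V (?k + 1 - i)) = (\<Sum>l=1..int N. of_bool (l \<le> ?k) * ?V (?k + 1 - l) * ?a l)"
      using k by (intro sum.mono_neutral_cong_left) auto
    have split_1: "(\<Sum>i\<in>I. (a i + b i) - (c i + d i)) = (sum a I + sum b I) - (sum c I + sum d I)"
      and split_2: "(\<Sum>i\<in>I. 2 * a i * b i - c i) = (\<Sum>i\<in>I. a i * b i) + (\<Sum>i\<in>I. a i * b i) - sum c I"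
      for a b c d :: "int \<Rightarrow> complex" and I
      by (simp_all add: sum.distrib sum_subtractf sum_distrib_left mult.assoc)
    have "(\<Sum>i=1..?k. (G i * ?dG (?k + 1 - i) h + ?dG i h * G (?k + 1 - i))
      - (W i * ?dV (?k + 1 - i) h + ?a i * ?V (?k + 1 - i))) =
      (\<Sum>i=1..?k. 2 * G i * ?dG (?k + 1 - i) h - W i * ?dV (?k + 1 - i) h) - (\<Sum>i=1..?k. ?a i * ?V (?k + 1 - i))"
      unfolding split_1 split_2 1 by (simp only: diff_diff_eq)
    also have "(\<Sum>i=1..?k. 2 * G i * ?dG (?k + 1 - i) h - W i * ?dV (?k + 1 - i) h) =
      (\<Sum>i=1..?k. \<Sum>l=1..int N. (2 * G i * P (l - (?k + 1 - i)) - W i * ?q (l - (?k + 1 - i))) * ?a l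
          + 2 * (minor G W i (?k + l + 1 - i)) * ?b l)"
      unfolding sum_distrib_left sum_subtractf [symmetric]
      by (intro sum.cong refl) (simp add: minor_def algebra_simps)
    also have "\<dots> = (\<Sum>l=1..int N. \<Sum>i=1..?k. (2 * G i * P (l - (?k + 1 - i)) - W i * ?q (l - (?k + 1 - i))) * ?a l
          + 2 * (minor G W i (?k + l + 1 - i)) * ?b l)"
      by (rule sum.swap)
    also have "\<dots> = (\<Sum>l=1..int N. (\<Sum>i=1..?k. 2 * G i * P (l - (?k + 1 - i)) - W i * ?q (l - (?k + 1 - i))) * ?a l
          + dJ_p (w x, p x) ?k l * ?b l)"
      unfolding dJ_p_def bez_def fst_conv snd_conv sum_distrib_left sum_distrib_right sum.distrib [symmetric] ..
    finally show "(\<Sum>i=1..?k. (G i * ?dG (?k + 1 - i) h + ?dG i h * G (?k + 1 - i))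
      - (W i * ?dV (?k + 1 - i) h + ?a i * ?V (?k + 1 - i))) =
      (\<Sum>l=1..int N. dJ_p (w x, p x) ?k l * ?b l + dJ_w N f (w x, p x) ?k l * ?a l)"
      unfolding 2 sum_subtractf [symmetric] dJ_w_def
      by (simp add: left_diff_distrib add_diff_eq diff_add_eq add.commute)
  qed
  finally show ?thesis
    by (rule has_derivative_transform [OF x, rotated])
      (simp only: J_int_F_space [OF wF nz pH k] potential_def)
qed

end

section \<open>Involution\<close>

text \<open>For \<open>l > k\<close> only the first indicator of \<open>horner_mult\<close> can act
  and gives the head \<open>i \<le> k\<close> of a convolution. For \<open>l \<le> k\<close> only
  the second can, and it gives minus the tail \<open>i > k\<close>.\<close>

lemma sum_horner_mult:
  assumes u: "\<And>i. i \<le> 0 \<or> N + 1 < i \<Longrightarrow> u i = 0" and l: "1 \<le> l" "l \<le> N" and k: "0 \<le> k" "k \<le> N"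
  shows "(\<Sum>s=1..N. a s * horner_mult u k s l) =
    (if l \<le> k then - (\<Sum>i=k+1..N+1. u i * a (i - (k + 1 - l))) else (\<Sum>i=1..k. u i * a (l - (k + 1 - i))))"
proof (cases "l \<le> k")
  case True
  have "(\<Sum>s=1..N. a s * horner_mult u k s l) = (\<Sum>s=l..N + l - k. - (u (s + (k + 1 - l)) * a s))"
    using True assms by (intro sum.mono_neutral_cong_right) (auto simp: horner_mult_def algebra_simps)
  also have "\<dots> = (\<Sum>i=k+1..N+1. - (u i * a (i - (k + 1 - l))))"
    by (rule sum.reindex_bij_witness [of _ "\<lambda>i. i - (k + 1 - l)" "\<lambda>s. s + (k + 1 - l)"]) auto
  finally show ?thesis using True by (simp add: sum_negf)
next
  case False
  have "(\<Sum>s=1..N. a s * horner_mult u k s l) = (\<Sum>s=l-k..l-1. u (k + 1 - (l - s)) * a s)"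
    using False assms by (intro sum.mono_neutral_cong_right) (auto simp: horner_mult_def algebra_simps)
  also have "\<dots> = (\<Sum>i=1..k. u i * a (l - (k + 1 - i)))"
    by (rule sum.reindex_bij_witness [of _ "\<lambda>i. l - (k + 1 - i)" "\<lambda>s. k + 1 - (l - s)"]) auto
  finally show ?thesis using False by simp
qed

context
  fixes N :: nat and f w p :: h1
  assumes PF: "(w, p) \<in> PF_space N"
begin

private abbreviation "W \<equiv> h1_coeff w"
private abbreviation "P \<equiv> h1_coeff p"
private abbreviation "G \<equiv> gam w p"
private abbreviation "q \<equiv> qcoeff N f w p"

private lemma wF: "w \<in> F_space N" and pH: "p \<in> H1p0" and nz: "h1_fun w y \<noteq> 0"
  using PF by (auto simp: PF_space_iff H1p0_def Oset_def)

private lemma W0: "i \<le> 0 \<or> int N + 1 < i \<Longrightarrow> W i = 0"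
  using wF by (auto simp: F_space_iff)

private lemma G0: "i \<le> 0 \<or> int N < i \<Longrightarrow> G i = 0"
  using gam_eq_0 [OF wF pH] by (auto simp: gam_def)

private lemma P0: "i \<le> 0 \<or> int N < i \<Longrightarrow> P i = 0"
  using PF by (auto simp: PF_space_iff)

text \<open>The potential is itself a combination of \<open>p\<close> and \<open>q\<close> with the same coefficients as the other
  part of \<open>\<partial>J_k/\<partial>w_l\<close>; this cancels it there.\<close>

private lemma potential_eq:
  assumes r: "1 \<le> r"
  shows "(\<Sum>i=1..int N + 1. 2 * G i * P (i - r) - W i * q (i - r)) = potential f w p r"
proof -
  have 1: "(\<Sum>i=1..int N + 1. G i * P (i - r)) = gam2 w p r"
  proof -
    have "(\<Sum>i=1..int N + 1. G i * P (i - r)) = (\<Sum>m=1-r..int N + 1-r. G (m + r) * P m)"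
      by (rule sum.reindex_bij_witness [of _ "\<lambda>m. m + r" "\<lambda>i. i - r"]) auto
    also have "\<dots> = (\<Sum>m=1-r..int N. G (m + r) * P m)"
      using r by (intro sum.mono_neutral_left) (auto simp: G0)
    also have "\<dots> = (\<Sum>m=1..int N. G (m + r) * P m)"
      using r by (intro sum.mono_neutral_right) (auto simp: P0)
    finally show ?thesis using r by (simp add: gam2_finite [OF wF pH])
  qed
  have hk: "(\<Sum>i=1..int N + 1. W i * P (i - m)) = G m" if "1 \<le> m" for m
  proof -
    have "(\<Sum>i=1..int N + 1. W i * P (i - m)) = (\<Sum>n=1-m..int N + 1-m. W (n + m) * P n)"
      by (rule sum.reindex_bij_witness [of _ "\<lambda>n. n + m" "\<lambda>i. i - m"]) auto
    also have "\<dots> = (\<Sum>n=1-m..int N. W (n + m) * P n)"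
      using that by (intro sum.mono_neutral_left) (auto simp: W0)
    also have "\<dots> = (\<Sum>n=1..int N. W (n + m) * P n)"
      using that by (intro sum.mono_neutral_right) (auto simp: P0)
    finally show ?thesis using that by (simp add: gam_finite [OF wF pH])
  qed
  have "(\<Sum>i=1..int N + 1. W i * psq N p (i - r)) = (\<Sum>i=1..int N + 1. \<Sum>m=1..int N. P m * (W i * P (i - (m + r))))"
    unfolding psq_def sum_distrib_left by (intro sum.cong refl) (simp add: algebra_simps)
  also have "\<dots> = (\<Sum>m=1..int N. P m * (\<Sum>i=1..int N + 1. W i * P (i - (m + r))))"
    by (subst sum.swap) (simp only: sum_distrib_left)
  also have "\<dots> = gam2 w p r"
    unfolding gam2_finite [OF wF pH order_trans [OF zero_le_one r]]
    using r by (intro sum.cong refl) (subst hk, auto)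
  finally have 2: "(\<Sum>i=1..int N + 1. W i * psq N p (i - r)) = gam2 w p r" .
  have "(\<Sum>i=1..int N + 1. W i * psi f w (r - i)) = fourier_coeff (\<lambda>y. h1_fun w y * (h1_fun f y / (h1_fun w y)\<^sup>2)) r"
    unfolding psi_def using nz
    by (subst F_space_mult_coeff [OF wF]) (auto intro!: continuous_intros h1_fun_continuous)
  also have "(\<lambda>y. h1_fun w y * (h1_fun f y / (h1_fun w y)\<^sup>2)) = (\<lambda>y. h1_fun f y / h1_fun w y)"
    using nz by (auto simp: power2_eq_square)
  finally have 3: "(\<Sum>i=1..int N + 1. W i * psi f w (r - i)) = phi f w r"
    by (simp only: phi_def)
  have "(\<Sum>i=1..int N + 1. 2 * G i * P (i - r) - W i * q (i - r)) =
      2 * (\<Sum>i=1..int N + 1. G i * P (i - r)) - (\<Sum>i=1..int N + 1. W i * psq N p (i - r))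
        + (\<Sum>i=1..int N + 1. W i * psi f w (r - i))"
    unfolding sum_distrib_left sum_subtractf [symmetric] sum.distrib [symmetric]
    by (intro sum.cong refl) (simp add: qcoeff_def algebra_simps)
  then show ?thesis unfolding 1 2 3 potential_def by simp
qed

private lemma dJ_w_eq:
  assumes k: "0 \<le> k" "k \<le> int N" and l: "1 \<le> l" "l \<le> int N"
  shows "dJ_w N f (w, p) k l =
    (\<Sum>s=1..int N. 2 * P s * horner_mult G k s l - q s * horner_mult W k s l)"
proof -
  have G: "i \<le> 0 \<or> int N + 1 < i \<Longrightarrow> G i = 0" for i using G0 [of i] by auto
  have "(\<Sum>s=1..int N. 2 * P s * horner_mult G k s l - q s * horner_mult W k s l) =
      2 * (\<Sum>s=1..int N. P s * horner_mult G k s l) - (\<Sum>s=1..int N. q s * horner_mult W k s l)"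
    by (simp add: sum_subtractf sum_distrib_left mult.assoc)
  also have "\<dots> = dJ_w N f (w, p) k l"
  proof (cases "l \<le> k")
    case True
    have idx: "l - (k + 1 - i) = i - (k + 1 - l)" for i by simp
    have "potential f w p (k + 1 - l) = (\<Sum>i=1..k. 2 * G i * P (i - (k + 1 - l)) - W i * q (i - (k + 1 - l)))
        + (\<Sum>i=k+1..int N + 1. 2 * G i * P (i - (k + 1 - l)) - W i * q (i - (k + 1 - l)))"
      using potential_eq [of "k + 1 - l"] True k by (subst sum_split_int [symmetric]) auto
    moreover have "(\<Sum>s=1..int N. P s * horner_mult G k s l) = - (\<Sum>i=k+1..int N + 1. G i * P (i - (k + 1 - l)))"
      "(\<Sum>s=1..int N. q s * horner_mult W k s l) = - (\<Sum>i=k+1..int N + 1. W i * q (i - (k + 1 - l)))"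
      using sum_horner_mult [OF G l k, where a = P] sum_horner_mult [OF W0 l k, where a = q] True by simp_all
    moreover have "dJ_w N f (w, p) k l = (\<Sum>i=1..k. 2 * G i * P (i - (k + 1 - l)) - W i * q (i - (k + 1 - l)))
        - potential f w p (k + 1 - l)"
      using True by (simp add: dJ_w_def idx)
    ultimately show ?thesis
      by (simp add: sum_subtractf sum_distrib_left mult.assoc)
  next
    case False
    then have "(\<Sum>s=1..int N. P s * horner_mult G k s l) = (\<Sum>i=1..k. G i * P (l - (k + 1 - i)))"
      "(\<Sum>s=1..int N. q s * horner_mult W k s l) = (\<Sum>i=1..k. W i * q (l - (k + 1 - i)))"
      using sum_horner_mult [OF G l k, where a = P] sum_horner_mult [OF W0 l k, where a = q] by simp_all
    moreover have "dJ_w N f (w, p) k l = (\<Sum>i=1..k. 2 * G i * P (l - (k + 1 - i)) - W i * q (l - (k + 1 - i)))"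
      using False by (simp add: dJ_w_def)
    ultimately show ?thesis
      by (simp add: sum_subtractf sum_distrib_left mult.assoc)
  qed
  finally show ?thesis by simp
qed

text \<open>After exchanging the sums, the \<open>q\<close>-part contains the trilinear form with
  \<open>v = w\<close>, the \<open>p\<close>-part the one with \<open>v = \<Gamma>(w)p\<close>. The
  latter needs the Bezoutian with its arguments swapped, hence the sign of the factor 4.\<close>

lemma dJ_bracket_symmetric:
  assumes j: "0 \<le> j" "j \<le> int N" and k: "0 \<le> k" "k \<le> int N"
  shows "(\<Sum>l=1..int N. dJ_p (w, p) j l * dJ_w N f (w, p) k l) = (\<Sum>l=1..int N. dJ_p (w, p) k l * dJ_w N f (w, p) j l)"
proof -
  interpret GW: bez_pair G W "int N"
    using W0 G0 by unfold_locales auto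
  interpret WG: bez_pair W G "int N"
    using W0 G0 by unfold_locales auto
  have eq: "(\<Sum>l=1..int N. dJ_p (w, p) j l * dJ_w N f (w, p) k l) =
      (\<Sum>s=1..int N. - 4 * P s * WG.tri j k s - 2 * q s * GW.tri j k s)"
    if "0 \<le> k" "k \<le> int N" for j k
  proof -
    have "(\<Sum>l=1..int N. dJ_p (w, p) j l * dJ_w N f (w, p) k l) = (\<Sum>l=1..int N. \<Sum>s=1..int N.
        (2 * bez G W j l) * (2 * P s * horner_mult G k s l - q s * horner_mult W k s l))"
      using that by (intro sum.cong refl) (simp add: dJ_w_eq dJ_p_def sum_distrib_left)
    also have "\<dots> = (\<Sum>s=1..int N. \<Sum>l=1..int N.
        (2 * bez G W j l) * (2 * P s * horner_mult G k s l - q s * horner_mult W k s l))"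
      by (rule sum.swap)
    also have "\<dots> = (\<Sum>s=1..int N. - 4 * P s * WG.tri j k s - 2 * q s * GW.tri j k s)"
    proof (rule sum.cong [OF refl])
      fix s
      show "(\<Sum>l=1..int N. (2 * bez G W j l) * (2 * P s * horner_mult G k s l - q s * horner_mult W k s l))
          = - 4 * P s * WG.tri j k s - 2 * q s * GW.tri j k s"
        unfolding GW.tri_def WG.tri_def sum_distrib_left sum_subtractf [symmetric] bez_commute [of W G]
        by (intro sum.cong refl) (simp add: algebra_simps)
    qed
    finally show ?thesis .
  qed
  show ?thesis
    unfolding eq [OF k] eq [OF j]
    using j k by (intro sum.cong refl) (simp add: GW.tri_symmetric [of j k] WG.tri_symmetric [of j k])
qed

text \<open>Both identities behind this compare coefficients of \<open>e\<^sub>N\<^sub>+\<^sub>1\<close>: trivially \<open>w \<cdot> (f/w) = f\<close>, and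
  \<open>(\<Gamma>(w)p)\<^sup>2\<close> agrees with the product of \<open>w\<close> and the modes \<open>\<ge> 0\<close> of \<open>w \<cdot> p(-y)\<^sup>2\<close> in all modes
  beyond \<open>N\<close>.\<close>

lemma H_ham_eq_J_int: "H_ham f (w, p) = J_int f N (w, p) + h1_coeff f (int N + 1)"
proof -
  let ?N = "int N"
  have H: "H_ham f (w, p) = gam2 w p 0 + phi f w 0"
    by (simp add: pairing_square_eq [OF wF pH] phi_def fourier_coeff_def)
  have "(\<Sum>i=1..?N + 1. W i * phi f w (?N + 1 - i)) = fourier_coeff (\<lambda>y. h1_fun w y * (h1_fun f y / h1_fun w y)) (?N + 1)"
    unfolding phi_def using nz
    by (subst F_space_mult_coeff [OF wF]) (auto intro!: continuous_intros h1_fun_continuous)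
  also have "(\<lambda>y. h1_fun w y * (h1_fun f y / h1_fun w y)) = h1_fun f" using nz by auto
  finally have f: "(\<Sum>i=1..?N + 1. W i * phi f w (?N + 1 - i)) = h1_coeff f (?N + 1)" .
  \<comment> \<open>By \<open>bez_upper\<close> the sum may stop at \<open>i = m - 1\<close>, and
    there the other index exceeds \<open>N + 1\<close>.\<close>
  have bez0: "(\<Sum>i=1..?N+1. minor G W i (m + ?N + 1 - i)) = 0" if "1 \<le> m" for m
  proof -
    interpret bez_pair G W "int N"
      using W0 G0 by unfold_locales auto
    have "(\<Sum>i=1..?N+1. minor G W i (m + ?N + 1 - i)) = bez G W (m - 1) (?N + 1)"
      using bez_upper [of "m - 1" "?N + 1" G W] that by (simp add: algebra_simps)
    then show ?thesis by (simp add: bez_beyond)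
  qed
  have GG: "(\<Sum>i=1..?N + 1. G i * G (?N + 1 - i)) = (\<Sum>i=1..?N + 1. W i * gam2 w p (?N + 1 - i))"
  proof -
    have 1: "G i * G (?N + 1 - i) = (\<Sum>m=1..?N. P m * (G i * W (m + ?N + 1 - i)))" if "i \<in> {1..?N + 1}" for i
    proof (cases "i = ?N + 1")
      case False
      then have "G (?N + 1 - i) = (\<Sum>m=1..?N. W (m + ?N + 1 - i) * P m)"
        using that by (subst gam_finite [OF wF pH]) (auto simp: algebra_simps)
      then show ?thesis by (simp add: sum_distrib_left mult_ac)
    qed (simp add: G0)
    have 2: "W i * gam2 w p (?N + 1 - i) = (\<Sum>m=1..?N. P m * (W i * G (m + ?N + 1 - i)))" if "i \<in> {1..?N + 1}" for i
    proof -
      have "gam2 w p (?N + 1 - i) = (\<Sum>m=1..?N. G (m + ?N + 1 - i) * P m)"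
        using that by (subst gam2_finite [OF wF pH]) (auto simp: algebra_simps)
      then show ?thesis by (simp add: sum_distrib_left mult_ac)
    qed
    have "(\<Sum>i=1..?N + 1. G i * G (?N + 1 - i)) - (\<Sum>i=1..?N + 1. W i * gam2 w p (?N + 1 - i)) =
        (\<Sum>i=1..?N + 1. \<Sum>m=1..?N. P m * minor G W i (m + ?N + 1 - i))"
      unfolding sum_subtractf [symmetric]
      by (intro sum.cong refl, subst 1, assumption, subst 2, assumption)
        (simp only: minor_def right_diff_distrib sum_subtractf)
    also have "\<dots> = (\<Sum>m=1..?N. P m * (\<Sum>i=1..?N + 1. minor G W i (m + ?N + 1 - i)))"
      by (subst sum.swap) (simp only: sum_distrib_left)
    also have "\<dots> = 0" by (intro sum.neutral) (auto simp: bez0)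
    finally show ?thesis by simp
  qed
  have ext: "(\<Sum>i=1..?N + 1. a i) = (\<Sum>i=1..?N. a i) + a (?N + 1)" for a :: "int \<Rightarrow> complex"
    by (subst sum_split_int [of 1 ?N "?N + 1"]) auto
  have W1: "W (?N + 1) = 1" using wF by (simp add: F_space_iff)
  have "J_int f N (w, p) = (\<Sum>i=1..?N. G i * G (?N + 1 - i)) - (\<Sum>i=1..?N. W i * gam2 w p (?N + 1 - i))
      - (\<Sum>i=1..?N. W i * phi f w (?N + 1 - i))"
    unfolding J_int_F_space [OF wF nz pH order_refl] sum_subtractf [symmetric]
    by (intro sum.cong refl) (simp add: algebra_simps)
  \<comment> \<open>At \<open>i = N + 1\<close> the left summand contains
    \<open>gam w p 0 = 0\<close>, while the right one is \<open>gam2 w p 0\<close>. This term is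
    \<open>\<langle>w, p\<^sup>2\<rangle>\<close>, which \<open>H_f\<close> has and the sum for
    \<open>J_N\<close> lacks.\<close>
  moreover have "(\<Sum>i=1..?N. G i * G (?N + 1 - i)) = (\<Sum>i=1..?N. W i * gam2 w p (?N + 1 - i)) + gam2 w p 0"
    using GG unfolding ext W1 by (simp add: G0)
  moreover have "h1_coeff f (?N + 1) = (\<Sum>i=1..?N. W i * phi f w (?N + 1 - i)) + phi f w 0"
    using f unfolding ext W1 by simp
  ultimately show ?thesis unfolding H by (simp only:) simp
qed

end

section \<open>The finite-dimensional flow\<close>

lemma sum_int_eq_sum_nat: "(\<Sum>l=1..int N. g l) = (\<Sum>l=1..N. g (int l))"
  by (rule sum.reindex_bij_witness [of _ int nat]) auto

lemma J_int_deriv_w_PF: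
  assumes PF: "(w, p) \<in> PF_space N" and l: "1 \<le> l" "l \<le> int N" and k: "k \<le> N"
  shows "((\<lambda>z. J_int f k (w + h1_mode z l, p)) has_field_derivative dJ_w N f (w, p) (int k) l) (at 0)"
proof -
  obtain \<delta> where \<delta>: "\<delta> > 0" "\<And>z. cmod z < \<delta> \<Longrightarrow> (w + h1_mode z l, p) \<in> PF_space N"
    using eventually_PF_space_add_w [OF PF l] by (auto simp: eventually_nhds_metric)
  interpret PF_curve N "ball 0 \<delta>" 0 "\<lambda>z. w + h1_mode z l" "\<lambda>_. p" "\<lambda>z. h1_mode z l" "\<lambda>_. 0"
    using \<delta> l by unfold_locales (auto intro!: derivative_eq_intros has_derivative_h1_mode split: if_splits)
  have "(\<Sum>i=1..int N. dJ_p (w, p) (int k) i * h1_coeff 0 i + dJ_w N f (w, p) (int k) i * h1_coeff (h1_mode z l) i)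
      = dJ_w N f (w, p) (int k) l * z" for z
    using l by (subst sum.remove [of _ l]) (auto intro!: sum.neutral)
  then show ?thesis
    using J_int_has_derivative [OF k, of f] \<delta>(1)
    by (simp add: has_field_derivative_def at_within_open [of 0 "ball 0 \<delta>"] del: J_int.simps)
qed

lemma J_int_deriv_p_PF:
  assumes PF: "(w, p) \<in> PF_space N" and l: "1 \<le> l" "l \<le> int N" and k: "k \<le> N"
  shows "((\<lambda>z. J_int f k (w, p + h1_mode z l)) has_field_derivative dJ_p (w, p) (int k) l) (at 0)"
proof -
  interpret PF_curve N UNIV 0 "\<lambda>_. w" "\<lambda>z. p + h1_mode z l" "\<lambda>_. 0" "\<lambda>z. h1_mode z l"
    using PF_space_add_p [OF PF l] l
    by unfold_locales (auto intro!: derivative_eq_intros has_derivative_h1_mode split: if_splits)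
  have "(\<Sum>i=1..int N. dJ_p (w, p) (int k) i * h1_coeff (h1_mode z l) i + dJ_w N f (w, p) (int k) i * h1_coeff 0 i)
      = dJ_p (w, p) (int k) l * z" for z
    using l by (subst sum.remove [of _ l]) (auto intro!: sum.neutral)
  then show ?thesis
    using J_int_has_derivative [OF k, of f]
    by (simp add: has_field_derivative_def del: J_int.simps)
qed

text \<open>An additive constant does not affect derivatives, so this covers each \<open>J_k\<close>
  with \<open>c = 0\<close> and \<open>H_f\<close> with \<open>k = N\<close> and \<open>c\<close>
  the mode \<open>N + 1\<close> of \<open>f\<close>.\<close>

context
  fixes N k :: nat and f :: h1 and F :: "h1 \<times> h1 \<Rightarrow> complex" and c :: complex
  assumes k: "k \<le> N"
    and F: "restrict F (PF_space N) = restrict (\<lambda>x. J_int f k x + c) (PF_space N)"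
begin

lemma
  assumes "(w, p) \<in> PF_space N" "l \<in> {1..N}"
  shows restrict_deriv_w: "((\<lambda>z. restrict F (PF_space N) (w + h1_mode z (int l), p)) has_field_derivative dJ_w N f (w, p) (int k) (int l)) (at 0)"
    and dF_w_restrict: "dF_w (restrict F (PF_space N)) l (w, p) = dJ_w N f (w, p) (int k) (int l)"
    and restrict_deriv_p: "((\<lambda>z. restrict F (PF_space N) (w, p + h1_mode z (int l))) has_field_derivative dJ_p (w, p) (int k) (int l)) (at 0)"
    and dF_p_restrict: "dF_p (restrict F (PF_space N)) l (w, p) = dJ_p (w, p) (int k) (int l)"
proof -
  have l: "1 \<le> l" "l \<le> N" "1 \<le> int l" "int l \<le> int N" using assms by auto
  have w: "((\<lambda>z. J_int f k (w + h1_mode z (int l), p) + c) has_field_derivative dJ_w N f (w, p) (int k) (int l)) (at 0)"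
    using DERIV_add [OF J_int_deriv_w_PF [OF assms(1) l(3,4) k] DERIV_const] by simp
  have p: "((\<lambda>z. J_int f k (w, p + h1_mode z (int l)) + c) has_field_derivative dJ_p (w, p) (int k) (int l)) (at 0)"
    using DERIV_add [OF J_int_deriv_p_PF [OF assms(1) l(3,4) k] DERIV_const] by simp
  show "((\<lambda>z. restrict F (PF_space N) (w + h1_mode z (int l), p)) has_field_derivative dJ_w N f (w, p) (int k) (int l)) (at 0)"
    "dF_w (restrict F (PF_space N)) l (w, p) = dJ_w N f (w, p) (int k) (int l)"
    unfolding F by (rule restrict_PF_deriv_w [OF assms(1) l(1,2) w])+
  show "((\<lambda>z. restrict F (PF_space N) (w, p + h1_mode z (int l))) has_field_derivative dJ_p (w, p) (int k) (int l)) (at 0)"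
    "dF_p (restrict F (PF_space N)) l (w, p) = dJ_p (w, p) (int k) (int l)"
    unfolding F by (rule restrict_PF_deriv_p [OF assms(1) l(1,2) p])+
qed

lemma PF_differentiable_restrict: "PF_differentiable N (restrict F (PF_space N))"
  unfolding PF_differentiable_def field_differentiable_def
  using restrict_deriv_w restrict_deriv_p by blast

text \<open>Along a solution the derivative of \<open>J_j\<close> is the bracket of
  \<open>J_k\<close> and \<open>J_j\<close>, which vanishes; on an interval the function is then
  constant.\<close>

lemma PF_integral_restrict:
  assumes j: "j \<le> N"
  shows "PF_integral N (restrict F (PF_space N)) (restrict (J_int f j) (PF_space N))"
  unfolding PF_integral_def
proof (intro allI impI ballI, elim conjE)
  fix S w p s t
  assume int: "is_interval S" and sol: "PF_solution N (restrict F (PF_space N)) S w p" and st: "s \<in> S" "t \<in> S"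
  have PF: "(w r, p r) \<in> PF_space N" if "r \<in> S" for r
    using sol that by (auto simp: PF_solution_def)
  have "((\<lambda>r. J_int f j (w r, p r)) has_derivative (\<lambda>h. 0)) (at r within S)" if r: "r \<in> S" for r
  proof -
    let ?a = "\<lambda>l. dJ_p (w r, p r) (int k) (int l)" and ?b = "\<lambda>l. - dJ_w N f (w r, p r) (int k) (int l)"
    have dW: "((\<lambda>s. h1_coeff (w s) (int l)) has_vector_derivative ?a l) (at r within S)"
      and dP: "((\<lambda>s. h1_coeff (p s) (int l)) has_vector_derivative ?b l) (at r within S)"
      if "l \<in> {1..N}" for l
      using sol r that unfolding PF_solution_def
      by (metis dF_p_restrict [OF PF [OF r] that], metis dF_w_restrict [OF PF [OF r] that])
    \<comment> \<open>A solution is given through the derivatives of its coordinates only. Writing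
      \<open>w\<close> and \<open>p\<close> as finite sums of modes gives differentiability in
      \<open>h1\<close>; the \<open>+ 0\<close> in \<open>?dw\<close> is the derivative of the fixed
      top mode.\<close>
    let ?w = "\<lambda>s. (\<Sum>l=1..N. h1_mode (h1_coeff (w s) (int l)) (int l)) + h1_mode 1 (int N + 1)"
    let ?dw = "\<lambda>h. h *\<^sub>R ((\<Sum>l=1..N. h1_mode (?a l) (int l)) + 0)" and ?dp = "\<lambda>h. h *\<^sub>R (\<Sum>l=1..N. h1_mode (?b l) (int l))"
    have modes: "h1_coeff (\<Sum>l=1..N. h1_mode (d l) (int l)) i = (if i \<in> {1..int N} then d (nat i) else 0)" for d i
    proof (cases "i \<in> {1..int N}")
      case True
      then have "h1_coeff (\<Sum>l=1..N. h1_mode (d l) (int l)) i = d (nat i)"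
        unfolding h1_coeff_sum by (subst sum.remove [of _ "nat i"]) (auto intro!: sum.neutral split: if_splits)
      then show ?thesis using True by simp
    qed (auto simp: h1_coeff_sum intro!: sum.neutral)
    have w_eq: "w s = ?w s" and p_eq: "p s = (\<Sum>l=1..N. h1_mode (h1_coeff (p s) (int l)) (int l))" if "s \<in> S" for s
      unfolding Pi_le_def [symmetric] using PF [OF that]
      by (auto simp: PF_space_iff F_space_iff h1_coeff_Pi_le h1_coeff_add not_le intro!: h1_eqI)
    have "(?w has_derivative ?dw) (at r within S)"
      unfolding has_vector_derivative_def [symmetric]
      by (intro has_vector_derivative_add has_vector_derivative_sum has_vector_derivative_const
          bounded_linear.has_vector_derivative [OF bounded_linear_h1_mode] dW)
    then have wd: "(w has_derivative ?dw) (at r within S)"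
      by (rule has_derivative_transform [OF r, rotated]) (rule w_eq)
    have "((\<lambda>s. \<Sum>l=1..N. h1_mode (h1_coeff (p s) (int l)) (int l)) has_derivative ?dp) (at r within S)"
      unfolding has_vector_derivative_def [symmetric]
      by (intro has_vector_derivative_sum bounded_linear.has_vector_derivative [OF bounded_linear_h1_mode] dP)
    then have pd: "(p has_derivative ?dp) (at r within S)"
      by (rule has_derivative_transform [OF r, rotated]) (rule p_eq)
    interpret PF_curve N S r w p ?dw ?dp
      using r PF wd pd by unfold_locales (auto simp: h1_coeff_scaleR modes simp del: One_nat_def split: if_splits)
    have "(\<Sum>l=1..int N. dJ_p (w r, p r) (int j) l * h1_coeff (?dp h) l + dJ_w N f (w r, p r) (int j) l * h1_coeff (?dw h) l)
      = h *\<^sub>R ((\<Sum>l=1..int N. dJ_p (w r, p r) (int k) l * dJ_w N f (w r, p r) (int j) l)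
          - (\<Sum>l=1..int N. dJ_p (w r, p r) (int j) l * dJ_w N f (w r, p r) (int k) l))" for h
    proof -
      have "h1_coeff (?dp h) l = h *\<^sub>R - dJ_w N f (w r, p r) (int k) l"
        "h1_coeff (?dw h) l = h *\<^sub>R dJ_p (w r, p r) (int k) l" if "l \<in> {1..int N}" for l
        unfolding add_0_right h1_coeff_scaleR modes using that by simp_all
      then have "(\<Sum>l=1..int N. dJ_p (w r, p r) (int j) l * h1_coeff (?dp h) l + dJ_w N f (w r, p r) (int j) l * h1_coeff (?dw h) l)
        = (\<Sum>l=1..int N. h *\<^sub>R (dJ_p (w r, p r) (int k) l * dJ_w N f (w r, p r) (int j) l
            - dJ_p (w r, p r) (int j) l * dJ_w N f (w r, p r) (int k) l))"
        by (intro sum.cong refl) (simp only: scaleR_conv_of_real, simp add: algebra_simps)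
      then show ?thesis by (simp only: scaleR_sum_right [symmetric] sum_subtractf)
    qed
    moreover have "(\<Sum>l=1..int N. dJ_p (w r, p r) (int k) l * dJ_w N f (w r, p r) (int j) l)
        = (\<Sum>l=1..int N. dJ_p (w r, p r) (int j) l * dJ_w N f (w r, p r) (int k) l)"
      using j k by (intro dJ_bracket_symmetric [OF PF [OF r]]) auto
    ultimately show ?thesis
      using J_int_has_derivative [OF j, of f] by simp
  qed
  then obtain d where "\<And>r. r \<in> S \<Longrightarrow> J_int f j (w r, p r) = d"
    using has_derivative_zero_constant [OF is_interval_convex [OF int], of "\<lambda>r. J_int f j (w r, p r)"] by blast
  then show "restrict (J_int f j) (PF_space N) (w s, p s) = restrict (J_int f j) (PF_space N) (w t, p t)"
    using PF st by (simp del: J_int.simps)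
qed

end

lemma J_int_in_involution:
  assumes "j \<le> N" "k \<le> N"
  shows "in_involution N (restrict (J_int f j) (PF_space N)) (restrict (J_int f k) (PF_space N))"
  unfolding in_involution_def
proof
  fix x assume "x \<in> PF_space N"
  moreover obtain w p where x: "x = (w, p)" by (cases x)
  ultimately have PF: "(w, p) \<in> PF_space N" by simp
  have triv: "restrict (J_int f i) (PF_space N) = restrict (\<lambda>x. J_int f i x + 0) (PF_space N)" for i
    by simp
  have "poisson N (restrict (J_int f j) (PF_space N)) (restrict (J_int f k) (PF_space N)) x =
      (\<Sum>l=1..N. dJ_p (w, p) (int j) (int l) * dJ_w N f (w, p) (int k) (int l) -
        dJ_w N f (w, p) (int j) (int l) * dJ_p (w, p) (int k) (int l))"
    unfolding poisson_def x
    by (intro sum.cong refl)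
      (simp only: dF_w_restrict [OF assms(1) triv PF] dF_w_restrict [OF assms(2) triv PF]
        dF_p_restrict [OF assms(1) triv PF] dF_p_restrict [OF assms(2) triv PF])
  also have "\<dots> = (\<Sum>l=1..int N. dJ_p (w, p) (int j) l * dJ_w N f (w, p) (int k) l) -
      (\<Sum>l=1..int N. dJ_p (w, p) (int k) l * dJ_w N f (w, p) (int j) l)"
    unfolding sum_int_eq_sum_nat sum_subtractf by (simp add: mult.commute)
  also have "\<dots> = 0"
    using dJ_bracket_symmetric [OF PF, of "int j" "int k" f] assms by simp
  finally show "poisson N (restrict (J_int f j) (PF_space N)) (restrict (J_int f k) (PF_space N)) x = 0" .
qed

theorem proposition8p1:
  fixes f :: h1 and N :: nat
  assumes "N \<ge> 2"
  shows "\<forall>F \<in> insert (H_ham f) (J_int f ` {1..N}).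
    (\<forall>l T w p w\<^sub>0 p\<^sub>0.
        2 \<le> l \<and> 0 < T \<and> Ck_on l {0..<T} (\<lambda>t. (w t, p t)) \<and>
        ham_solution F {0..<T} w p \<and> (w 0, p 0) = (w\<^sub>0, p\<^sub>0) \<and> (w\<^sub>0, p\<^sub>0) \<in> HF_space N \<longrightarrow>
        (\<forall>t\<in>{0..<T}. w t \<in> F_space N) \<and> Ck_on l {0..<T} w \<and>
        (\<forall>t\<in>{0..<T}. (w t, Pi_le N (p t)) \<in> PF_space N) \<and>
        Ck_on l {0..<T} (\<lambda>t. (w t, Pi_le N (p t))) \<and>
        PF_solution N (restrict F (PF_space N)) {0..<T} w (\<lambda>t. Pi_le N (p t)) \<and>
        (w 0, Pi_le N (p 0)) = (w\<^sub>0, Pi_le N p\<^sub>0)) \<and>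
    PF_differentiable N (restrict F (PF_space N)) \<and>
    (\<forall>k\<in>{1..N}. PF_differentiable N (restrict (J_int f k) (PF_space N)) \<and>
        PF_integral N (restrict F (PF_space N)) (restrict (J_int f k) (PF_space N))) \<and>
    (\<forall>j\<in>{1..N}. \<forall>k\<in>{1..N}.
        in_involution N (restrict (J_int f j) (PF_space N)) (restrict (J_int f k) (PF_space N)))"
proof
  fix F assume "F \<in> insert (H_ham f) (J_int f ` {1..N})"
  then obtain k c where k: "k \<le> N" and F: "F = H_ham f \<or> F = J_int f k"
    and red: "restrict F (PF_space N) = restrict (\<lambda>x. J_int f k x + c) (PF_space N)"
  proof
    assume F: "F = H_ham f"
    show thesis
    proof (rule that [of N "h1_coeff f (int N + 1)"])
      show "restrict F (PF_space N) = restrict (\<lambda>x. J_int f N x + h1_coeff f (int N + 1)) (PF_space N)"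
        unfolding F by (rule restrict_ext) (use H_ham_eq_J_int in auto)
    qed (use F in auto)
  next
    assume "F \<in> J_int f ` {1..N}"
    then obtain k where "F = J_int f k" "k \<le> N" by auto
    then show thesis using that [of k 0] by simp
  qed
  have flow: "(\<forall>t\<in>{0..<T}. w t \<in> F_space N) \<and> Ck_on l {0..<T} w \<and>
        (\<forall>t\<in>{0..<T}. (w t, Pi_le N (p t)) \<in> PF_space N) \<and>
        Ck_on l {0..<T} (\<lambda>t. (w t, Pi_le N (p t))) \<and>
        PF_solution N (restrict F (PF_space N)) {0..<T} w (\<lambda>t. Pi_le N (p t)) \<and>
        (w 0, Pi_le N (p 0)) = (w\<^sub>0, Pi_le N p\<^sub>0)"
    if Ck: "Ck_on l {0..<T} (\<lambda>t. (w t, p t))" and sol: "ham_solution F {0..<T} w p"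
      and init: "(w 0, p 0) = (w\<^sub>0, p\<^sub>0)" "(w\<^sub>0, p\<^sub>0) \<in> HF_space N" for l T w p w\<^sub>0 p\<^sub>0
  proof -
    have w0: "w 0 \<in> F_space N" using init by (auto simp: HF_space_def)
    have PF: "PF_solution N (restrict F (PF_space N)) {0..<T} w (\<lambda>t. Pi_le N (p t))"
      by (rule ham_solution_reduces [OF F sol w0])
    have "Ck_on l {0..<T} (\<lambda>t. fst (w t, p t))"
      by (rule Ck_on_bounded_linear [OF bounded_linear_fst Ck])
    moreover have "Ck_on l {0..<T} (\<lambda>t. (fst (w t, p t), Pi_le N (snd (w t, p t))))"
      by (rule Ck_on_bounded_linear [OF bounded_linear_Pair [OF bounded_linear_fst
          bounded_linear_compose [OF bounded_linear_Pi_le bounded_linear_snd]] Ck])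
    ultimately show ?thesis
      using PF F_space_invariant [OF F sol w0] init by (simp add: PF_solution_def)
  qed
  have J: "restrict (J_int f k) (PF_space N) = restrict (\<lambda>x. J_int f k x + 0) (PF_space N)" for k
    by simp
  show "(\<forall>l T w p w\<^sub>0 p\<^sub>0.
        2 \<le> l \<and> 0 < T \<and> Ck_on l {0..<T} (\<lambda>t. (w t, p t)) \<and>
        ham_solution F {0..<T} w p \<and> (w 0, p 0) = (w\<^sub>0, p\<^sub>0) \<and> (w\<^sub>0, p\<^sub>0) \<in> HF_space N \<longrightarrow>
        (\<forall>t\<in>{0..<T}. w t \<in> F_space N) \<and> Ck_on l {0..<T} w \<and>
        (\<forall>t\<in>{0..<T}. (w t, Pi_le N (p t)) \<in> PF_space N) \<and>
        Ck_on l {0..<T} (\<lambda>t. (w t, Pi_le N (p t))) \<and>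
        PF_solution N (restrict F (PF_space N)) {0..<T} w (\<lambda>t. Pi_le N (p t)) \<and>
        (w 0, Pi_le N (p 0)) = (w\<^sub>0, Pi_le N p\<^sub>0)) \<and>
    PF_differentiable N (restrict F (PF_space N)) \<and>
    (\<forall>k\<in>{1..N}. PF_differentiable N (restrict (J_int f k) (PF_space N)) \<and>
        PF_integral N (restrict F (PF_space N)) (restrict (J_int f k) (PF_space N))) \<and>
    (\<forall>j\<in>{1..N}. \<forall>k\<in>{1..N}.
        in_involution N (restrict (J_int f j) (PF_space N)) (restrict (J_int f k) (PF_space N)))"
  proof (intro conjI ballI)
    show "\<forall>l T w p w\<^sub>0 p\<^sub>0.
        2 \<le> l \<and> 0 < T \<and> Ck_on l {0..<T} (\<lambda>t. (w t, p t)) \<and>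
        ham_solution F {0..<T} w p \<and> (w 0, p 0) = (w\<^sub>0, p\<^sub>0) \<and> (w\<^sub>0, p\<^sub>0) \<in> HF_space N \<longrightarrow>
        (\<forall>t\<in>{0..<T}. w t \<in> F_space N) \<and> Ck_on l {0..<T} w \<and>
        (\<forall>t\<in>{0..<T}. (w t, Pi_le N (p t)) \<in> PF_space N) \<and>
        Ck_on l {0..<T} (\<lambda>t. (w t, Pi_le N (p t))) \<and>
        PF_solution N (restrict F (PF_space N)) {0..<T} w (\<lambda>t. Pi_le N (p t)) \<and>
        (w 0, Pi_le N (p 0)) = (w\<^sub>0, Pi_le N p\<^sub>0)"
      by (intro allI impI, elim conjE) (rule flow)
    show "PF_differentiable N (restrict F (PF_space N))"
      by (rule PF_differentiable_restrict [OF k red])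
  next
    fix k' assume "k' \<in> {1..N}"
    then have k': "k' \<le> N" by simp
    show "PF_differentiable N (restrict (J_int f k') (PF_space N))"
      by (rule PF_differentiable_restrict [OF k' J])
    show "PF_integral N (restrict F (PF_space N)) (restrict (J_int f k') (PF_space N))"
      by (rule PF_integral_restrict [OF k red k'])
  next
    fix i j assume "i \<in> {1..N}" "j \<in> {1..N}"
    then show "in_involution N (restrict (J_int f i) (PF_space N)) (restrict (J_int f j) (PF_space N))"
      by (intro J_int_in_involution) auto
  qed
qed

end
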